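(* Let $\Xi\in C(\mathbb T^n)$. For every $T>0$ and $P\in\mathbb R^n$, the functional $\mu\mapsto H_{\Xi,T}(\mu,P)$ is continuous on $\overline{\mathcal M}$ with respect to the weak-* topology. In addition, for every $\mu\in\overline{\mathcal M}$ and $P\in\mathbb R^n$, $$\lim_{T\to0^+}H_{\Xi,T}(\mu,P)=H_\Xi(\mu,P).$$
   Context: $\mathbb T^n=\mathbb R^n/\mathbb Z^n$ is the flat torus and $\overline{\mathcal M}$ is the set of Borel probability measures on $\mathbb T^n$ with the weak-* topology (duality with $C(\mathbb T^n)$). For $\mu\in\overline{\mathcal M}$, $P\in\mathbb R^n$: $$F(\mu,P)=\frac12\inf_{\phi\in C^1(\mathbb T^n)}\int_{\mathbb T^n}|\nabla\phi+P|^2\,d\mu,\qquad H_\Xi(\mu,P)=\int_{\mathbb T^n}\Xi\,d\mu+F(\mu,P).$$ For $T>0$, $\overline{\mathcal M}_T(\mu)$ is the set of weak-* continuous curves $\hat\mu=(\mu_{(t)})_{t\in[0,T]}$ in $\overline{\mathcal M}$ with $\mu_{(0)}=\mu_{(T)}=\mu$. For such a curve, $$F(\hat\mu,P,T)=\frac1T\inf_{\phi}\int_0^T\!\!\int_{\mathbb T^n}\Big[\frac{\partial\phi}{\partial t}+\frac12|\nabla_x\phi+P|^2\Big]d\mu_{(t)}\,dt\in[-\infty,\infty),$$ the infimum being over $\phi\in C^1_0(\mathbb T^n\times(0,T))$ ($C^1$ functions compactly supported in $\mathbb T^n\times(0,T)$). Finally, $$H_{\Xi,T}(\mu,P)=\sup_{\hat\mu\in\overline{\mathcal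 M}_T(\mu)}\Big[\frac1T\int_0^T\!\!\int_{\mathbb T^n}\Xi\,d\mu_{(t)}\,dt+F(\hat\mu,P,T)\Big].$$ *)

theory Defs
  imports "HOL-Probability.Probability"
begin

quotient_type 'n torus = "real ^ 'n::finite" / "\<lambda>x y. \<forall>i. x $ i - y $ i \<in> \<int>"
  morphisms rep_torus torus_proj
proof (rule equivpI)
  show "reflp (\<lambda>x y::real ^ 'n. \<forall>i. x $ i - y $ i \<in> \<int>)"
    by (simp add: reflp_def)
  show "symp (\<lambda>x y::real ^ 'n. \<forall>i. x $ i - y $ i \<in> \<int>)"
  proof (rule sympI, rule allI)
    fix x y :: "real ^ 'n" and i
    assume "\<forall>i. x $ i - y $ i \<in> \<int>"
    then have "- (x $ i - y $ i) \<in> \<int>"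
      by (intro Ints_minus) auto
    then show "y $ i - x $ i \<in> \<int>" by simp
  qed
  show "transp (\<lambda>x y::real ^ 'n. \<forall>i. x $ i - y $ i \<in> \<int>)"
  proof (rule transpI, rule allI)
    fix x y z :: "real ^ 'n" and i
    assume "\<forall>i. x $ i - y $ i \<in> \<int>" "\<forall>i. y $ i - z $ i \<in> \<int>"
    then have "(x $ i - y $ i) + (y $ i - z $ i) \<in> \<int>"
      by (intro Ints_add) auto
    then show "x $ i - z $ i \<in> \<int>" by simp
  qed
qed

text \<open>The torus carries the quotient topology.\<close>

instantiation torus :: (finite) topological_space
begin

definition open_torus :: "'a torus set \<Rightarrow> bool" where
  "open_torus U \<longleftrightarrow> open (torus_proj -` U)"

instance
  by standard (auto simp: open_torus_def vimage_Union intro: open_Int)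

end

definition torus_probs :: "'n::finite torus measure set" where
  "torus_probs = {\<mu>. prob_space \<mu> \<and> sets \<mu> = sets borel}"

text \<open>The coarsest topology on the set of probability measures making all functionals
  \<open>\<mu> \<mapsto> \<integral> f d\<mu>\<close> with \<open>f\<close> continuous on the torus continuous.\<close>

definition weak_star :: "'n::finite torus measure topology" where
  "weak_star = topology_generated_by
     {{\<mu> \<in> torus_probs. (\<integral>x. f x \<partial>\<mu>) \<in> U} | (f :: 'n torus \<Rightarrow> real) U.
        continuous_on UNIV f \<and> open U}"

lemma topspace_weak_star: "topspace (weak_star :: 'n::finite torus measure topology) = torus_probs"
proof -
  have "\<Union> {{\<mu> \<in> torus_probs. (\<integral>x. f x \<partial>\<mu>) \<in> U} | (f :: 'n torus \<Rightarrow> real) U.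
        continuous_on UNIV f \<and> open U} = (torus_probs :: 'n torus measure set)"
  proof
    have "\<exists>(f :: 'n torus \<Rightarrow> real) U. torus_probs = {\<mu> \<in> torus_probs. (\<integral>x. f x \<partial>\<mu>) \<in> U}
        \<and> continuous_on UNIV f \<and> open U"
      by (rule exI[of _ "\<lambda>_. 0"], rule exI[of _ UNIV]) auto
    then show "(torus_probs :: 'n torus measure set) \<subseteq>
      \<Union> {{\<mu> \<in> torus_probs. (\<integral>x. f x \<partial>\<mu>) \<in> U} | (f :: 'n torus \<Rightarrow> real) U.
        continuous_on UNIV f \<and> open U}"
      by (intro Union_upper) blast
  qed auto
  then show ?thesis
    by (simp add: weak_star_def topology_generated_by_topspace)
qed

text \<open>Derivatives on the torus are those of the periodic lift to Euclidean space.\<close>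

definition has_torus_gradient :: "('n::finite torus \<Rightarrow> real) \<Rightarrow> real ^ 'n \<Rightarrow> 'n torus \<Rightarrow> bool" where
  "has_torus_gradient \<phi> v q \<longleftrightarrow> (\<forall>x. torus_proj x = q \<longrightarrow> GDERIV (\<lambda>y. \<phi> (torus_proj y)) x :> v)"

definition torus_gradient :: "('n::finite torus \<Rightarrow> real) \<Rightarrow> 'n torus \<Rightarrow> real ^ 'n" where
  "torus_gradient \<phi> q = (THE v. has_torus_gradient \<phi> v q)"

definition torus_C1 :: "('n::finite torus \<Rightarrow> real) set" where
  "torus_C1 = {\<phi>. (\<forall>q. \<exists>v. has_torus_gradient \<phi> v q) \<and> continuous_on UNIV (torus_gradient \<phi>)}"

text \<open>A compactly supported function on the product of the torus with the open interval from
  \<open>0\<close> to \<open>T\<close> is identified with its extension by zero to all times. It is \<open>C\<^sup>1\<close> iff its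
  space and time derivatives exist and are jointly continuous.\<close>

definition spacetime_C1_0 :: "real \<Rightarrow> ('n::finite torus \<times> real \<Rightarrow> real) set" where
  "spacetime_C1_0 T = {\<phi>.
     (\<forall>q t. \<exists>v. has_torus_gradient (\<lambda>y. \<phi> (y, t)) v q) \<and>
     (\<forall>q t. (\<lambda>s. \<phi> (q, s)) differentiable (at t)) \<and>
     continuous_on UNIV (\<lambda>(q, t). torus_gradient (\<lambda>y. \<phi> (y, t)) q) \<and>
     continuous_on UNIV (\<lambda>(q, t). deriv (\<lambda>s. \<phi> (q, s)) t) \<and>
     compact (closure {p. \<phi> p \<noteq> 0}) \<and>
     closure {p. \<phi> p \<noteq> 0} \<subseteq> UNIV \<times> {0<..<T}}"

definition F_stat :: "'n::finite torus measure \<Rightarrow> real ^ 'n \<Rightarrow> real" where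
  "F_stat \<mu> P = 1 / 2 * (INF \<phi>\<in>torus_C1. \<integral>x. (norm (torus_gradient \<phi> x + P))\<^sup>2 \<partial>\<mu>)"

definition H_stat :: "('n::finite torus \<Rightarrow> real) \<Rightarrow> 'n torus measure \<Rightarrow> real ^ 'n \<Rightarrow> real" where
  "H_stat \<Xi> \<mu> P = (\<integral>x. \<Xi> x \<partial>\<mu>) + F_stat \<mu> P"

text \<open>Curves are functions on the real line of which only the restriction to
  \<open>[0, T]\<close> matters.\<close>

definition loops :: "real \<Rightarrow> 'n::finite torus measure \<Rightarrow> (real \<Rightarrow> 'n torus measure) set" where
  "loops T \<mu> = {m. continuous_map (top_of_set {0..T}) weak_star m \<and> m 0 = \<mu> \<and> m T = \<mu>}"

definition F_dyn :: "(real \<Rightarrow> 'n::finite torus measure) \<Rightarrow> real ^ 'n \<Rightarrow> real \<Rightarrow> ereal" where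
  "F_dyn m P T = ereal (1 / T) *
     (INF \<phi>\<in>spacetime_C1_0 T. ereal
        (LBINT t:{0..T}. (\<integral>x. deriv (\<lambda>s. \<phi> (x, s)) t +
            1 / 2 * (norm (torus_gradient (\<lambda>y. \<phi> (y, t)) x + P))\<^sup>2 \<partial>(m t))))"

definition H_dyn ::
    "('n::finite torus \<Rightarrow> real) \<Rightarrow> real \<Rightarrow> 'n torus measure \<Rightarrow> real ^ 'n \<Rightarrow> ereal" where
  "H_dyn \<Xi> T \<mu> P =
     (SUP m\<in>loops T \<mu>. ereal (1 / T * (LBINT t:{0..T}. (\<integral>x. \<Xi> x \<partial>(m t)))) + F_dyn m P T)"

end

(* A lower bound on F_dyn along a loop m is an inequality (action_ge) that is additive under
   concatenation of curves once the test functions are freed from their compact support; a smooth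
   cutoff in time shows that this costs exactly the boundary terms. If mu and nu admit a coupling of small cost, moving mass along
   short segments in a short time joins them by a curve whose action is bounded below by a small
   negative number. Inserting such curves at both ends of a slightly accelerated near-optimal loop
   at mu gives a loop at nu, and conversely. Measures that are weak-* close have a coupling of small
   cost, so H_dyn is uniformly continuous in this sense and no compactness of curves is needed.

   For small T, constant loops give H_dyn >= H_stat. Conversely, the stationary test function
   psi(x) bounds the value of a loop m by the time average of the integrals of
   Xi + |grad psi + P|^2 / 2 against m, and the test function -(t / T) f(x), with f a C^1
   approximation of that function, shows that this average is close to the integral against mu. *)

theory Submission
  imports Defs
begin

section \<open>The torus and weak-* continuous curves\<close>

text \<open>A lower bound on the action is dual to a kinetic energy. If particles move with velocity
  \<open>v\<close>, then \<open>\<phi>\<close> changes along them at the rate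
  \<open>d + v . g\<close>, and \<open>|g + P - v|^2 \<ge> 0\<close> bounds the action below by the
  mean of \<open>P . v - |v|^2 / 2\<close>. Connecting curves get their bound in this way, while a
  given loop is known only through its inequality: no velocity is ever extracted from it. The order
  of choices matters. Connecting curves take a time \<open>\<delta>\<close>, which the loop must
  give up by running faster; this changes the effective \<open>P\<close> and is absorbed by
  convexity. Their kinetic cost is of order \<open>e / \<delta>\<close> for a coupling of cost
  \<open>e\<close>. Hence \<open>\<delta>\<close> is chosen first and \<open>e\<close> afterwards,
  both from \<open>T\<close>, \<open>P\<close>, the bound on \<open>\<Xi>\<close> and the tolerance.
  As neither depends on the measures, exchanging \<open>\<mu>\<close> and \<open>\<nu>\<close> gives
  the other half of continuity. \<open>F_dyn\<close> is an extended real, so the comparisons start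
  from a real number strictly below the value of a loop.\<close>

lemma torus_proj_eq_iff: "torus_proj x = torus_proj y \<longleftrightarrow> (\<forall>i. x $ i - y $ i \<in> \<int>)"
  using torus.abs_eq_iff[of x y] by (simp add: eq_onp_def)

lemma torus_proj_rep [simp]: "torus_proj (rep_torus q) = q"
  by (rule Quotient3_abs_rep[OF Quotient3_torus])

lemma continuous_on_torus_proj [continuous_intros]:
  fixes f :: "'a::topological_space \<Rightarrow> real ^ 'n::finite"
  shows "continuous_on S f \<Longrightarrow> continuous_on S (\<lambda>x. torus_proj (f x))"
proof -
  have "continuous_on UNIV (torus_proj :: real ^ 'n \<Rightarrow> _)"
    by (auto simp: continuous_on_open_vimage open_torus_def)
  then show "continuous_on S f \<Longrightarrow> continuous_on S (\<lambda>x. torus_proj (f x) :: 'n torus)"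
    by (rule continuous_on_compose2) auto
qed

lemma continuous_on_torusI:
  fixes f :: "'n::finite torus \<Rightarrow> 'b::topological_space"
  assumes "continuous_on UNIV (\<lambda>x. f (torus_proj x))"
  shows "continuous_on UNIV f"
  using assms by (auto simp: continuous_on_open_vimage open_torus_def vimage_def)

text \<open>The saturation of \<open>U\<close> is the union of its integer translates.\<close>

lemma open_torus_proj_image:
  fixes U :: "(real ^ 'n::finite) set"
  assumes "open U"
  shows "open (torus_proj ` U)"
proof -
  have "torus_proj -` torus_proj ` U = (\<Union>k\<in>{k. \<forall>i. k $ i \<in> \<int>}. (\<lambda>x. k + x) ` U)"
  proof (intro subset_antisym subsetI)
    fix y assume "y \<in> torus_proj -` torus_proj ` U"
    then obtain x where x: "x \<in> U" "torus_proj y = torus_proj x" by auto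
    have "y = (y - x) + x" by simp
    with x show "y \<in> (\<Union>k\<in>{k. \<forall>i. k $ i \<in> \<int>}. (\<lambda>x. k + x) ` U)"
      by (intro UN_I[of "y - x"]) (auto simp: torus_proj_eq_iff)
  next
    fix y assume "y \<in> (\<Union>k\<in>{k. \<forall>i. k $ i \<in> \<int>}. (\<lambda>x. k + x) ` U)"
    then obtain k x where "\<forall>i. k $ i \<in> \<int>" "x \<in> U" "y = k + x" by auto
    then have "torus_proj y = torus_proj x" by (simp add: torus_proj_eq_iff)
    with \<open>x \<in> U\<close> show "y \<in> torus_proj -` torus_proj ` U" by auto
  qed
  then show ?thesis
    using assms by (auto simp: open_torus_def intro!: open_UN open_translation)
qed

text \<open>The product of a quotient map with an identity need not be a quotient map; here it is
  one because the projection is open.\<close>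

lemma continuous_on_torus_prodI:
  fixes f :: "'n::finite torus \<times> 'a::topological_space \<Rightarrow> 'b::topological_space"
  assumes "continuous_on UNIV (\<lambda>(x, t). f (torus_proj x, t))"
  shows "continuous_on UNIV f"
proof -
  have "open (f -` V)" if V: "open V" for V
  proof (rule open_prod_intro)
    fix p assume p: "p \<in> f -` V"
    obtain q t where [simp]: "p = (q, t)" by (cases p)
    have "open ((\<lambda>(x, t). f (torus_proj x, t)) -` V)"
      using assms V by (auto simp: continuous_on_open_vimage)
    moreover have "(rep_torus q, t) \<in> (\<lambda>(x, t). f (torus_proj x, t)) -` V"
      using p by simp
    ultimately obtain A B where "open A" "open B" "(rep_torus q, t) \<in> A \<times> B"
      "A \<times> B \<subseteq> (\<lambda>(x, t). f (torus_proj x, t)) -` V"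
      by (rule open_prod_elim)
    moreover from this have "p \<in> torus_proj ` A \<times> B"
      using image_eqI[of q torus_proj "rep_torus q" A] by simp
    moreover have "torus_proj ` A \<times> B \<subseteq> f -` V"
      using \<open>A \<times> B \<subseteq> _\<close> by auto
    ultimately show "\<exists>A B. open A \<and> open B \<and> p \<in> A \<times> B \<and> A \<times> B \<subseteq> f -` V"
      by (intro exI[of _ "torus_proj ` A"] exI[of _ B] conjI open_torus_proj_image)
  qed
  then show ?thesis by (auto simp: continuous_on_open_vimage)
qed

lemma compact_torus: "compact (UNIV :: 'n::finite torus set)"
proof -
  have "UNIV = torus_proj ` cbox (0 :: real ^ 'n) 1"
  proof -
    have "q \<in> torus_proj ` cbox (0 :: real ^ 'n) 1" for q :: "'n torus"
    proof
      show "q = torus_proj (\<chi> i. frac (rep_torus q $ i))"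
        by (subst torus_proj_rep[symmetric], subst torus_proj_eq_iff) (simp add: frac_def)
      show "(\<chi> i. frac (rep_torus q $ i)) \<in> cbox (0 :: real ^ 'n) 1"
        by (auto simp: mem_box_cart intro: less_imp_le frac_lt_1)
    qed
    then show ?thesis by auto
  qed
  also have "compact \<dots>"
    by (intro compact_continuous_image continuous_intros compact_cbox)
  finally show ?thesis .
qed

lemma continuous_on_torus_bounded:
  fixes f :: "'n::finite torus \<Rightarrow> 'b::real_normed_vector"
  assumes "continuous_on UNIV f"
  obtains C where "C \<ge> 0" "\<And>x. norm (f x) \<le> C"
proof -
  have "bounded (range f)"
    by (intro compact_imp_bounded compact_continuous_image assms compact_torus)
  then obtain C where "\<And>x. norm (f x) \<le> C" by (auto simp: bounded_iff)
  moreover from this have "C \<ge> 0" using norm_ge_zero[of "f undefined"] order_trans by blast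
  ultimately show thesis by (intro that[of C]) auto
qed

lemma torus_probsD:
  assumes "\<mu> \<in> torus_probs"
  shows "prob_space \<mu>" "sets \<mu> = sets borel" "space \<mu> = UNIV"
  using assms sets_eq_imp_space_eq[of \<mu> borel] by (auto simp: torus_probs_def)

lemma integrable_torus:
  fixes f :: "'n::finite torus \<Rightarrow> real"
  assumes "\<mu> \<in> torus_probs" "continuous_on UNIV f"
  shows "integrable \<mu> f"
proof -
  interpret prob_space \<mu> using torus_probsD[OF assms(1)] by simp
  obtain C where "\<And>x. norm (f x) \<le> C" using continuous_on_torus_bounded[OF assms(2)] by metis
  moreover have "f \<in> borel_measurable \<mu>"
    using borel_measurable_continuous_onI[OF assms(2)] torus_probsD(2)[OF assms(1)]
    by (metis measurable_cong_sets)
  ultimately show ?thesis by (intro integrable_const_bound[of _ C]) auto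
qed

lemma integral_torus_mono:
  fixes f g :: "'n::finite torus \<Rightarrow> real"
  assumes "\<mu> \<in> torus_probs" "continuous_on UNIV f" "continuous_on UNIV g" "\<And>x. f x \<le> g x"
  shows "(\<integral>x. f x \<partial>\<mu>) \<le> (\<integral>x. g x \<partial>\<mu>)"
  by (intro integral_mono integrable_torus assms)

lemma measure_torus_space [simp]:
  assumes "\<mu> \<in> torus_probs" shows "measure \<mu> (space \<mu>) = 1"
  by (intro prob_space.prob_space torus_probsD assms)

lemma integral_torus_le:
  fixes f :: "'n::finite torus \<Rightarrow> real"
  assumes "\<mu> \<in> torus_probs" "continuous_on UNIV f" "\<And>x. f x \<le> C"
  shows "(\<integral>x. f x \<partial>\<mu>) \<le> C"
  using integral_torus_mono[OF assms(1,2), of "\<lambda>_. C"] assms by simp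

lemma integral_torus_ge:
  fixes f :: "'n::finite torus \<Rightarrow> real"
  assumes "\<mu> \<in> torus_probs" "continuous_on UNIV f" "\<And>x. C \<le> f x"
  shows "C \<le> (\<integral>x. f x \<partial>\<mu>)"
  using integral_torus_mono[OF assms(1) _ assms(2), of "\<lambda>_. C"] assms by simp

text \<open>Continuity tested against one function at a time, on an arbitrary interval.
  \<open>weak_curve_iff\<close> identifies it with continuity into \<open>weak_star\<close>; this
  form passes directly to integrals in time and to glued curves.\<close>

definition weak_curve :: "real \<Rightarrow> real \<Rightarrow> (real \<Rightarrow> 'n::finite torus measure) \<Rightarrow> bool" where
  "weak_curve a b m \<longleftrightarrow> (\<forall>t\<in>{a..b}. m t \<in> torus_probs) \<and>
     (\<forall>f :: 'n torus \<Rightarrow> real. continuous_on UNIV f \<longrightarrow> continuous_on {a..b} (\<lambda>t. \<integral>x. f x \<partial>m t))"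

lemma weak_curve_probs: "weak_curve a b m \<Longrightarrow> t \<in> {a..b} \<Longrightarrow> m t \<in> torus_probs"
  by (simp add: weak_curve_def)

lemma continuous_map_weak_star_integral:
  fixes f :: "'n::finite torus \<Rightarrow> real"
  assumes "continuous_on UNIV f"
  shows "continuous_map weak_star euclidean (\<lambda>\<mu>. \<integral>x. f x \<partial>\<mu>)"
  unfolding continuous_map_def topspace_weak_star
proof (intro conjI allI impI)
  fix U :: "real set" assume "openin euclidean U"
  then have "{\<mu> \<in> torus_probs. (\<integral>x. f x \<partial>\<mu>) \<in> U} \<in> {{\<mu> \<in> torus_probs. (\<integral>x. f x \<partial>\<mu>) \<in> U} | (f :: 'n torus \<Rightarrow> real) U.
        continuous_on UNIV f \<and> open U}" using assms by auto
  then show "openin weak_star {\<mu> \<in> torus_probs. (\<integral>x. f x \<partial>\<mu>) \<in> U}"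
    unfolding weak_star_def by (rule topology_generated_by_Basis)
qed auto

lemma weak_curve_iff:
  "weak_curve a b m \<longleftrightarrow> continuous_map (top_of_set {a..b}) weak_star m"
proof
  assume m: "weak_curve a b m"
  show "continuous_map (top_of_set {a..b}) weak_star m"
    unfolding weak_star_def
  proof (rule continuous_on_generated_topo)
    show "m ` topspace (top_of_set {a..b}) \<subseteq> \<Union> {{\<mu> \<in> torus_probs. (\<integral>x. f x \<partial>\<mu>) \<in> U} | (f :: 'a torus \<Rightarrow> real) U.
        continuous_on UNIV f \<and> open U}"
      using m topspace_weak_star[where 'n='a, unfolded weak_star_def topology_generated_by_topspace]
      by (auto simp: weak_curve_def)
  next
    fix V assume "V \<in> {{\<mu> \<in> torus_probs. (\<integral>x. f x \<partial>\<mu>) \<in> U} | (f :: 'a torus \<Rightarrow> real) U.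
        continuous_on UNIV f \<and> open U}"
    then obtain f :: "'a torus \<Rightarrow> real" and U where V: "V = {\<mu> \<in> torus_probs. (\<integral>x. f x \<partial>\<mu>) \<in> U}"
        "continuous_on UNIV f" "open U" by auto
    have "continuous_on {a..b} (\<lambda>t. \<integral>x. f x \<partial>m t)" using m V by (auto simp: weak_curve_def)
    then have "openin (top_of_set {a..b}) ({a..b} \<inter> (\<lambda>t. \<integral>x. f x \<partial>m t) -` U)"
      using V(3) by (simp add: continuous_openin_preimage_gen)
    moreover have "m -` V \<inter> topspace (top_of_set {a..b}) = {a..b} \<inter> (\<lambda>t. \<integral>x. f x \<partial>m t) -` U"
      using m V(1) by (auto simp: weak_curve_def)
    ultimately show "openin (top_of_set {a..b}) (m -` V \<inter> topspace (top_of_set {a..b}))" by simp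
  qed
next
  assume m: "continuous_map (top_of_set {a..b}) weak_star m"
  show "weak_curve a b m"
    unfolding weak_curve_def
  proof (intro conjI ballI allI impI)
    fix t assume "t \<in> {a..b}"
    then show "m t \<in> torus_probs" using m by (auto simp: continuous_map_def topspace_weak_star)
  next
    fix f :: "'a torus \<Rightarrow> real" assume "continuous_on UNIV f"
    from continuous_map_compose[OF m continuous_map_weak_star_integral[OF this]]
    show "continuous_on {a..b} (\<lambda>t. \<integral>x. f x \<partial>m t)" by (simp add: comp_def)
  qed
qed

lemma weak_curve_cong:
  assumes "weak_curve a b m" and eq: "\<And>t. t \<in> {a..b} \<Longrightarrow> m t = m' t"
  shows "weak_curve a b m'"
proof -
  have "continuous_on {a..b} (\<lambda>t. \<integral>x. f x \<partial>m' t) \<longleftrightarrow> continuous_on {a..b} (\<lambda>t. \<integral>x. f x \<partial>m t)"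
    for f :: "'a torus \<Rightarrow> real"
    by (rule continuous_on_cong) (simp_all add: eq)
  then show ?thesis using assms by (simp add: weak_curve_def)
qed

lemma weak_curve_const: "\<mu> \<in> torus_probs \<Longrightarrow> weak_curve a b (\<lambda>_. \<mu>)"
  by (auto simp: weak_curve_def)

lemma continuous_on_slice:
  assumes "continuous_on UNIV (\<lambda>(x, t). g x t)"
  shows "continuous_on UNIV (\<lambda>x. g x t)"
proof -
  have "continuous_on UNIV (\<lambda>x. (x, t))" by (intro continuous_intros)
  from continuous_on_compose2[OF assms this] show ?thesis by simp
qed

text \<open>Both the integrand and the measure move with \<open>t\<close>. Compactness of the torus
  makes \<open>g x t\<close> close to \<open>g x s\<close> uniformly in \<open>x\<close>, and for
  the integrand frozen at time \<open>s\<close> weak continuity applies.\<close>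

lemma continuous_on_integral_curve:
  fixes g :: "'n::finite torus \<Rightarrow> real \<Rightarrow> real"
  assumes m: "weak_curve a b m" and g: "continuous_on UNIV (\<lambda>(x, t). g x t)"
  shows "continuous_on {a..b} (\<lambda>t. \<integral>x. g x t \<partial>m t)"
  unfolding continuous_on_iff
proof (intro ballI allI impI)
  fix s e :: real assume s: "s \<in> {a..b}" and e: "e > 0"
  have gc: "continuous_on UNIV (\<lambda>x. g x t)" for t
    using g by (rule continuous_on_slice)
  have "continuous_on (UNIV \<times> UNIV) (\<lambda>(t, x). g x t)"
    using continuous_on_swap_args[OF g[folded UNIV_Times_UNIV]] by simp
  from continuous_on_prod_compactE[OF this compact_torus, of s "e / 3"]
  obtain X0 where X0: "s \<in> X0" "open X0" "\<forall>t\<in>X0 \<inter> UNIV. \<forall>x\<in>UNIV. dist (g x t) (g x s) \<le> e/3"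
    using e by auto
  obtain d1 where d1: "d1 > 0" "\<And>t. dist t s < d1 \<Longrightarrow> t \<in> X0"
    using X0 by (meson open_dist)
  have "continuous_on {a..b} (\<lambda>t. \<integral>x. g x s \<partial>m t)"
    using m gc by (auto simp: weak_curve_def)
  then obtain d2 where d2: "d2 > 0" "\<And>t. t \<in> {a..b} \<Longrightarrow> dist t s < d2 \<Longrightarrow>
     dist (\<integral>x. g x s \<partial>m t) (\<integral>x. g x s \<partial>m s) < e / 3"
    using s e unfolding continuous_on_iff by (metis divide_pos_pos zero_less_numeral)
  show "\<exists>d>0. \<forall>t\<in>{a..b}. dist t s < d \<longrightarrow> dist (\<integral>x. g x t \<partial>m t) (\<integral>x. g x s \<partial>m s) < e"
  proof (intro exI[of _ "min d1 d2"] conjI ballI impI)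
    fix t assume t: "t \<in> {a..b}" "dist t s < min d1 d2"
    have mt: "m t \<in> torus_probs" using m t by (auto simp: weak_curve_def)
    have "dist (g x t) (g x s) \<le> e/3" for x
      using X0(3) d1(2)[of t] t by auto
    then have "g x t \<le> g x s + e/3" "g x s - e/3 \<le> g x t" for x
      unfolding dist_real_def by (smt (verit))+
    then have "(\<integral>x. g x t \<partial>m t) \<le> (\<integral>x. g x s + e/3 \<partial>m t)"
       "(\<integral>x. g x s - e/3 \<partial>m t) \<le> (\<integral>x. g x t \<partial>m t)"
      by (auto intro!: integral_torus_mono[OF mt] gc continuous_intros)
    moreover have "(\<integral>x. g x s + e/3 \<partial>m t) = (\<integral>x. g x s \<partial>m t) + e/3"
      "(\<integral>x. g x s - e/3 \<partial>m t) = (\<integral>x. g x s \<partial>m t) - e/3"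
      using integrable_torus[OF mt gc, of s] integrable_torus[OF mt, of "\<lambda>_. e/3"] mt by (simp_all add: Bochner_Integration.integral_add Bochner_Integration.integral_diff)
    ultimately show "dist (\<integral>x. g x t \<partial>m t) (\<integral>x. g x s \<partial>m s) < e"
      using d2(2)[of t] t e unfolding dist_real_def by linarith
  qed (use d1 d2 in auto)
qed

section \<open>Space-time test functions and the action\<close>

lemma has_torus_gradient_unique:
  assumes "has_torus_gradient \<phi> v q" "has_torus_gradient \<phi> w q"
  shows "v = w"
proof -
  have "(\<lambda>h. h \<bullet> v) = (\<lambda>h. h \<bullet> w)"
    using assms unfolding has_torus_gradient_def gderiv_def
    by (metis has_derivative_unique torus_proj_rep)
  then show ?thesis by (metis vector_eq_ldot)
qed

lemma torus_gradient_eq: "has_torus_gradient \<phi> v q \<Longrightarrow> torus_gradient \<phi> q = v"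
  unfolding torus_gradient_def by (blast intro: has_torus_gradient_unique)

lemma has_torus_gradient_torus_gradient:
  "\<phi> \<in> torus_C1 \<Longrightarrow> has_torus_gradient \<phi> (torus_gradient \<phi> q) q"
  using torus_gradient_eq by (fastforce simp: torus_C1_def)

lemma continuous_on_has_torus_gradient:
  assumes "\<And>q. has_torus_gradient \<phi> (g q) q"
  shows "continuous_on UNIV \<phi>"
proof (rule continuous_on_torusI)
  show "continuous_on UNIV (\<lambda>x. \<phi> (torus_proj x))"
    using assms unfolding has_torus_gradient_def gderiv_def
    by (auto intro!: continuous_at_imp_continuous_on has_derivative_continuous)
qed

lemma torus_C1I:
  assumes "\<And>q. has_torus_gradient \<phi> (g q) q" "continuous_on UNIV g"
  shows "\<phi> \<in> torus_C1"
proof -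
  have "torus_gradient \<phi> = g" using assms torus_gradient_eq by blast
  then show ?thesis using assms by (auto simp: torus_C1_def)
qed

lemma has_torus_gradient_cmult:
  "has_torus_gradient \<phi> v q \<Longrightarrow> has_torus_gradient (\<lambda>x. c * \<phi> x) (c *\<^sub>R v) q"
  unfolding has_torus_gradient_def using GDERIV_mult[OF GDERIV_const] by fastforce

text \<open>Test functions without a support condition. The derivatives are explicit arguments, so
  that products and rescalings can be computed without going through \<open>torus_gradient\<close>
  and \<open>deriv\<close>.\<close>

definition spacetime_C1 ::
    "('n::finite torus \<Rightarrow> real \<Rightarrow> real) \<Rightarrow> ('n torus \<Rightarrow> real \<Rightarrow> real ^ 'n) \<Rightarrow> ('n torus \<Rightarrow> real \<Rightarrow> real) \<Rightarrow> bool" where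
  "spacetime_C1 \<phi> g d \<longleftrightarrow>
     (\<forall>q t. has_torus_gradient (\<lambda>y. \<phi> y t) (g q t) q) \<and>
     (\<forall>q t. (\<phi> q has_real_derivative d q t) (at t)) \<and>
     continuous_on UNIV (\<lambda>(q, t). g q t) \<and> continuous_on UNIV (\<lambda>(q, t). d q t)"

text \<open>Continuity of the time derivative, read as a bounded linear map, upgrades the partial
  derivatives to a joint one. This gives the chain rule along moving points and joint continuity of
  \<open>\<phi>\<close>.\<close>

lemma spacetime_C1_has_derivative:
  assumes "spacetime_C1 \<phi> g d"
  shows "((\<lambda>(x, t). \<phi> (torus_proj x) t) has_derivative
           (\<lambda>(h, s). h \<bullet> g (torus_proj x) t + s * d (torus_proj x) t)) (at (x, t))"
proof -
  let ?D = "\<lambda>x t. d (torus_proj x) t *\<^sub>R (id_blinfun :: real \<Rightarrow>\<^sub>L real)"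
  have lift: "continuous_on UNIV (\<lambda>(x, t). (torus_proj x :: 'a torus, t :: real))"
    unfolding case_prod_beta by (intro continuous_intros)
  have "continuous_on UNIV (\<lambda>(x, t). d (torus_proj x) t)"
    using continuous_on_compose2[OF _ lift, of UNIV "\<lambda>(x, t). d x t"] assms
    by (auto simp: spacetime_C1_def case_prod_beta)
  then have "continuous_on UNIV (\<lambda>(x, t). ?D x t)"
    unfolding case_prod_beta by (intro continuous_intros)
  then have "isCont (\<lambda>(x, t). ?D x t) (x, t)"
    by (simp add: continuous_on_eq_continuous_at)
  then have "((\<lambda>(x, t). ?D x t) \<longlongrightarrow> ?D x t) (at (x, t) within UNIV \<times> UNIV)"
    by (simp add: isCont_def)
  then have "((\<lambda>(x, t). \<phi> (torus_proj x) t) has_derivative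
           (\<lambda>(h, s). h \<bullet> g (torus_proj x) t + blinfun_apply (?D x t) s)) (at (x, t) within UNIV \<times> UNIV)"
    using assms
    by (intro has_derivative_partialsI)
       (auto simp: spacetime_C1_def has_torus_gradient_def gderiv_def has_field_derivative_def
          scaleR_blinfun.rep_eq continuous_within simp del: UNIV_Times_UNIV)
  then show ?thesis by (simp add: scaleR_blinfun.rep_eq mult.commute)
qed

lemma spacetime_C1_continuous:
  assumes "spacetime_C1 \<phi> g d"
  shows "continuous_on UNIV (\<lambda>(x, t). \<phi> x t)"
proof (rule continuous_on_torus_prodI)
  have "isCont (\<lambda>(x, t). \<phi> (torus_proj x) t) p" for p
    using has_derivative_continuous[OF spacetime_C1_has_derivative[OF assms]] by (cases p) auto
  then show "continuous_on UNIV (\<lambda>(x, t). (\<lambda>(x, t). \<phi> x t) (torus_proj x, t))"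
    by (simp add: continuous_at_imp_continuous_on)
qed

lemma spacetime_C1_integrand_continuous:
  assumes "spacetime_C1 \<phi> g d"
  shows "continuous_on UNIV (\<lambda>(x, t). d x t + 1/2 * (norm (g x t + P))\<^sup>2)"
  using assms unfolding spacetime_C1_def case_prod_beta by (auto intro!: continuous_intros)

text \<open>Serves the cutoff in time as well as the linear factor \<open>- t / T\<close> of the
  short-time limit.\<close>

lemma spacetime_C1_mult_time:
  assumes \<phi>: "spacetime_C1 \<phi> g d" and \<theta>: "\<And>t. (\<theta> has_real_derivative \<theta>' t) (at t)" "continuous_on UNIV \<theta>'"
  shows "spacetime_C1 (\<lambda>x t. \<theta> t * \<phi> x t) (\<lambda>x t. \<theta> t *\<^sub>R g x t) (\<lambda>x t. \<theta>' t * \<phi> x t + \<theta> t * d x t)"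
proof -
  have "continuous_on UNIV \<theta>"
    using \<theta>(1) by (auto intro!: continuous_at_imp_continuous_on DERIV_isCont)
  then have *: "continuous_on UNIV (\<lambda>x :: 'a torus \<times> real. \<theta> (snd x))" "continuous_on UNIV (\<lambda>x :: 'a torus \<times> real. \<theta>' (snd x))"
    using \<theta>(2) by (auto intro!: continuous_on_compose2[of UNIV \<theta>] continuous_on_compose2[of UNIV \<theta>'] continuous_intros)
  show ?thesis
    using assms(1) * spacetime_C1_continuous[OF \<phi>]
    unfolding spacetime_C1_def case_prod_beta
    by (auto intro!: continuous_intros has_torus_gradient_cmult DERIV_mult' \<theta>(1) derivative_eq_intros)
qed

lemma spacetime_C1_stationary:
  assumes "\<And>q. has_torus_gradient \<phi> (g q) q" "continuous_on UNIV g"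
  shows "spacetime_C1 (\<lambda>x t. \<phi> x) (\<lambda>x t. g x) (\<lambda>x t. 0)"
  using assms unfolding spacetime_C1_def case_prod_beta
  by (auto intro!: derivative_eq_intros continuous_on_compose2[of UNIV g] continuous_intros)

lemma continuous_on_affine_time:
  fixes f :: "'a::topological_space \<Rightarrow> real \<Rightarrow> 'b::topological_space"
  assumes "continuous_on UNIV (\<lambda>x. f (fst x) (snd x))"
  shows "continuous_on UNIV (\<lambda>x. f (fst x) (\<delta> + s * snd x))"
  by (rule continuous_on_compose2[OF assms, of UNIV "\<lambda>x. (fst x, \<delta> + s * snd x)", simplified])
     (intro continuous_intros)

lemma spacetime_C1_rescale:
  assumes \<phi>: "spacetime_C1 \<phi> g d"
  shows "spacetime_C1 (\<lambda>x t. k * \<phi> x (\<delta> + s * t)) (\<lambda>x t. k *\<^sub>R g x (\<delta> + s * t)) (\<lambda>x t. k * s * d x (\<delta> + s * t))"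
proof -
  have D: "((\<lambda>t. \<phi> q (\<delta> + s * t)) has_real_derivative d q (\<delta> + s * t) * s) (at t)" for q t
    by (rule DERIV_chain2[of "\<phi> q"]) (use \<phi> in \<open>auto simp: spacetime_C1_def intro!: derivative_eq_intros\<close>)
  have "((\<lambda>t. k * \<phi> q (\<delta> + s * t)) has_real_derivative k * s * d q (\<delta> + s * t)) (at t)" for q t
    by (rule DERIV_cong[OF DERIV_cmult[OF D, of k]]) simp
  then show ?thesis
    using \<phi> unfolding spacetime_C1_def case_prod_beta
    by (auto intro!: has_torus_gradient_cmult continuous_on_scaleR continuous_on_mult continuous_on_const
        continuous_on_affine_time[where f=d] continuous_on_affine_time[where f=g])
qed

text \<open>The constant \<open>c\<close> is not divided by the length of the interval, so that
  bounds on adjacent intervals add up while the boundary terms telescope.\<close>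

definition action_ge :: "real ^ 'n \<Rightarrow> real \<Rightarrow> real \<Rightarrow> (real \<Rightarrow> 'n::finite torus measure) \<Rightarrow> real \<Rightarrow> bool" where
  "action_ge P a b m c \<longleftrightarrow> (\<forall>\<phi> g d. spacetime_C1 \<phi> g d \<longrightarrow>
     (\<integral>x. \<phi> x b \<partial>m b) - (\<integral>x. \<phi> x a \<partial>m a) + c
       \<le> integral {a..b} (\<lambda>t. \<integral>x. d x t + 1/2 * (norm (g x t + P))\<^sup>2 \<partial>m t))"

lemma action_ge_cong:
  assumes "action_ge P a b m c" "\<And>t. t \<in> {a..b} \<Longrightarrow> m t = m' t" "a \<le> b"
  shows "action_ge P a b m' c"
proof -
  have "integral {a..b} (\<lambda>t. \<integral>x. f x t \<partial>m t) = integral {a..b} (\<lambda>t. \<integral>x. f x t \<partial>m' t)" for f :: "_ \<Rightarrow> _ \<Rightarrow> real"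
    by (rule integral_cong) (use assms in auto)
  moreover have "m a = m' a" "m b = m' b" using assms by auto
  ultimately show ?thesis using assms(1) by (simp add: action_ge_def)
qed

lemma integrable_on_curve:
  fixes f :: "'n::finite torus \<Rightarrow> real \<Rightarrow> real"
  assumes "weak_curve a b m" "continuous_on UNIV (\<lambda>(x, t). f x t)"
  shows "(\<lambda>t. \<integral>x. f x t \<partial>m t) integrable_on {a..b}"
  by (intro integrable_continuous_real continuous_on_integral_curve assms)

lemma action_ge_join:
  assumes "action_ge P a b m c" "action_ge P b e m c'" "weak_curve a e m" "a \<le> b" "b \<le> e"
  shows "action_ge P a e m (c + c')"
  unfolding action_ge_def
proof (intro allI impI)
  fix \<phi> g d assume \<phi>: "spacetime_C1 \<phi> g (d :: 'a torus \<Rightarrow> real \<Rightarrow> real)"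
  let ?I = "\<lambda>t. \<integral>x. d x t + 1/2 * (norm (g x t + P))\<^sup>2 \<partial>m t"
  have "integral {a..b} ?I + integral {b..e} ?I = integral {a..e} ?I"
    using assms by (intro Henstock_Kurzweil_Integration.integral_combine integrable_on_curve spacetime_C1_integrand_continuous[OF \<phi>])
  then show "(\<integral>x. \<phi> x e \<partial>m e) - (\<integral>x. \<phi> x a \<partial>m a) + (c + c') \<le> integral {a..e} ?I"
    using assms(1)[unfolded action_ge_def, rule_format, OF \<phi>]
      assms(2)[unfolded action_ge_def, rule_format, OF \<phi>] by linarith
qed

lemma LBINT_eq_integral:
  fixes f :: "real \<Rightarrow> real"
  assumes "continuous_on {a..b} f"
  shows "(LBINT t:{a..b}. f t) = integral {a..b} f"
  by (intro set_borel_integral_eq_integral borel_integrable_atLeastAtMost' assms)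

lemma spacetime_C1_0_imp:
  assumes "\<phi> \<in> spacetime_C1_0 T"
  shows "spacetime_C1 (\<lambda>x t. \<phi> (x, t)) (\<lambda>x t. torus_gradient (\<lambda>y. \<phi> (y, t)) x) (\<lambda>x t. deriv (\<lambda>s. \<phi> (x, s)) t)"
    and "t \<notin> {0<..<T} \<Longrightarrow> \<phi> (x, t) = 0"
proof -
  have "has_torus_gradient (\<lambda>y. \<phi> (y, t)) (torus_gradient (\<lambda>y. \<phi> (y, t)) q) q" for q t
    using assms torus_gradient_eq unfolding spacetime_C1_0_def by fastforce
  then show "spacetime_C1 (\<lambda>x t. \<phi> (x, t)) (\<lambda>x t. torus_gradient (\<lambda>y. \<phi> (y, t)) x) (\<lambda>x t. deriv (\<lambda>s. \<phi> (x, s)) t)"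
    using assms by (auto simp: spacetime_C1_def spacetime_C1_0_def DERIV_deriv_iff_real_differentiable)
  assume t: "t \<notin> {0<..<T}"
  have "\<phi> p = 0 \<or> p \<in> UNIV \<times> {0<..<T}" for p
    using assms closure_subset[of "{p. \<phi> p \<noteq> 0}"] by (force simp: spacetime_C1_0_def)
  from this[of "(x, t)"] t show "\<phi> (x, t) = 0" by auto
qed

text \<open>The margin \<open>e\<close> keeps the closure of the support inside the open time
  interval; the closed slab over \<open>[e, T - e]\<close> is compact because the torus is.\<close>

lemma spacetime_C1_0I:
  assumes \<phi>: "spacetime_C1 \<phi> g d" and z: "\<And>x t. t \<notin> {e..T - e} \<Longrightarrow> \<phi> x t = 0" and e: "0 < e"
  shows "(\<lambda>(x, t). \<phi> x t) \<in> spacetime_C1_0 T"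
proof -
  have g: "torus_gradient (\<lambda>y. \<phi> y t) x = g x t" for x t
    using \<phi> by (intro torus_gradient_eq) (auto simp: spacetime_C1_def)
  have d: "deriv (\<phi> x) t = d x t" for x t
    using \<phi> by (intro DERIV_imp_deriv) (auto simp: spacetime_C1_def)
  have "closed (UNIV \<times> {e..T - e} :: ('a torus \<times> real) set)" by (intro closed_Times) auto
  moreover have "{p. (case p of (x, t) \<Rightarrow> \<phi> x t) \<noteq> 0} \<subseteq> UNIV \<times> {e..T - e}"
    using z by (auto simp del: atLeastAtMost_iff)
  ultimately have cl: "closure {p. (case p of (x, t) \<Rightarrow> \<phi> x t) \<noteq> 0} \<subseteq> UNIV \<times> {e..T - e}"
    by (rule closure_minimal[rotated])
  have "compact (UNIV \<times> {e..T - e} :: ('a torus \<times> real) set)"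
    by (intro compact_Times compact_torus) auto
  from compact_Int_closed[OF this closed_closure[of "{p. (case p of (x, t) \<Rightarrow> \<phi> x t) \<noteq> 0}"]] cl
  have "compact (closure {p. (case p of (x, t) \<Rightarrow> \<phi> x t) \<noteq> 0})" by (simp add: Int_absorb1)
  moreover have "closure {p. (case p of (x, t) \<Rightarrow> \<phi> x t) \<noteq> 0} \<subseteq> UNIV \<times> {0<..<T}"
    using cl e by force
  ultimately show ?thesis
    using \<phi> unfolding spacetime_C1_0_def spacetime_C1_def
    by (auto simp: g case_prod_beta d real_differentiable_def intro!: exI[of _ "d _ _"])
qed

lemma F_dyn_ge:
  assumes "action_ge P 0 T m c" "weak_curve 0 T m" "T > 0"
  shows "ereal (c / T) \<le> F_dyn m P T"
proof -
  have "ereal c \<le> (INF \<phi>\<in>spacetime_C1_0 T. ereal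
        (LBINT t:{0..T}. (\<integral>x. deriv (\<lambda>s. \<phi> (x, s)) t +
            1 / 2 * (norm (torus_gradient (\<lambda>y. \<phi> (y, t)) x + P))\<^sup>2 \<partial>(m t))))"
  proof (rule INF_greatest)
    fix \<phi> :: "'a torus \<times> real \<Rightarrow> real" assume \<phi>: "\<phi> \<in> spacetime_C1_0 T"
    note C1 = spacetime_C1_0_imp(1)[OF \<phi>]
    have "\<phi> (x, 0) = 0" "\<phi> (x, T) = 0" for x using spacetime_C1_0_imp(2)[OF \<phi>] by auto
    then show "ereal c \<le> ereal (LBINT t:{0..T}. (\<integral>x. deriv (\<lambda>s. \<phi> (x, s)) t +
            1 / 2 * (norm (torus_gradient (\<lambda>y. \<phi> (y, t)) x + P))\<^sup>2 \<partial>(m t)))"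
      using assms(1) C1 LBINT_eq_integral[OF continuous_on_integral_curve[OF assms(2) spacetime_C1_integrand_continuous[OF C1, of P]]]
      by (fastforce simp: action_ge_def)
  qed
  from ereal_mult_left_mono[OF this, of "ereal (1 / T)"] show ?thesis
    using assms(3) by (simp add: F_dyn_def)
qed

section \<open>Removing the compact support\<close>

text \<open>Building block of the cutoff. At the kink the difference quotient is squeezed between
  \<open>0\<close> and \<open>\<bar>h\<bar>\<close>.\<close>

lemma has_real_derivative_pos_part_squared:
  "((\<lambda>u::real. (max 0 u)\<^sup>2) has_real_derivative 2 * max 0 u) (at u)"
proof (cases u "0 :: real" rule: linorder_cases)
  case equal
  have "((\<lambda>h. (max 0 h)\<^sup>2 / h) \<longlongrightarrow> 0) (at (0::real))"
  proof (rule tendsto_rabs_zero_cancel, rule tendsto_sandwich[of "\<lambda>_. 0" _ _ "\<lambda>h. \<bar>h\<bar>"])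
    show "((\<lambda>h::real. \<bar>h\<bar>) \<longlongrightarrow> 0) (at 0)" by (intro tendsto_eq_intros) auto
  qed (auto simp: max_def power2_eq_square)
  then show ?thesis using equal by (simp add: DERIV_def)
next
  case less
  have "((\<lambda>u::real. 0) has_real_derivative 2 * max 0 u) (at u)" using less by simp
  then show ?thesis
    by (rule has_field_derivative_transform_within_open[of _ _ _ "{..<0}"]) (use less in auto)
next
  case greater
  have "((\<lambda>u::real. u\<^sup>2) has_real_derivative 2 * max 0 u) (at u)"
    using greater by (auto intro!: derivative_eq_intros)
  then show ?thesis
    by (rule has_field_derivative_transform_within_open[of _ _ _ "{0<..}"]) (use greater in auto)
qed

lemma smooth_step_exists:
  obtains S S' :: "real \<Rightarrow> real" where
    "\<And>u. (S has_real_derivative S' u) (at u)" "continuous_on UNIV S'" "\<And>u. 0 \<le> S' u"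
    "\<And>u. u \<le> 0 \<Longrightarrow> S u = 0" "\<And>u. 1 \<le> u \<Longrightarrow> S u = 1" "\<And>u. u \<notin> {0..1} \<Longrightarrow> S' u = 0"
    "\<And>u. 0 \<le> S u" "\<And>u. S u \<le> 1"
proof -
  \<comment> \<open>A quadratic spline with knots 0, 1/2 and 1. Its derivative is the hat function
    that rises with slope 4 to the value 2 at 1/2 and falls back to 0 at 1, so it has area
    1.\<close>
  define S where "S u = 2 * (max 0 u)\<^sup>2 - 4 * (max 0 (u - 1/2))\<^sup>2 + 2 * (max 0 (u - 1))\<^sup>2" for u :: real
  define S' where "S' u = 4 * max 0 u - 8 * max 0 (u - 1/2) + 4 * max 0 (u - 1)" for u :: real
  have sq: "((\<lambda>u. (max 0 (u - a))\<^sup>2) has_real_derivative 2 * max 0 (u - a)) (at u)" for a u :: real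
    using DERIV_chain2[OF has_real_derivative_pos_part_squared, of "\<lambda>u. u - a" 1 u UNIV]
      DERIV_diff[OF DERIV_ident DERIV_const[of a], of u] by simp
  have D: "(S has_real_derivative S' u) (at u)" for u
    unfolding S_def S'_def
    using DERIV_add[OF DERIV_diff[OF DERIV_cmult[OF sq[of 0 u], of 2] DERIV_cmult[OF sq[of "1/2" u], of 4]]
        DERIV_cmult[OF sq[of 1 u], of 2]] by simp
  have pos: "0 \<le> S' u" for u by (auto simp: S'_def max_def)
  have mono: "S u \<le> S v" if "u \<le> v" for u v
    by (rule DERIV_nonneg_imp_nondecreasing[OF that]) (use D pos in blast)
  have S0: "S u = 0" if "u \<le> 0" for u using that by (simp add: S_def)
  have S1: "S u = 1" if "1 \<le> u" for u using that by (simp add: S_def power2_eq_square algebra_simps)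
  show thesis
  proof (rule that[of S S'])
    show "continuous_on UNIV S'" unfolding S'_def by (intro continuous_intros)
    show "S' u = 0" if "u \<notin> {0..1}" for u using that by (auto simp: S'_def max_def)
    show "0 \<le> S u" for u using mono[of "min 0 u" u] S0[of "min 0 u"] by simp
    show "S u \<le> 1" for u using mono[of u "max 1 u"] S1[of "max 1 u"] by simp
  qed (use D pos S0 S1 in auto)
qed

text \<open>\<open>\<alpha>'\<close> acts as an approximate point mass at a place where \<open>g\<close> is close to \<open>g\<^sub>0\<close>.\<close>

lemma integral_bump:
  fixes \<alpha> \<alpha>' g :: "real \<Rightarrow> real"
  assumes \<alpha>: "\<And>t. (\<alpha> has_real_derivative \<alpha>' t) (at t)" "continuous_on UNIV \<alpha>'" "\<And>t. 0 \<le> \<alpha>' t"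
    and ends: "\<alpha> a = 0" "\<alpha> b = 1" "a \<le> b" and g: "continuous_on {a..b} g"
    and near: "\<And>t. t \<in> {a..b} \<Longrightarrow> \<alpha>' t \<noteq> 0 \<Longrightarrow> \<bar>g t - g\<^sub>0\<bar> \<le> \<eta>"
  shows "\<bar>integral {a..b} (\<lambda>t. \<alpha>' t * g t) - g\<^sub>0\<bar> \<le> \<eta>"
proof -
  have "(\<alpha>' has_integral (\<alpha> b - \<alpha> a)) {a..b}"
    using \<alpha>(1) ends(3)
    by (intro fundamental_theorem_of_calculus)
       (auto simp: has_real_derivative_iff_has_vector_derivative[symmetric] intro: has_field_derivative_at_within)
  then have I: "(\<alpha>' has_integral 1) {a..b}" using ends by simp
  note c = continuous_on_subset[OF \<alpha>(2) subset_UNIV, of "{a..b}"]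
  have *: "(\<lambda>t. \<alpha>' t * g t) integrable_on {a..b}"
    by (intro integrable_continuous_real continuous_intros c g)
  \<comment> \<open>Where \<open>\<alpha>' t = 0\<close> nothing is known about \<open>g\<close>,
    but there all three products vanish.\<close>
  have "\<alpha>' t * (g\<^sub>0 - \<eta>) \<le> \<alpha>' t * g t \<and> \<alpha>' t * g t \<le> \<alpha>' t * (g\<^sub>0 + \<eta>)" if "t \<in> {a..b}" for t
    using near[OF that] \<alpha>(3)[of t] by (cases "\<alpha>' t = 0") (auto intro!: mult_left_mono simp: abs_le_iff)
  then have lo: "\<And>t. t \<in> {a..b} \<Longrightarrow> \<alpha>' t * (g\<^sub>0 - \<eta>) \<le> \<alpha>' t * g t"
    and hi: "\<And>t. t \<in> {a..b} \<Longrightarrow> \<alpha>' t * g t \<le> \<alpha>' t * (g\<^sub>0 + \<eta>)" by blast+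
  have "g\<^sub>0 - \<eta> \<le> integral {a..b} (\<lambda>t. \<alpha>' t * g t)"
    using has_integral_le[OF has_integral_mult_left[OF I, of "g\<^sub>0 - \<eta>"] integrable_integral[OF *] lo] by simp
  moreover have "integral {a..b} (\<lambda>t. \<alpha>' t * g t) \<le> g\<^sub>0 + \<eta>"
    using has_integral_le[OF integrable_integral[OF *] has_integral_mult_left[OF I, of "g\<^sub>0 + \<eta>"] hi] by simp
  ultimately show ?thesis by (simp add: abs_le_iff)
qed

text \<open>Convexity of half the squared norm between \<open>p + q\<close> and \<open>q\<close>,
  with the exact defect \<open>\<theta> (1 - \<theta>) |p|^2 / 2\<close>. It serves both the cutoff
  in time, with \<open>q = P\<close>, and the change of speed, with \<open>q = 2 P\<close>.\<close>

lemma half_norm_sq_cutoff: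
  fixes p q :: "'a::real_inner"
  assumes "0 \<le> \<theta>" "\<theta> \<le> 1"
  shows "1/2 * (norm (\<theta> *\<^sub>R p + q))\<^sup>2 \<le> \<theta> * (1/2 * (norm (p + q))\<^sup>2) + (1 - \<theta>) * (1/2 * (norm q)\<^sup>2)"
proof -
  have "\<theta> * (norm (p + q))\<^sup>2 + (1 - \<theta>) * (norm q)\<^sup>2 - (norm (\<theta> *\<^sub>R p + q))\<^sup>2 = \<theta> * (1 - \<theta>) * (norm p)\<^sup>2"
    unfolding power2_norm_eq_inner
    by (simp add: algebra_simps inner_commute power2_eq_square)
  moreover have "0 \<le> \<theta> * (1 - \<theta>) * (norm p)\<^sup>2" using assms by simp
  ultimately have "(norm (\<theta> *\<^sub>R p + q))\<^sup>2 \<le> \<theta> * (norm (p + q))\<^sup>2 + (1 - \<theta>) * (norm q)\<^sup>2"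
    by linarith
  then show ?thesis by simp
qed

lemma continuous_on_real_nhd:
  fixes f :: "real \<Rightarrow> real"
  assumes "continuous_on S f" "s \<in> S" "0 < e"
  obtains r where "0 < r" "\<And>t. t \<in> S \<Longrightarrow> \<bar>t - s\<bar> < r \<Longrightarrow> \<bar>f t - f s\<bar> < e"
  using assms unfolding continuous_on_iff dist_real_def by blast

lemma F_dyn_le_action:
  assumes F: "ereal (c / T) \<le> F_dyn m P T" and T: "0 < T" and m: "weak_curve 0 T m"
    and \<phi>: "spacetime_C1 \<phi> g d" and e: "0 < e" and z: "\<And>x t. t \<notin> {e..T - e} \<Longrightarrow> \<phi> x t = 0"
  shows "c \<le> integral {0..T} (\<lambda>t. \<integral>x. d x t + 1/2 * (norm (g x t + P))\<^sup>2 \<partial>m t)"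
proof -
  have g: "torus_gradient (\<lambda>y. \<phi> y t) x = g x t" for x t
    using \<phi> by (intro torus_gradient_eq) (auto simp: spacetime_C1_def)
  have d: "deriv (\<phi> x) t = d x t" for x t
    using \<phi> by (intro DERIV_imp_deriv) (auto simp: spacetime_C1_def)
  have "F_dyn m P T \<le> ereal (1 / T) * ereal (LBINT t:{0..T}. (\<integral>x. d x t + 1/2 * (norm (g x t + P))\<^sup>2 \<partial>m t))"
    unfolding F_dyn_def
    by (rule ereal_mult_left_mono, rule INF_lower2[OF spacetime_C1_0I[OF \<phi> z e]])
       (use T in \<open>simp_all add: g d\<close>)
  also have "\<dots> = ereal (integral {0..T} (\<lambda>t. \<integral>x. d x t + 1/2 * (norm (g x t + P))\<^sup>2 \<partial>m t) / T)"
    using LBINT_eq_integral[OF continuous_on_integral_curve[OF m spacetime_C1_integrand_continuous[OF \<phi>, of P]]]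
    by simp
  finally have "ereal (c / T) \<le> \<dots>" using F by (rule order_trans[rotated])
  then show ?thesis using T by (simp add: divide_le_cancel)
qed

text \<open>The boundary terms arise from the derivative of a smooth cutoff in time.\<close>

lemma action_ge_F_dyn:
  assumes F: "ereal (c / T) \<le> F_dyn m P T" and T: "0 < T" and m: "weak_curve 0 T m"
  shows "action_ge P 0 T m c"
  unfolding action_ge_def
proof (intro allI impI)
  fix \<phi> g d assume \<phi>: "spacetime_C1 \<phi> g (d :: 'a torus \<Rightarrow> real \<Rightarrow> real)"
  define G0 where "G0 t = (\<integral>x. \<phi> x t \<partial>m t)" for t
  define G where "G t = (\<integral>x. d x t + 1/2 * (norm (g x t + P))\<^sup>2 \<partial>m t)" for t
  have G0: "continuous_on {0..T} G0" and G: "continuous_on {0..T} G"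
    unfolding G0_def G_def
    by (intro continuous_on_integral_curve[OF m] spacetime_C1_continuous[OF \<phi>] spacetime_C1_integrand_continuous[OF \<phi>])+
  have "G0 T - G0 0 + c \<le> integral {0..T} G + \<eta>" if \<eta>: "\<eta> > 0" for \<eta>
  proof -
    have "compact (G ` {0..T})" by (intro compact_continuous_image G) auto
    then obtain C0 where C0: "\<And>t. t \<in> {0..T} \<Longrightarrow> \<bar>G t\<bar> \<le> C0"
      using compact_imp_bounded bounded_iff by (metis imageI real_norm_def)
    \<comment> \<open>Where the cutoff \<open>\<theta>\<close> is below 1, \<open>G\<close> is
      replaced by at most \<open>\<theta> G + (1 - \<theta>) |P|^2 / 2\<close> apart from the
      boundary terms. The excess over \<open>G\<close> is at most \<open>1 - \<theta>\<close> times
      \<open>C\<close>.\<close>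
    define C where "C = C0 + (norm P)\<^sup>2"
    have C: "\<bar>G t\<bar> + 1/2 * (norm P)\<^sup>2 \<le> C" if "t \<in> {0..T}" for t using C0[OF that] zero_le_power2[of "norm P"] unfolding C_def by linarith
    have "\<bar>G 0\<bar> + 1/2 * (norm P)\<^sup>2 \<le> C" using C[of 0] T by simp
    moreover have "0 \<le> \<bar>G 0\<bar> + 1/2 * (norm P)\<^sup>2" by simp
    ultimately have "0 \<le> C" by (rule order_trans[rotated])
    obtain e0 where e0: "e0 > 0" "\<And>t. t \<in> {0..T} \<Longrightarrow> \<bar>t - 0\<bar> < e0 \<Longrightarrow> \<bar>G0 t - G0 0\<bar> < \<eta>/4"
      using continuous_on_real_nhd[OF G0, of 0 "\<eta>/4"] T \<eta> by auto
    obtain e1 where e1: "e1 > 0" "\<And>t. t \<in> {0..T} \<Longrightarrow> \<bar>t - T\<bar> < e1 \<Longrightarrow> \<bar>G0 t - G0 T\<bar> < \<eta>/4"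
      using continuous_on_real_nhd[OF G0, of T "\<eta>/4"] T \<eta> by auto
    \<comment> \<open>The first two entries keep \<open>G0\<close> within \<open>\<eta> / 4\<close>
      of its end values on the transition zones, \<open>T / 4\<close> keeps the zones apart, and the
      last entry makes the loss \<open>4 e C\<close> at most \<open>\<eta> / 2\<close>.\<close>
    define e where "e = min (min (e0 / 4) (e1 / 4)) (min (T / 4) (\<eta> / (8 * (C + 1))))"
    have "0 < \<eta> / (8 * (C + 1))" using \<eta> \<open>0 \<le> C\<close> by simp
    then have e_pos: "0 < e" using e0(1) e1(1) T by (simp add: e_def)
    have e_le: "e \<le> e0 / 4" "e \<le> e1 / 4" "e \<le> T / 4" "e \<le> \<eta> / (8 * (C + 1))"
      unfolding e_def by (simp_all only: min_le_iff_disj order_refl simp_thms)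
    have e: "0 < e" "2 * e < e0" "2 * e < e1" "4 * e \<le> T" "e \<le> \<eta> / (8 * (C + 1))"
      using e_pos e_le by linarith+
    have eC: "4 * e * C \<le> \<eta> / 2"
    proof -
      have "e * (8 * (C + 1)) \<le> \<eta>" using e(5) \<open>0 \<le> C\<close> by (simp add: pos_le_divide_eq)
      moreover have "e * (8 * (C + 1)) = 8 * (e * C) + 8 * e" by (simp add: algebra_simps)
      ultimately show ?thesis using e(1) by linarith
    qed
    obtain S S' :: "real \<Rightarrow> real" where S: "\<And>u. (S has_real_derivative S' u) (at u)" "continuous_on UNIV S'" "\<And>u. 0 \<le> S' u"
    "\<And>u. u \<le> 0 \<Longrightarrow> S u = 0" "\<And>u. 1 \<le> u \<Longrightarrow> S u = 1" "\<And>u. u \<notin> {0..1} \<Longrightarrow> S' u = 0"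
    "\<And>u. 0 \<le> S u" "\<And>u. S u \<le> 1" by (rule smooth_step_exists) (rule that)
    \<comment> \<open>\<open>\<alpha>\<close> switches on over \<open>[e, 2 e]\<close> and
      \<open>\<beta>\<close> over \<open>[T - 2 e, T - e]\<close>. The cutoff is
      \<open>\<alpha> - \<beta>\<close>: its derivative is a difference of two nonnegative bumps of
      mass one, and each of them produces one boundary term.\<close>
    define \<alpha> where "\<alpha> t = S ((t - e) / e)" for t
    define \<alpha>' where "\<alpha>' t = S' ((t - e) / e) / e" for t
    define \<beta> where "\<beta> t = S ((t - (T - 2 * e)) / e)" for t
    define \<beta>' where "\<beta>' t = S' ((t - (T - 2 * e)) / e) / e" for t
    have dS: "((\<lambda>t. S ((t - r) / e)) has_real_derivative S' ((t - r) / e) / e) (at t)" for r t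
      using e(1) by (intro DERIV_cong[OF DERIV_chain2[OF S(1)]]) (auto intro!: derivative_eq_intros)
    have cS: "continuous_on UNIV (\<lambda>t. S' ((t - r) / e) / e)" for r
      using e by (intro continuous_intros continuous_on_compose2[OF S(2)]) auto
    have supp: "r \<le> t \<and> t \<le> r + e" if "S' ((t - r) / e) / e \<noteq> 0" for r t
    proof -
      have "(t - r) / e \<in> {0..1}" using that S(6) by fastforce
      then show ?thesis using e(1) by (simp add: pos_divide_le_eq zero_le_divide_iff)
    qed
    have lo: "S ((t - r) / e) = 0" if "t \<le> r" for r t
      using that e(1) by (intro S(4)) (simp add: divide_nonpos_pos)
    have hi: "S ((t - r) / e) = 1" if "r + e \<le> t" for r t
      using that e(1) by (intro S(5)) (simp add: pos_le_divide_eq)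
    have \<alpha>: "\<And>t. (\<alpha> has_real_derivative \<alpha>' t) (at t)" "continuous_on UNIV \<alpha>'" "\<And>t. 0 \<le> \<alpha>' t"
       "\<alpha> 0 = 0" "\<alpha> T = 1" "\<And>t. \<alpha>' t \<noteq> 0 \<Longrightarrow> t \<le> 2 * e" "\<And>t. t \<le> e \<Longrightarrow> \<alpha> t = 0" "\<And>t. t \<ge> 2 * e \<Longrightarrow> \<alpha> t = 1"
       "\<And>t. 0 \<le> \<alpha> t" "\<And>t. \<alpha> t \<le> 1"
    proof -
      show "(\<alpha> has_real_derivative \<alpha>' t) (at t)" for t unfolding \<alpha>_def \<alpha>'_def by (rule dS)
      show "continuous_on UNIV \<alpha>'" unfolding \<alpha>'_def by (rule cS)
      show "0 \<le> \<alpha>' t" for t unfolding \<alpha>'_def using S(3) e(1) by simp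
      show "\<alpha> 0 = 0" unfolding \<alpha>_def using lo[of 0 "e"] e by simp
      show "\<alpha> T = 1" unfolding \<alpha>_def using hi[of "e" T] e by simp
      show "0 \<le> \<alpha> t" "\<alpha> t \<le> 1" for t unfolding \<alpha>_def by (rule S(7), rule S(8))
      show "\<alpha>' t \<noteq> 0 \<Longrightarrow> t \<le> 2 * e" for t using supp[of t e] by (auto simp: \<alpha>'_def)
      show "t \<le> e \<Longrightarrow> \<alpha> t = 0" for t using lo[of t e] by (simp add: \<alpha>_def)
      show "t \<ge> 2 * e \<Longrightarrow> \<alpha> t = 1" for t using hi[of e t] by (simp add: \<alpha>_def)
    qed
    have \<beta>: "\<And>t. (\<beta> has_real_derivative \<beta>' t) (at t)" "continuous_on UNIV \<beta>'" "\<And>t. 0 \<le> \<beta>' t"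
       "\<beta> 0 = 0" "\<beta> T = 1" "\<And>t. \<beta>' t \<noteq> 0 \<Longrightarrow> t \<ge> T - 2 * e" "\<And>t. t \<le> T - 2 * e \<Longrightarrow> \<beta> t = 0" "\<And>t. t \<ge> T - e \<Longrightarrow> \<beta> t = 1"
       "\<And>t. 0 \<le> \<beta> t" "\<And>t. \<beta> t \<le> 1"
    proof -
      show "(\<beta> has_real_derivative \<beta>' t) (at t)" for t unfolding \<beta>_def \<beta>'_def by (rule dS)
      show "continuous_on UNIV \<beta>'" unfolding \<beta>'_def by (rule cS)
      show "0 \<le> \<beta>' t" for t unfolding \<beta>'_def using S(3) e(1) by simp
      show "\<beta> 0 = 0" unfolding \<beta>_def using lo[of 0 "T - 2 * e"] e by simp
      show "\<beta> T = 1" unfolding \<beta>_def using hi[of "T - 2 * e" T] e by simp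
      show "0 \<le> \<beta> t" "\<beta> t \<le> 1" for t unfolding \<beta>_def by (rule S(7), rule S(8))
      show "\<beta>' t \<noteq> 0 \<Longrightarrow> t \<ge> T - 2 * e" for t using supp[of t "T - 2 * e"] by (auto simp: \<beta>'_def)
      show "t \<le> T - 2 * e \<Longrightarrow> \<beta> t = 0" for t using lo[of t "T - 2 * e"] by (simp add: \<beta>_def)
      show "t \<ge> T - e \<Longrightarrow> \<beta> t = 1" for t using hi[of "T - 2 * e" t] by (simp add: \<beta>_def)
    qed
    have \<beta>\<alpha>: "\<beta> t \<le> \<alpha> t" for t
      using \<alpha>(8,9,10)[of t] \<beta>(7,9,10)[of t] e by (cases "t \<le> 2 * e") auto
    define \<theta> where "\<theta> t = \<alpha> t - \<beta> t" for t
    define \<theta>' where "\<theta>' t = \<alpha>' t - \<beta>' t" for t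
    have \<theta>: "(\<theta> has_real_derivative \<theta>' t) (at t)" "0 \<le> \<theta> t" "\<theta> t \<le> 1" for t
      using \<alpha>(1,10)[of t] \<beta>(1,9)[of t] \<beta>\<alpha>[of t] unfolding \<theta>_def \<theta>'_def by (auto intro!: derivative_intros)
    have c\<theta>': "continuous_on UNIV \<theta>'" unfolding \<theta>'_def using \<alpha>(2) \<beta>(2) by (intro continuous_intros)
    have c\<theta>: "continuous_on UNIV \<theta>" using \<theta>(1) by (auto intro!: continuous_at_imp_continuous_on DERIV_isCont)
    have \<theta>z: "\<theta> t = 0" if "t \<notin> {e..T - e}" for t
      using that \<alpha>(7)[of t] \<beta>(7)[of t] \<alpha>(8)[of t] \<beta>(8)[of t] e by (auto simp: \<theta>_def)
    note sub = continuous_on_subset[OF _ subset_UNIV, of _ "{0..T}"]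
    note \<psi> = spacetime_C1_mult_time[OF \<phi> \<theta>(1) c\<theta>']
    have "c \<le> integral {0..T} (\<lambda>t. \<integral>x. \<theta>' t * \<phi> x t + \<theta> t * d x t + 1/2 * (norm (\<theta> t *\<^sub>R g x t + P))\<^sup>2 \<partial>m t)"
      by (rule F_dyn_le_action[OF F T m \<psi> e(1)]) (simp add: \<theta>z)
    also have "\<dots> \<le> integral {0..T} (\<lambda>t. \<alpha>' t * G0 t - \<beta>' t * G0 t + G t + (1 - \<theta> t) * C)"
    proof (rule integral_le)
      show "(\<lambda>t. \<integral>x. \<theta>' t * \<phi> x t + \<theta> t * d x t + 1/2 * (norm (\<theta> t *\<^sub>R g x t + P))\<^sup>2 \<partial>m t) integrable_on {0..T}"
        by (intro integrable_on_curve[OF m] spacetime_C1_integrand_continuous[OF \<psi>])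
      show "(\<lambda>t. \<alpha>' t * G0 t - \<beta>' t * G0 t + G t + (1 - \<theta> t) * C) integrable_on {0..T}"
        by (intro integrable_continuous_real continuous_intros G G0 sub c\<theta> \<alpha>(2) \<beta>(2))
      fix t assume t: "t \<in> {0..T}"
      then have mt: "m t \<in> torus_probs" using m weak_curve_probs by blast
      have c1: "continuous_on UNIV (\<lambda>x. \<phi> x t)" using spacetime_C1_continuous[OF \<phi>] by (rule continuous_on_slice)
      have c2: "continuous_on UNIV (\<lambda>x. d x t + 1/2 * (norm (g x t + P))\<^sup>2)"
        using spacetime_C1_integrand_continuous[OF \<phi>] by (rule continuous_on_slice)
      have c3: "continuous_on UNIV (\<lambda>x. \<theta>' t * \<phi> x t + \<theta> t * d x t + 1/2 * (norm (\<theta> t *\<^sub>R g x t + P))\<^sup>2)"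
        using spacetime_C1_integrand_continuous[OF \<psi>] by (rule continuous_on_slice)
      have "(\<integral>x. \<theta>' t * \<phi> x t + \<theta> t * d x t + 1/2 * (norm (\<theta> t *\<^sub>R g x t + P))\<^sup>2 \<partial>m t)
        \<le> (\<integral>x. \<theta>' t * \<phi> x t + \<theta> t * (d x t + 1/2 * (norm (g x t + P))\<^sup>2) + (1 - \<theta> t) * (1/2 * (norm P)\<^sup>2) \<partial>m t)"
      proof (rule integral_torus_mono[OF mt c3])
        show "continuous_on UNIV (\<lambda>x. \<theta>' t * \<phi> x t + \<theta> t * (d x t + 1/2 * (norm (g x t + P))\<^sup>2) + (1 - \<theta> t) * (1/2 * (norm P)\<^sup>2))"
          by (intro continuous_on_add continuous_on_mult_left c1 c2 continuous_on_const)
        show "\<theta>' t * \<phi> x t + \<theta> t * d x t + 1/2 * (norm (\<theta> t *\<^sub>R g x t + P))\<^sup>2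
          \<le> \<theta>' t * \<phi> x t + \<theta> t * (d x t + 1/2 * (norm (g x t + P))\<^sup>2) + (1 - \<theta> t) * (1/2 * (norm P)\<^sup>2)" for x
          using half_norm_sq_cutoff[OF \<theta>(2,3), of t "g x t" P] by (simp add: distrib_left)
      qed
      also have "\<dots> = \<theta>' t * G0 t + \<theta> t * G t + (1 - \<theta> t) * (1/2 * (norm P)\<^sup>2)"
        using integrable_torus[OF mt c1] integrable_torus[OF mt c2] integrable_torus[OF mt continuous_on_const] mt
        by (simp add: G0_def G_def)
      \<comment> \<open>The sign of \<open>G t\<close> is unknown, so removing the factor
        \<open>\<theta> t\<close> costs \<open>(1 - \<theta> t) \<bar>G t\<bar>\<close>.\<close>
      also have "\<theta> t * G t \<le> G t + (1 - \<theta> t) * \<bar>G t\<bar>"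
      proof -
        have "(1 - \<theta> t) * (- G t) \<le> (1 - \<theta> t) * \<bar>G t\<bar>" using \<theta>(3)[of t] by (intro mult_left_mono) auto
        then show ?thesis by (simp add: algebra_simps)
      qed
      also have "\<theta>' t * G0 t + (G t + (1 - \<theta> t) * \<bar>G t\<bar>) + (1 - \<theta> t) * (1/2 * (norm P)\<^sup>2)
          = \<theta>' t * G0 t + G t + (1 - \<theta> t) * (\<bar>G t\<bar> + 1/2 * (norm P)\<^sup>2)" by (simp add: distrib_left)
      also have "\<dots> \<le> \<theta>' t * G0 t + G t + (1 - \<theta> t) * C"
        using C[OF t] \<theta>(3)[of t] by (intro add_left_mono mult_left_mono) auto
      finally show "(\<integral>x. \<theta>' t * \<phi> x t + \<theta> t * d x t + 1/2 * (norm (\<theta> t *\<^sub>R g x t + P))\<^sup>2 \<partial>m t)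
         \<le> \<alpha>' t * G0 t - \<beta>' t * G0 t + G t + (1 - \<theta> t) * C"
        by (simp add: \<theta>'_def left_diff_distrib)
    qed
    also have "\<dots> = integral {0..T} (\<lambda>t. \<alpha>' t * G0 t) - integral {0..T} (\<lambda>t. \<beta>' t * G0 t) + integral {0..T} G
         + integral {0..T} (\<lambda>t. (1 - \<theta> t) * C)"
    proof -
      have "(\<lambda>t. \<alpha>' t * G0 t) integrable_on {0..T}" "(\<lambda>t. \<beta>' t * G0 t) integrable_on {0..T}"
        "G integrable_on {0..T}" "(\<lambda>t. (1 - \<theta> t) * C) integrable_on {0..T}"
        by (intro integrable_continuous_real continuous_intros G G0 sub c\<theta> \<alpha>(2) \<beta>(2))+
      then show ?thesis
        by (simp add: Henstock_Kurzweil_Integration.integral_add Henstock_Kurzweil_Integration.integral_diff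
            integrable_add integrable_diff)
    qed
    finally have "c \<le> integral {0..T} (\<lambda>t. \<alpha>' t * G0 t) - integral {0..T} (\<lambda>t. \<beta>' t * G0 t) + integral {0..T} G
         + integral {0..T} (\<lambda>t. (1 - \<theta> t) * C)" .
    \<comment> \<open>\<open>1 - \<theta>\<close> vanishes on \<open>[2 e, T - 2 e]\<close>, which
      leaves two end intervals of length \<open>2 e\<close>.\<close>
    moreover have "integral {0..T} (\<lambda>t. (1 - \<theta> t) * C) \<le> 4 * e * C"
    proof -
      have i: "(\<lambda>t. (1 - \<theta> t) * C) integrable_on {a..b}" for a b
        by (intro integrable_continuous_real continuous_intros continuous_on_subset[OF c\<theta> subset_UNIV])
      have "(1 - \<theta> t) * C \<le> C" for t
        using mult_right_mono[OF _ \<open>0 \<le> C\<close>, of "1 - \<theta> t" 1] \<theta>(2)[of t] by simp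
      then have bd: "integral {a..b} (\<lambda>t. (1 - \<theta> t) * C) \<le> (b - a) * C" if "a \<le> b" for a b
        using integral_le[OF i integrable_const_ivl, of a b C] that by simp
      have "integral {2 * e..T - 2 * e} (\<lambda>t. (1 - \<theta> t) * C) = integral {2 * e..T - 2 * e} (\<lambda>t. 0)"
        by (intro integral_cong) (auto simp: \<theta>_def \<alpha> \<beta>)
      then have "integral {2 * e..T - 2 * e} (\<lambda>t. (1 - \<theta> t) * C) = 0" by simp
      moreover have "integral {0..2*e} (\<lambda>t. (1 - \<theta> t) * C) + integral {2*e..T} (\<lambda>t. (1 - \<theta> t) * C) = integral {0..T} (\<lambda>t. (1 - \<theta> t) * C)"
        using e by (intro Henstock_Kurzweil_Integration.integral_combine i) auto
      moreover have "integral {2*e..T-2*e} (\<lambda>t. (1 - \<theta> t) * C) + integral {T-2*e..T} (\<lambda>t. (1 - \<theta> t) * C) = integral {2*e..T} (\<lambda>t. (1 - \<theta> t) * C)"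
        using e by (intro Henstock_Kurzweil_Integration.integral_combine i) auto
      ultimately have "integral {0..T} (\<lambda>t. (1 - \<theta> t) * C)
         = integral {0..2*e} (\<lambda>t. (1 - \<theta> t) * C) + integral {T-2*e..T} (\<lambda>t. (1 - \<theta> t) * C)" by linarith
      moreover have "integral {0..2*e} (\<lambda>t. (1 - \<theta> t) * C) \<le> 2 * e * C"
        using bd[of 0 "2*e"] e by simp
      moreover have "integral {T-2*e..T} (\<lambda>t. (1 - \<theta> t) * C) \<le> 2 * e * C"
        using bd[of "T-2*e" T] e by simp
      ultimately show ?thesis by linarith
    qed
    moreover have "integral {0..T} (\<lambda>t. \<alpha>' t * G0 t) \<le> G0 0 + \<eta> / 4"
    proof -
      have "\<bar>G0 t - G0 0\<bar> \<le> \<eta> / 4" if "t \<in> {0..T}" "\<alpha>' t \<noteq> 0" for t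
        using that e0(2)[of t] \<alpha>(6)[of t] e by auto
      from integral_bump[OF \<alpha>(1-3) \<alpha>(4,5) less_imp_le[OF T] G0 this]
      show ?thesis by linarith
    qed
    moreover have "integral {0..T} (\<lambda>t. \<beta>' t * G0 t) \<ge> G0 T - \<eta> / 4"
    proof -
      have "\<bar>G0 t - G0 T\<bar> \<le> \<eta> / 4" if "t \<in> {0..T}" "\<beta>' t \<noteq> 0" for t
        using that e1(2)[of t] \<beta>(6)[of t] e by auto
      from integral_bump[OF \<beta>(1-3) \<beta>(4,5) less_imp_le[OF T] G0 this]
      show ?thesis by linarith
    qed
    ultimately show ?thesis using eC by linarith
  qed
  then have "G0 T - G0 0 + c \<le> integral {0..T} G" by (rule field_le_epsilon)
  then show "(\<integral>x. \<phi> x T \<partial>m T) - (\<integral>x. \<phi> x 0 \<partial>m 0) + c \<le> integral {0..T} (\<lambda>t. \<integral>x. d x t + 1/2 * (norm (g x t + P))\<^sup>2 \<partial>m t)"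
    by (simp add: G_def[abs_def] G0_def)
qed

section \<open>Change of speed\<close>

lemma weak_curve_rescale:
  assumes m: "weak_curve 0 T m" and s: "0 < s"
  shows "weak_curve \<delta> (\<delta> + s * T) (\<lambda>t. m ((t - \<delta>) / s))"
proof -
  have *: "(t - \<delta>) / s \<in> {0..T}" if "t \<in> {\<delta>..\<delta> + s * T}" for t
    using that s by (auto simp: field_simps)
  show ?thesis
    unfolding weak_curve_def
  proof (intro conjI ballI allI impI)
    fix f :: "'a torus \<Rightarrow> real" assume "continuous_on UNIV f"
    then have "continuous_on {0..T} (\<lambda>t. \<integral>x. f x \<partial>m t)" using m by (simp add: weak_curve_def)
    then show "continuous_on {\<delta>..\<delta> + s * T} (\<lambda>t. \<integral>x. f x \<partial>m ((t - \<delta>) / s))"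
      by (rule continuous_on_compose2) (use s * in \<open>auto intro!: continuous_intros\<close>)
  qed (use * m weak_curve_probs in blast)
qed

lemma integral_rescale:
  fixes f :: "real \<Rightarrow> real"
  assumes "continuous_on {\<delta>..\<delta> + s * T} f" "0 < s" "0 \<le> T"
  shows "integral {\<delta>..\<delta> + s * T} f = s * integral {0..T} (\<lambda>t. f (\<delta> + s * t))"
proof -
  have "((\<lambda>t. s *\<^sub>R f (\<delta> + s * t)) has_integral (integral {\<delta> + s * 0..\<delta> + s * T} f)) {0..T}"
    by (rule has_integral_substitution[where c = \<delta> and d = "\<delta> + s * T"])
       (use assms in \<open>auto intro!: derivative_eq_intros simp: mult_left_mono\<close>)
  then have "integral {0..T} (\<lambda>t. s * f (\<delta> + s * t)) = integral {\<delta>..\<delta> + s * T} f"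
    by (auto dest: integral_unique)
  then show ?thesis by simp
qed

text \<open>Speeding a curve up by the factor \<open>1/s\<close> replaces \<open>P\<close> by \<open>s P\<close> in the action. Since the
  infimum of the action is convex in \<open>P\<close> and bounded above at \<open>2 P\<close>, writing \<open>P\<close> as a convex
  combination of \<open>s P\<close> and \<open>2 P\<close> bounds it below at \<open>s P\<close>.\<close>

lemma action_ge_rescale:
  assumes A: "action_ge P 0 T m c" and m: "weak_curve 0 T m" and s: "0 < s" "s \<le> 1" and T: "0 \<le> T"
  shows "action_ge P \<delta> (\<delta> + s * T) (\<lambda>t. m ((t - \<delta>) / s)) (((2 - s) * c - 2 * (1 - s) * T * (norm P)\<^sup>2) / s)"
  unfolding action_ge_def
proof (intro allI impI)
  fix \<phi> g d assume \<phi>: "spacetime_C1 \<phi> g (d :: 'a torus \<Rightarrow> real \<Rightarrow> real)"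
  let ?m = "\<lambda>t. m ((t - \<delta>) / s)"
  \<comment> \<open>The weight in \<open>P = k (s P) + (1 - k) (2 P)\<close>, that is, the solution
    of \<open>k s + 2 (1 - k) = 1\<close>.\<close>
  define k where "k = 1 / (2 - s)"
  have k: "0 < k" "k \<le> 1" "k * (2 - s) = 1" using s by (auto simp: k_def)
  have m': "weak_curve \<delta> (\<delta> + s * T) ?m" using m s(1) by (rule weak_curve_rescale)
  \<comment> \<open>The factor \<open>k\<close> is the convexity weight. The factor \<open>s\<close>
    gives the gradient part the form \<open>s (g + P)\<close>, whose square carries
    \<open>s^2\<close>; the time derivative collects a second \<open>s\<close> from the chain rule,
    so both terms of the integrand scale alike.\<close>
  note \<psi> = spacetime_C1_rescale[OF \<phi>, of "k * s" \<delta> s]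
  define H where "H t = (\<integral>x. d x (\<delta> + s * t) + 1/2 * (norm (g x (\<delta> + s * t) + P))\<^sup>2 \<partial>m t)" for t
  have cH: "continuous_on UNIV (\<lambda>(x, t). d x (\<delta> + s * t) + 1/2 * (norm (g x (\<delta> + s * t) + P))\<^sup>2)"
    using continuous_on_affine_time[where f = "\<lambda>x t. d x t + 1/2 * (norm (g x t + P))\<^sup>2", of \<delta> s]
      spacetime_C1_integrand_continuous[OF \<phi>, of P] by (simp add: case_prod_beta)
  have H: "H integrable_on {0..T}"
    unfolding H_def by (rule integrable_on_curve[OF m cH])
  have "(\<integral>x. k * s * \<phi> x (\<delta> + s * T) \<partial>m T) - (\<integral>x. k * s * \<phi> x (\<delta> + s * 0) \<partial>m 0) + c
     \<le> integral {0..T} (\<lambda>t. \<integral>x. k * s * s * d x (\<delta> + s * t) + 1/2 * (norm ((k * s) *\<^sub>R g x (\<delta> + s * t) + P))\<^sup>2 \<partial>m t)"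
    using A[unfolded action_ge_def, rule_format, OF \<psi>] .
  also have "\<dots> \<le> integral {0..T} (\<lambda>t. k * s * s * H t + (1 - k) * (2 * (norm P)\<^sup>2))"
  proof (rule integral_le)
    show "(\<lambda>t. \<integral>x. k * s * s * d x (\<delta> + s * t) + 1/2 * (norm ((k * s) *\<^sub>R g x (\<delta> + s * t) + P))\<^sup>2 \<partial>m t) integrable_on {0..T}"
      by (intro integrable_on_curve[OF m] spacetime_C1_integrand_continuous[OF \<psi>])
    show "(\<lambda>t. k * s * s * H t + (1 - k) * (2 * (norm P)\<^sup>2)) integrable_on {0..T}"
      using integrable_cmul[OF H, of "k * s * s"] by (intro integrable_add) auto
    fix t assume "t \<in> {0..T}"
    then have mt: "m t \<in> torus_probs" using m weak_curve_probs by blast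
    note c1 = continuous_on_slice[OF spacetime_C1_integrand_continuous[OF \<psi>, of P], of t]
    note c2 = continuous_on_slice[OF cH, of t]
    have "(\<integral>x. k * s * s * d x (\<delta> + s * t) + 1/2 * (norm ((k * s) *\<^sub>R g x (\<delta> + s * t) + P))\<^sup>2 \<partial>m t)
      \<le> (\<integral>x. k * s * s * (d x (\<delta> + s * t) + 1/2 * (norm (g x (\<delta> + s * t) + P))\<^sup>2) + (1 - k) * (2 * (norm P)\<^sup>2) \<partial>m t)"
    proof (rule integral_torus_mono[OF mt c1])
      show "continuous_on UNIV (\<lambda>x. k * s * s * (d x (\<delta> + s * t) + 1/2 * (norm (g x (\<delta> + s * t) + P))\<^sup>2) + (1 - k) * (2 * (norm P)\<^sup>2))"
        by (intro continuous_on_add continuous_on_mult_left c2 continuous_on_const)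
      fix x
      let ?g = "g x (\<delta> + s * t)"
      have "k *\<^sub>R (s *\<^sub>R (?g + P) - 2 *\<^sub>R P) + 2 *\<^sub>R P = (k * s) *\<^sub>R ?g + (2 - k * (2 - s)) *\<^sub>R P"
        by (simp add: algebra_simps)
      then have "1/2 * (norm ((k * s) *\<^sub>R ?g + P))\<^sup>2 \<le> k * (1/2 * (norm (s *\<^sub>R (?g + P)))\<^sup>2) + (1 - k) * (1/2 * (norm (2 *\<^sub>R P))\<^sup>2)"
        using half_norm_sq_cutoff[of k "s *\<^sub>R (?g + P) - 2 *\<^sub>R P" "2 *\<^sub>R P"] k by (simp add: mult.commute)
      moreover have "(norm (s *\<^sub>R (?g + P)))\<^sup>2 = s * s * (norm (?g + P))\<^sup>2" "(norm (2 *\<^sub>R P))\<^sup>2 = 4 * (norm P)\<^sup>2"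
        by (simp_all only: norm_scaleR power_mult_distrib power2_abs) (simp_all add: power2_eq_square)
      ultimately show "k * s * s * d x (\<delta> + s * t) + 1/2 * (norm ((k * s) *\<^sub>R ?g + P))\<^sup>2
         \<le> k * s * s * (d x (\<delta> + s * t) + 1/2 * (norm (?g + P))\<^sup>2) + (1 - k) * (2 * (norm P)\<^sup>2)"
        by (simp add: distrib_left)
    qed
    also have "\<dots> = k * s * s * H t + (1 - k) * (2 * (norm P)\<^sup>2)"
      using integrable_torus[OF mt c2] integrable_torus[OF mt continuous_on_const] mt by (simp add: H_def)
    finally show "(\<integral>x. k * s * s * d x (\<delta> + s * t) + 1/2 * (norm ((k * s) *\<^sub>R g x (\<delta> + s * t) + P))\<^sup>2 \<partial>m t)
        \<le> k * s * s * H t + (1 - k) * (2 * (norm P)\<^sup>2)" .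
  qed
  also have "\<dots> = k * s * (s * integral {0..T} H) + (1 - k) * (2 * (norm P)\<^sup>2) * T"
    using integrable_cmul[OF H, of "k * s * s"] T
    by (subst Henstock_Kurzweil_Integration.integral_add) auto
  also have "s * integral {0..T} H = integral {\<delta>..\<delta> + s * T} (\<lambda>t. \<integral>x. d x t + 1/2 * (norm (g x t + P))\<^sup>2 \<partial>?m t)"
    using integral_rescale[OF continuous_on_integral_curve[OF m' spacetime_C1_integrand_continuous[OF \<phi>, of P]] s(1) T] s
    by (simp add: H_def[abs_def])
  finally have *: "k * s * ((\<integral>x. \<phi> x (\<delta> + s * T) \<partial>m T) - (\<integral>x. \<phi> x \<delta> \<partial>m 0)) + c
     \<le> k * s * integral {\<delta>..\<delta> + s * T} (\<lambda>t. \<integral>x. d x t + 1/2 * (norm (g x t + P))\<^sup>2 \<partial>?m t) + (1 - k) * (2 * (norm P)\<^sup>2) * T"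
    (is "k * s * ?b + c \<le> k * s * ?J + _")
    by (simp add: algebra_simps)
  have "?b + ((2 - s) * c - 2 * (1 - s) * T * (norm P)\<^sup>2) / s = (k * s * ?b + c - (1 - k) * (2 * (norm P)\<^sup>2) * T) / (k * s)"
  proof -
    have k': "1 / k = 2 - s" by (simp add: k_def)
    have "(k * s * ?b + c - (1 - k) * (2 * (norm P)\<^sup>2) * T) / (k * s)
       = ?b + ((1 / k) * c - (1 / k - 1) * (2 * (norm P)\<^sup>2) * T) / s"
      using s k by (simp add: field_simps)
    also have "(1 / k) * c - (1 / k - 1) * (2 * (norm P)\<^sup>2) * T = (2 - s) * c - 2 * (1 - s) * T * (norm P)\<^sup>2"
      unfolding k' by (simp add: algebra_simps)
    finally show ?thesis by (rule sym)
  qed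
  also have "\<dots> \<le> (k * s * ?J) / (k * s)"
    using * k s by (intro divide_right_mono) auto
  also have "\<dots> = ?J" using k s by simp
  finally show "(\<integral>x. \<phi> x (\<delta> + s * T) \<partial>?m (\<delta> + s * T)) - (\<integral>x. \<phi> x \<delta> \<partial>?m \<delta>) +
     ((2 - s) * c - 2 * (1 - s) * T * (norm P)\<^sup>2) / s \<le> ?J"
    using s by simp
qed

section \<open>Transport along segments\<close>

lemma continuous_on_torus_slab_bounded:
  fixes f :: "'n::finite torus \<Rightarrow> real \<Rightarrow> 'b::real_normed_vector"
  assumes "continuous_on UNIV (\<lambda>(x, t). f x t)"
  obtains C where "0 \<le> C" "\<And>x t. t \<in> {a..b} \<Longrightarrow> norm (f x t) \<le> C"
proof -
  have "compact ((\<lambda>(x, t). f x t) ` (UNIV \<times> {a..b}))"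
    by (intro compact_continuous_image compact_Times compact_torus continuous_on_subset[OF assms]) auto
  then obtain C where C: "\<forall>y\<in>(\<lambda>(x, t). f x t) ` (UNIV \<times> {a..b}). norm y \<le> C"
    using compact_imp_bounded bounded_iff by metis
  have "norm (f x t) \<le> max 0 C" if "t \<in> {a..b}" for x t
    using bspec[OF C, of "f x t"] that by (force simp: image_iff)
  then show thesis by (intro that[of "max 0 C"]) auto
qed

text \<open>The law of particles labelled by \<open>\<omega>\<close>, starting at
  \<open>A \<omega>\<close> at time \<open>a\<close> with constant velocity
  \<open>B \<omega>\<close>. Particles may meet with different velocities, so there need not be a
  velocity field on the torus; averages over labels replace it.\<close>

definition transport :: "'a measure \<Rightarrow> ('a \<Rightarrow> real ^ 'n) \<Rightarrow> ('a \<Rightarrow> real ^ 'n) \<Rightarrow> real \<Rightarrow> real \<Rightarrow> 'n::finite torus measure" where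
  "transport \<gamma> A B a t = distr \<gamma> borel (\<lambda>\<omega>. torus_proj (A \<omega> + (t - a) *\<^sub>R B \<omega>))"

context
  fixes \<gamma> :: "'a measure" and A B :: "'a \<Rightarrow> real ^ 'n::finite" and K :: real and a b :: real
  assumes \<gamma>: "prob_space \<gamma>"
    and A [measurable]: "A \<in> borel_measurable \<gamma>" and B [measurable]: "B \<in> borel_measurable \<gamma>"
    and K: "\<And>\<omega>. norm (B \<omega>) \<le> K" and ab: "a \<le> b"
begin

interpretation prob_space \<gamma> by (rule \<gamma>)

lemma measurable_torus_proj [measurable]: "torus_proj \<in> borel_measurable borel"
  by (intro borel_measurable_continuous_onI continuous_intros)

lemma transport_torus_probs: "transport \<gamma> A B a t \<in> torus_probs"
  unfolding transport_def torus_probs_def by (auto intro!: prob_space_distr)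

lemma integral_transport:
  fixes f :: "'n torus \<Rightarrow> real"
  assumes "continuous_on UNIV f"
  shows "(\<integral>x. f x \<partial>transport \<gamma> A B a t) = (\<integral>\<omega>. f (torus_proj (A \<omega> + (t - a) *\<^sub>R B \<omega>)) \<partial>\<gamma>)"
  unfolding transport_def by (intro integral_distr borel_measurable_continuous_onI assms) measurable

lemma integrable_transport:
  fixes f :: "'n torus \<Rightarrow> real"
  assumes "continuous_on UNIV f"
  shows "integrable \<gamma> (\<lambda>\<omega>. f (torus_proj (A \<omega> + (t - a) *\<^sub>R B \<omega>)))"
proof -
  note [measurable] = borel_measurable_continuous_onI[OF assms]
  obtain C where "\<And>x. norm (f x) \<le> C" using continuous_on_torus_bounded[OF assms] by metis
  then show ?thesis by (intro integrable_const_bound[of _ C]) auto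
qed

lemma weak_curve_transport: "weak_curve a b (transport \<gamma> A B a)"
  unfolding weak_curve_def
proof (intro conjI ballI allI impI transport_torus_probs)
  fix f :: "'n torus \<Rightarrow> real" assume f: "continuous_on UNIV f"
  note [measurable] = borel_measurable_continuous_onI[OF f]
  obtain C where C: "\<And>x. norm (f x) \<le> C" using continuous_on_torus_bounded[OF f] by metis
  show "continuous_on {a..b} (\<lambda>t. \<integral>x. f x \<partial>transport \<gamma> A B a t)"
    unfolding integral_transport[OF f]
  proof (rule continuous_on_sequentiallyI)
    fix u :: "nat \<Rightarrow> real" and t assume u: "u \<longlonglongrightarrow> t"
    show "(\<lambda>n. \<integral>\<omega>. f (torus_proj (A \<omega> + (u n - a) *\<^sub>R B \<omega>)) \<partial>\<gamma>) \<longlonglongrightarrow> (\<integral>\<omega>. f (torus_proj (A \<omega> + (t - a) *\<^sub>R B \<omega>)) \<partial>\<gamma>)"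
    proof (rule integral_dominated_convergence[where w = "\<lambda>_. C"])
      show "AE \<omega> in \<gamma>. (\<lambda>n. f (torus_proj (A \<omega> + (u n - a) *\<^sub>R B \<omega>))) \<longlonglongrightarrow> f (torus_proj (A \<omega> + (t - a) *\<^sub>R B \<omega>))"
      proof (intro AE_I2)
        fix \<omega>
        have "continuous_on UNIV (\<lambda>t. f (torus_proj (A \<omega> + (t - a) *\<^sub>R B \<omega>)))"
          by (intro continuous_on_compose2[OF f] continuous_intros) auto
        from continuous_on_tendsto_compose[OF this u]
        show "(\<lambda>n. f (torus_proj (A \<omega> + (u n - a) *\<^sub>R B \<omega>))) \<longlonglongrightarrow> f (torus_proj (A \<omega> + (t - a) *\<^sub>R B \<omega>))"
          by simp
      qed
    qed (use C in auto)
  qed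
qed

text \<open>\<open>h\<close> is the total derivative of \<open>\<phi>\<close> along a trajectory.
  The fundamental theorem of calculus is applied on each trajectory, then Fubini exchanges labels
  and time.\<close>

lemma transport_continuity_equation:
  assumes \<phi>: "spacetime_C1 \<phi> g d"
  defines "h \<equiv> \<lambda>t \<omega>. d (torus_proj (A \<omega> + (t - a) *\<^sub>R B \<omega>)) t + B \<omega> \<bullet> g (torus_proj (A \<omega> + (t - a) *\<^sub>R B \<omega>)) t"
  shows "((\<lambda>t. \<integral>\<omega>. h t \<omega> \<partial>\<gamma>) has_integral
           ((\<integral>x. \<phi> x b \<partial>transport \<gamma> A B a b) - (\<integral>x. \<phi> x a \<partial>transport \<gamma> A B a a))) {a..b}"
    and "t \<in> {a..b} \<Longrightarrow> integrable \<gamma> (h t)"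
proof -
  have lift: "continuous_on UNIV (\<lambda>p. f (torus_proj (fst p)) (snd p))"
    if "continuous_on UNIV (\<lambda>(x, t). f x t)" for f :: "'n torus \<Rightarrow> real \<Rightarrow> 'c::real_normed_vector"
    by (rule continuous_on_compose2[OF that, of UNIV "\<lambda>p. (torus_proj (fst p), snd p)", simplified])
       (intro continuous_intros)
  have cd: "continuous_on UNIV (\<lambda>(x, t). d x t)" and cg: "continuous_on UNIV (\<lambda>(x, t). g x t)"
    using \<phi> by (auto simp: spacetime_C1_def)
  obtain Cd where Cd: "0 \<le> Cd" "\<And>x t. t \<in> {a..b} \<Longrightarrow> norm (d x t) \<le> Cd"
    using continuous_on_torus_slab_bounded[OF cd] by metis
  obtain Cg where Cg: "0 \<le> Cg" "\<And>x t. t \<in> {a..b} \<Longrightarrow> norm (g x t) \<le> Cg"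
    using continuous_on_torus_slab_bounded[OF cg] by metis
  have md: "(\<lambda>p. d (torus_proj (fst p)) (snd p)) \<in> borel_measurable (borel \<Otimes>\<^sub>M borel)"
    and mg: "(\<lambda>p. g (torus_proj (fst p)) (snd p)) \<in> borel_measurable (borel \<Otimes>\<^sub>M borel)"
    unfolding borel_prod using lift[OF cd] lift[OF cg] by (auto intro: borel_measurable_continuous_onI)
  have hm [measurable]: "(\<lambda>p. h (snd p) (fst p)) \<in> borel_measurable (\<gamma> \<Otimes>\<^sub>M lborel)"
  proof -
    have X: "(\<lambda>p. (A (fst p) + (snd p - a) *\<^sub>R B (fst p), snd p)) \<in> \<gamma> \<Otimes>\<^sub>M lborel \<rightarrow>\<^sub>M borel \<Otimes>\<^sub>M borel"
      by measurable
    have [measurable]: "(\<lambda>p. d (torus_proj (A (fst p) + (snd p - a) *\<^sub>R B (fst p))) (snd p)) \<in> borel_measurable (\<gamma> \<Otimes>\<^sub>M lborel)"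
      "(\<lambda>p. g (torus_proj (A (fst p) + (snd p - a) *\<^sub>R B (fst p))) (snd p)) \<in> borel_measurable (\<gamma> \<Otimes>\<^sub>M lborel)"
      using measurable_compose[OF X md] measurable_compose[OF X mg] by simp_all
    show ?thesis unfolding h_def by measurable
  qed
  have hb: "norm (h t \<omega>) \<le> Cd + K * Cg" if "t \<in> {a..b}" for t \<omega>
  proof -
    let ?x = "torus_proj (A \<omega> + (t - a) *\<^sub>R B \<omega>)"
    have "\<bar>B \<omega> \<bullet> g ?x t\<bar> \<le> norm (B \<omega>) * norm (g ?x t)" by (rule Cauchy_Schwarz_ineq2)
    also have "\<dots> \<le> K * Cg" using K[of \<omega>] Cg that by (intro mult_mono) (auto intro: order_trans[OF norm_ge_zero])
    finally show ?thesis using Cd(2)[OF that, of ?x] unfolding h_def real_norm_def by linarith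
  qed
  have ht: "(\<lambda>\<omega>. h t \<omega>) \<in> borel_measurable \<gamma>" for t
  proof -
    have "(\<lambda>\<omega>. (\<omega>, t)) \<in> \<gamma> \<rightarrow>\<^sub>M \<gamma> \<Otimes>\<^sub>M lborel" by measurable
    from measurable_compose[OF this hm] show ?thesis by simp
  qed
  show "t \<in> {a..b} \<Longrightarrow> integrable \<gamma> (h t)"
    using hb[of t] ht[of t] by (intro integrable_const_bound[of _ "Cd + K * Cg"]) auto
  interpret pair_sigma_finite \<gamma> lborel ..
  \<comment> \<open>The indicator confines Fubini to a set of finite measure on which
    \<open>h\<close> is bounded.\<close>
  let ?H = "\<lambda>p. indicator (space \<gamma> \<times> {a..b}) p *\<^sub>R h (snd p) (fst p)"
  have int: "integrable (\<gamma> \<Otimes>\<^sub>M lborel) ?H"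
  proof (rule integrableI_bounded_set_indicator)
    show "AE p in \<gamma> \<Otimes>\<^sub>M lborel. p \<in> space \<gamma> \<times> {a..b} \<longrightarrow> norm (h (snd p) (fst p)) \<le> Cd + K * Cg"
      using hb by (auto simp del: real_norm_def)
    show "emeasure (\<gamma> \<Otimes>\<^sub>M lborel) (space \<gamma> \<times> {a..b}) < \<infinity>"
      by (subst lborel.emeasure_pair_measure_Times) (auto simp: emeasure_space_1 emeasure_lborel_Icc_eq)
  qed auto
  have int': "integrable (\<gamma> \<Otimes>\<^sub>M lborel) (\<lambda>(\<omega>, t). ?H (\<omega>, t))"
    using int unfolding case_prod_beta prod.collapse .
  have Hs: "(\<integral>\<omega>. ?H (\<omega>, t) \<partial>\<gamma>) = indicator {a..b} t *\<^sub>R (\<integral>\<omega>. h t \<omega> \<partial>\<gamma>)" for t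
    by (subst integral_scaleR_right[symmetric], intro Bochner_Integration.integral_cong)
       (auto split: split_indicator)
  have sint: "set_integrable lborel {a..b} (\<lambda>t. \<integral>\<omega>. h t \<omega> \<partial>\<gamma>)"
    using integrable_snd[OF int'] unfolding set_integrable_def Hs .
  have "(LBINT t:{a..b}. \<integral>\<omega>. h t \<omega> \<partial>\<gamma>) = (\<integral>\<omega>. (\<integral>t. ?H (\<omega>, t) \<partial>lborel) \<partial>\<gamma>)"
    using Fubini_integral[OF int'] unfolding set_lebesgue_integral_def Hs .
  also have "\<dots> = (\<integral>\<omega>. \<phi> (torus_proj (A \<omega> + (b - a) *\<^sub>R B \<omega>)) b - \<phi> (torus_proj (A \<omega> + (a - a) *\<^sub>R B \<omega>)) a \<partial>\<gamma>)"
  proof (rule Bochner_Integration.integral_cong[OF refl])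
    fix \<omega> assume \<omega>: "\<omega> \<in> space \<gamma>"
    let ?X = "\<lambda>t. A \<omega> + (t - a) *\<^sub>R B \<omega>"
    have D: "((\<lambda>t. \<phi> (torus_proj (?X t)) t) has_vector_derivative h t \<omega>) (at t within {a..b})" for t
    proof -
      have "((\<lambda>t. (?X t, t)) has_derivative (\<lambda>s. (s *\<^sub>R B \<omega>, s))) (at t)"
        by (auto intro!: derivative_eq_intros)
      from has_derivative_compose[OF this spacetime_C1_has_derivative[OF \<phi>]]
      have "((\<lambda>t. \<phi> (torus_proj (?X t)) t) has_derivative (\<lambda>s. s *\<^sub>R h t \<omega>)) (at t)"
        by (simp add: h_def algebra_simps)
      then show ?thesis
        unfolding has_vector_derivative_def by (rule has_derivative_at_withinI)
    qed
    have path: "continuous_on {a..b} (\<lambda>t. f (torus_proj (?X t)) t)" if "continuous_on UNIV (\<lambda>(x, t). f x t)"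
      for f :: "'n torus \<Rightarrow> real \<Rightarrow> 'c::real_normed_vector"
      by (rule continuous_on_compose2[OF that, of _ "\<lambda>t. (torus_proj (?X t), t)", simplified])
         (intro continuous_intros)
    have ch: "continuous_on {a..b} (\<lambda>t. h t \<omega>)"
      unfolding h_def by (intro continuous_intros path[OF cd] path[OF cg])
    have "(\<integral>t. ?H (\<omega>, t) \<partial>lborel) = (LBINT t:{a..b}. h t \<omega>)"
      unfolding set_lebesgue_integral_def
      by (intro Bochner_Integration.integral_cong) (use \<omega> in \<open>auto split: split_indicator\<close>)
    also have "\<dots> = integral {a..b} (\<lambda>t. h t \<omega>)" by (rule LBINT_eq_integral[OF ch])
    also have "\<dots> = \<phi> (torus_proj (?X b)) b - \<phi> (torus_proj (?X a)) a"
      using fundamental_theorem_of_calculus[OF ab D] by (rule integral_unique)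
    finally show "(\<integral>t. ?H (\<omega>, t) \<partial>lborel) = \<phi> (torus_proj (?X b)) b - \<phi> (torus_proj (?X a)) a" .
  qed
  also have "\<dots> = (\<integral>x. \<phi> x b \<partial>transport \<gamma> A B a b) - (\<integral>x. \<phi> x a \<partial>transport \<gamma> A B a a)"
  proof -
    note c = continuous_on_slice[OF spacetime_C1_continuous[OF \<phi>]]
    show ?thesis
      unfolding integral_transport[OF c]
      by (rule Bochner_Integration.integral_diff[OF integrable_transport[OF c] integrable_transport[OF c]])
  qed
  finally show "((\<lambda>t. \<integral>\<omega>. h t \<omega> \<partial>\<gamma>) has_integral
           ((\<integral>x. \<phi> x b \<partial>transport \<gamma> A B a b) - (\<integral>x. \<phi> x a \<partial>transport \<gamma> A B a a))) {a..b}"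
    using set_borel_integral_eq_integral[OF sint] by (simp add: has_integral_iff)
qed

text \<open>Young's inequality \<open>B . (g + P) - |B|^2 / 2 \<le> |g + P|^2 / 2\<close>, applied
  particle by particle and added to the total derivative of \<open>\<phi>\<close>.\<close>

lemma action_ge_transport:
  "action_ge P a b (transport \<gamma> A B a) ((b - a) * (\<integral>\<omega>. P \<bullet> B \<omega> - 1/2 * (norm (B \<omega>))\<^sup>2 \<partial>\<gamma>))"
  unfolding action_ge_def
proof (intro allI impI)
  fix \<phi> g d assume \<phi>: "spacetime_C1 \<phi> g (d :: 'n torus \<Rightarrow> real \<Rightarrow> real)"
  let ?c = "\<integral>\<omega>. P \<bullet> B \<omega> - 1/2 * (norm (B \<omega>))\<^sup>2 \<partial>\<gamma>"
  define h where "h t \<omega> = d (torus_proj (A \<omega> + (t - a) *\<^sub>R B \<omega>)) t + B \<omega> \<bullet> g (torus_proj (A \<omega> + (t - a) *\<^sub>R B \<omega>)) t" for t \<omega>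
  have I: "((\<lambda>t. \<integral>\<omega>. h t \<omega> \<partial>\<gamma>) has_integral
           ((\<integral>x. \<phi> x b \<partial>transport \<gamma> A B a b) - (\<integral>x. \<phi> x a \<partial>transport \<gamma> A B a a))) {a..b}"
    and ih: "t \<in> {a..b} \<Longrightarrow> integrable \<gamma> (h t)" for t
    unfolding h_def using transport_continuity_equation[OF \<phi>] by auto
  have iP: "integrable \<gamma> (\<lambda>\<omega>. P \<bullet> B \<omega> - 1/2 * (norm (B \<omega>))\<^sup>2)"
  proof (intro integrable_const_bound[of _ "norm P * K + 1/2 * K\<^sup>2"] AE_I2)
    fix \<omega>
    have "\<bar>P \<bullet> B \<omega>\<bar> \<le> norm P * norm (B \<omega>)" by (rule Cauchy_Schwarz_ineq2)
    also have "\<dots> \<le> norm P * K" using K by (intro mult_left_mono) auto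
    finally have "\<bar>P \<bullet> B \<omega>\<bar> \<le> norm P * K" .
    moreover have "(norm (B \<omega>))\<^sup>2 \<le> K\<^sup>2" using K by (intro power_mono) auto
    ultimately show "norm (P \<bullet> B \<omega> - 1/2 * (norm (B \<omega>))\<^sup>2) \<le> norm P * K + 1/2 * K\<^sup>2"
      using zero_le_power2[of "norm (B \<omega>)"] unfolding real_norm_def by linarith
  qed measurable
  have cI: "((\<lambda>t. ?c) has_integral ((b - a) * ?c)) {a..b}"
    using has_integral_const_real[of ?c a b] ab by simp
  show "(\<integral>x. \<phi> x b \<partial>transport \<gamma> A B a b) - (\<integral>x. \<phi> x a \<partial>transport \<gamma> A B a a) + (b - a) * ?c
     \<le> integral {a..b} (\<lambda>t. \<integral>x. d x t + 1/2 * (norm (g x t + P))\<^sup>2 \<partial>transport \<gamma> A B a t)"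
  proof (rule has_integral_le[OF has_integral_add[OF I cI] integrable_integral])
    show "(\<lambda>t. \<integral>x. d x t + 1/2 * (norm (g x t + P))\<^sup>2 \<partial>transport \<gamma> A B a t) integrable_on {a..b}"
      by (intro integrable_on_curve weak_curve_transport spacetime_C1_integrand_continuous[OF \<phi>])
    fix t assume t: "t \<in> {a..b}"
    note c = continuous_on_slice[OF spacetime_C1_integrand_continuous[OF \<phi>, of P], of t]
    have "(\<integral>\<omega>. h t \<omega> \<partial>\<gamma>) + ?c = (\<integral>\<omega>. h t \<omega> + (P \<bullet> B \<omega> - 1/2 * (norm (B \<omega>))\<^sup>2) \<partial>\<gamma>)"
      by (rule Bochner_Integration.integral_add[symmetric, OF ih[OF t] iP])
    also have "\<dots> \<le> (\<integral>x. d x t + 1/2 * (norm (g x t + P))\<^sup>2 \<partial>transport \<gamma> A B a t)"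
      unfolding integral_transport[OF c]
    proof (rule integral_mono[OF Bochner_Integration.integrable_add[OF ih[OF t] iP] integrable_transport[OF c]])
      fix \<omega>
      let ?g = "g (torus_proj (A \<omega> + (t - a) *\<^sub>R B \<omega>)) t"
      have "0 \<le> (norm (?g + P - B \<omega>))\<^sup>2" by simp
      then show "h t \<omega> + (P \<bullet> B \<omega> - 1/2 * (norm (B \<omega>))\<^sup>2)
         \<le> d (torus_proj (A \<omega> + (t - a) *\<^sub>R B \<omega>)) t + 1/2 * (norm (?g + P))\<^sup>2"
        unfolding h_def power2_norm_eq_inner by (simp add: algebra_simps inner_commute)
    qed
    finally show "(\<integral>\<omega>. h t \<omega> \<partial>\<gamma>) + ?c \<le> (\<integral>x. d x t + 1/2 * (norm (g x t + P))\<^sup>2 \<partial>transport \<gamma> A B a t)" .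
  qed
qed

end

section \<open>Couplings of small cost\<close>

text \<open>\<open>rep_torus\<close> is an arbitrary choice of representatives. Taking fractional
  parts makes the representative depend on the class in an explicit way, which gives a Borel section
  of the projection.\<close>

definition frac_rep :: "'n::finite torus \<Rightarrow> real ^ 'n" where
  "frac_rep q = (\<chi> i. frac (rep_torus q $ i))"

lemma torus_proj_frac_rep [simp]: "torus_proj (frac_rep q) = q"
proof -
  have "torus_proj (frac_rep q) = torus_proj (rep_torus q)"
    by (rule iffD2[OF torus_proj_eq_iff]) (simp add: frac_rep_def frac_def)
  then show ?thesis by simp
qed

lemma frac_cong_int: "x - y \<in> \<int> \<Longrightarrow> frac x = frac (y :: real)"
proof -
  assume "x - y \<in> \<int>"
  then obtain k where "x - y = of_int k" by (rule Ints_cases)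
  then have "x = y + of_int k" by simp
  then show ?thesis by (simp add: frac_def)
qed

lemma frac_rep_proj: "frac_rep (torus_proj x) $ i = frac (x $ i)"
  unfolding frac_rep_def
  using torus_proj_eq_iff[of "rep_torus (torus_proj x)" x] by (simp add: frac_cong_int)

text \<open>A coordinate of \<open>frac_rep\<close> jumps at the value 0. Away from that value the
  lifted set is a union of open strips, one for each integer.\<close>

lemma open_frac_rep_between:
  assumes "0 < c" "c \<le> 1"
  shows "open {q :: 'n::finite torus. 0 < frac_rep q $ i \<and> frac_rep q $ i < c}"
proof -
  have "{x :: real ^ 'n. 0 < frac (x $ i) \<and> frac (x $ i) < c}
      = (\<Union>k::int. {x. of_int k < x $ i} \<inter> {x. x $ i < of_int k + c})"
  proof (intro subset_antisym subsetI)
    fix x :: "real ^ 'n" assume "x \<in> (\<Union>k::int. {x. of_int k < x $ i} \<inter> {x. x $ i < of_int k + c})"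
    then obtain k :: int where k: "of_int k < x $ i" "x $ i < of_int k + c" by auto
    then have "\<lfloor>x $ i\<rfloor> = k" using assms by (intro floor_unique) auto
    then show "x \<in> {x. 0 < frac (x $ i) \<and> frac (x $ i) < c}" using k by (simp add: frac_def)
  next
    fix x :: "real ^ 'n" assume "x \<in> {x. 0 < frac (x $ i) \<and> frac (x $ i) < c}"
    then show "x \<in> (\<Union>k::int. {x. of_int k < x $ i} \<inter> {x. x $ i < of_int k + c})"
      by (intro UN_I[of "\<lfloor>x $ i\<rfloor>"]) (auto simp: frac_def)
  qed
  also have "open \<dots>"
    by (intro open_UN ballI open_Int open_Collect_less continuous_intros)
  finally show ?thesis by (simp add: open_torus_def vimage_def frac_rep_proj)
qed

lemma measurable_frac_rep [measurable]: "frac_rep \<in> borel_measurable borel"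
proof -
  have "(\<lambda>q :: 'n::finite torus. frac_rep q $ i) \<in> borel_measurable borel" for i
    unfolding borel_measurable_iff_less
  proof
    fix c :: real
    have "{q :: 'n torus. frac_rep q $ i < c} \<in> sets borel"
    proof -
      consider "c \<le> 0" | "c > 1" | "0 < c" "c \<le> 1" by linarith
      then show ?thesis
      proof cases
        case 1
        then have "{q :: 'n torus. frac_rep q $ i < c} = {}"
          by (auto simp: frac_rep_def not_less intro: order_trans[OF _ frac_ge_0])
        then show ?thesis by (metis sets.empty_sets)
      next
        case 2
        then have "{q :: 'n torus. frac_rep q $ i < c} = UNIV"
          by (auto simp: frac_rep_def intro: less_trans[OF frac_lt_1])
        then show ?thesis by simp
      next
        case 3
        \<comment> \<open>Since fractional parts lie in \<open>[0, 1)\<close>, the value 0 is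
          singled out as the complement of the open case \<open>c = 1\<close>.\<close>
        have "{q :: 'n torus. frac_rep q $ i < c} =
          {q. 0 < frac_rep q $ i \<and> frac_rep q $ i < c} \<union> (UNIV - {q. 0 < frac_rep q $ i \<and> frac_rep q $ i < 1})"
        proof -
          have "frac_rep q $ i < c \<longleftrightarrow> (0 < frac_rep q $ i \<and> frac_rep q $ i < c) \<or> \<not> (0 < frac_rep q $ i \<and> frac_rep q $ i < 1)"
            for q :: "'n torus"
            using 3 frac_ge_0[of "rep_torus q $ i"] frac_lt_1[of "rep_torus q $ i"]
            unfolding frac_rep_def vec_lambda_beta by linarith
          then show ?thesis by auto
        qed
        also have "\<dots> \<in> sets borel"
          using 3 by (intro sets.Un sets.Diff borel_open open_frac_rep_between) auto
        finally show ?thesis .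
      qed
    qed
    then show "{q \<in> space borel. frac_rep q $ i < c} \<in> sets (borel :: 'n torus measure)" by simp
  qed
  then show ?thesis
    by (subst borel_measurable_euclidean_space) (auto simp: Basis_vec_def inner_axis)
qed

text \<open>Distance to the nearest integer. Its symmetry and triangle inequality come from
  minimality (\<open>int_dist_le\<close>) and attainment (\<open>int_dist_witness\<close>).\<close>

definition int_dist :: "real \<Rightarrow> real" where
  "int_dist z = \<bar>z - of_int (round z)\<bar>"

lemma int_dist_le: "m \<in> \<int> \<Longrightarrow> int_dist z \<le> \<bar>z - m\<bar>"
  by (auto simp: int_dist_def round_diff_minimal elim!: Ints_cases)

lemma int_dist_witness: obtains m where "m \<in> \<int>" "int_dist z = \<bar>z - m\<bar>"
  using that[of "of_int (round z)"] by (simp add: int_dist_def)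

lemma int_dist_le_half: "int_dist z \<le> 1/2"
  using of_int_round_abs_le[of z] by (simp add: int_dist_def abs_minus_commute)

lemma int_dist_add: "int_dist (x + y) \<le> int_dist x + int_dist y"
proof -
  obtain m where m: "m \<in> \<int>" "int_dist x = \<bar>x - m\<bar>" by (rule int_dist_witness)
  obtain k where k: "k \<in> \<int>" "int_dist y = \<bar>y - k\<bar>" by (rule int_dist_witness)
  have "int_dist (x + y) \<le> \<bar>(x + y) - (m + k)\<bar>" using m k by (intro int_dist_le Ints_add)
  then show ?thesis using m k by linarith
qed

lemma int_dist_uminus [simp]: "int_dist (- x) = int_dist x"
proof -
  have "int_dist (- x) \<le> int_dist x" for x
  proof -
    obtain m where m: "m \<in> \<int>" "int_dist x = \<bar>x - m\<bar>" by (rule int_dist_witness)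
    have "int_dist (- x) \<le> \<bar>- x - - m\<bar>" using m by (intro int_dist_le Ints_minus)
    then show ?thesis using m by linarith
  qed
  from this[of x] this[of "- x"] show ?thesis by simp
qed

lemma int_dist_cong_int:
  assumes "x - y \<in> \<int>" shows "int_dist x = int_dist y"
proof -
  have "int_dist x \<le> int_dist y" if "x - y \<in> \<int>" for x y
    using int_dist_add[of y "x - y"] int_dist_le[OF that, of "x - y"] by simp
  from this[OF assms] this[of y x] assms Ints_minus[OF assms] show ?thesis by simp
qed

lemma continuous_on_int_dist [continuous_intros]:
  assumes "continuous_on S f" shows "continuous_on S (\<lambda>x. int_dist (f x))"
proof -
  have *: "int_dist x - int_dist y \<le> \<bar>x - y\<bar>" for x y
    using int_dist_add[of y "x - y"] int_dist_le[of 0 "x - y"] by simp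
  have "\<bar>int_dist x - int_dist y\<bar> \<le> \<bar>x - y\<bar>" for x y
    using *[of x y] *[of y x] by linarith
  then have "1-lipschitz_on UNIV int_dist"
    by (intro lipschitz_onI) (simp_all add: dist_real_def)
  then have "continuous_on UNIV int_dist" by (rule lipschitz_on_continuous_on)
  then show ?thesis using assms by (rule continuous_on_compose2) auto
qed

text \<open>The flat quotient distance in the l1 norm, which separates coordinates and dominates the
  Euclidean length of \<open>torus_diff\<close>.\<close>

definition torus_dist :: "'n::finite torus \<Rightarrow> 'n torus \<Rightarrow> real" where
  "torus_dist p q = (\<Sum>i\<in>UNIV. int_dist (frac_rep q $ i - frac_rep p $ i))"

lemma torus_dist_nonneg: "0 \<le> torus_dist p q"
  by (auto simp: torus_dist_def int_dist_def intro: sum_nonneg)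

lemma torus_dist_commute: "torus_dist p q = torus_dist q p"
proof -
  have "int_dist (frac_rep q $ i - frac_rep p $ i) = int_dist (frac_rep p $ i - frac_rep q $ i)" for i
    by (metis int_dist_uminus minus_diff_eq)
  then show ?thesis by (simp add: torus_dist_def)
qed

lemma torus_dist_triangle: "torus_dist p r \<le> torus_dist p q + torus_dist q r"
proof -
  have "int_dist (frac_rep r $ i - frac_rep p $ i)
      \<le> int_dist (frac_rep q $ i - frac_rep p $ i) + int_dist (frac_rep r $ i - frac_rep q $ i)" for i
    using int_dist_add[of "frac_rep q $ i - frac_rep p $ i" "frac_rep r $ i - frac_rep q $ i"] by simp
  then show ?thesis by (simp add: torus_dist_def sum.distrib[symmetric] sum_mono)
qed

lemma torus_dist_self [simp]: "torus_dist p p = 0"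
  by (simp add: torus_dist_def int_dist_def)

lemma torus_dist_le_card: "torus_dist p (q :: 'n::finite torus) \<le> CARD('n)"
proof -
  have "torus_dist p q \<le> (\<Sum>i\<in>(UNIV :: 'n set). 1)"
    unfolding torus_dist_def by (intro sum_mono order_trans[OF int_dist_le_half]) simp
  then show ?thesis by simp
qed

text \<open>\<open>int_dist\<close> is invariant under integer shifts, so the jumps of
  \<open>frac_rep\<close> disappear in the lift.\<close>

lemma continuous_on_torus_dist: "continuous_on UNIV (torus_dist p)"
proof (rule continuous_on_torusI)
  have "torus_dist p (torus_proj x) = (\<Sum>i\<in>UNIV. int_dist (x $ i - frac_rep p $ i))" for x
    unfolding torus_dist_def
    by (intro sum.cong refl int_dist_cong_int) (simp add: frac_rep_proj frac_def)
  moreover have "continuous_on UNIV (\<lambda>x :: real ^ 'a. \<Sum>i\<in>UNIV. int_dist (x $ i - frac_rep p $ i))"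
    by (intro continuous_intros)
  ultimately show "continuous_on UNIV (\<lambda>x. torus_dist p (torus_proj x))" by simp
qed

text \<open>A shortest displacement leading from \<open>frac_rep p\<close> to a lift of
  \<open>q\<close>. Where a coordinate difference is halfway between integers, \<open>round\<close>
  decides the direction in a Borel way.\<close>

definition torus_diff :: "'n::finite torus \<Rightarrow> 'n torus \<Rightarrow> real ^ 'n" where
  "torus_diff p q = (\<chi> i. let z = frac_rep q $ i - frac_rep p $ i in z - of_int (round z))"

lemma torus_proj_torus_diff: "torus_proj (frac_rep p + torus_diff p q) = q"
proof -
  have "torus_proj (frac_rep p + torus_diff p q) = torus_proj (frac_rep q)"
    by (rule iffD2[OF torus_proj_eq_iff]) (simp add: torus_diff_def Let_def)
  then show ?thesis by simp
qed

lemma norm_torus_diff_le: "norm (torus_diff p q) \<le> torus_dist p q"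
  using norm_le_l1_cart[of "torus_diff p q"]
  by (simp add: torus_diff_def torus_dist_def int_dist_def Let_def)

lemma measurable_torus_diff [measurable]:
  "(\<lambda>z. torus_diff (fst z) (snd z) :: real ^ 'n::finite) \<in> borel_measurable (borel \<Otimes>\<^sub>M borel)"
proof -
  have [measurable]: "(\<lambda>v :: real ^ 'n. v $ i) \<in> borel_measurable borel" for i
    by (intro borel_measurable_continuous_onI continuous_intros)
  have "(\<lambda>z. torus_diff (fst z) (snd z) $ i) \<in> borel_measurable (borel \<Otimes>\<^sub>M borel)" for i :: 'n
    unfolding torus_diff_def Let_def round_def by simp
  then show ?thesis
    by (subst borel_measurable_euclidean_space) (auto simp: Basis_vec_def inner_axis)
qed

lemma measurable_torus_dist [measurable]:
  "(\<lambda>z :: 'n::finite torus \<times> 'n torus. torus_dist (fst z) (snd z)) \<in> borel_measurable (borel \<Otimes>\<^sub>M borel)"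
proof -
  have [measurable]: "(\<lambda>v :: real ^ 'n. v $ i) \<in> borel_measurable borel" for i
    by (intro borel_measurable_continuous_onI continuous_intros)
  show ?thesis unfolding torus_dist_def int_dist_def round_def by measurable
qed

text \<open>A plan witnessing that the Wasserstein distance of order one is at most
  \<open>e\<close>. It lives on the product of the Borel algebras, where \<open>torus_dist\<close>
  and \<open>torus_diff\<close> are measurable.\<close>

definition coupled :: "real \<Rightarrow> 'n::finite torus measure \<Rightarrow> 'n torus measure \<Rightarrow> bool" where
  "coupled e \<mu> \<nu> \<longleftrightarrow> (\<exists>\<gamma>. prob_space \<gamma> \<and> sets \<gamma> = sets (borel \<Otimes>\<^sub>M borel) \<and>
     distr \<gamma> borel fst = \<mu> \<and> distr \<gamma> borel snd = \<nu> \<and> (\<integral>z. torus_dist (fst z) (snd z) \<partial>\<gamma>) \<le> e)"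

lemma coupled_commute:
  assumes "coupled e \<mu> \<nu>"
  shows "coupled e \<nu> \<mu>"
proof -
  obtain \<gamma> where \<gamma>: "prob_space \<gamma>" "sets \<gamma> = sets (borel \<Otimes>\<^sub>M borel)"
     "distr \<gamma> borel fst = \<mu>" "distr \<gamma> borel snd = \<nu>" "(\<integral>z. torus_dist (fst z) (snd z) \<partial>\<gamma>) \<le> e"
    using assms by (auto simp: coupled_def)
  note [measurable_cong] = \<gamma>(2)
  let ?s = "\<lambda>z :: 'a torus \<times> 'a torus. (snd z, fst z)"
  have s: "?s \<in> \<gamma> \<rightarrow>\<^sub>M borel \<Otimes>\<^sub>M borel" by measurable
  let ?\<gamma> = "distr \<gamma> (borel \<Otimes>\<^sub>M borel) ?s"
  have "prob_space ?\<gamma>" using \<gamma>(1) s by (rule prob_space.prob_space_distr)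
  moreover have "distr ?\<gamma> borel fst = \<nu>" "distr ?\<gamma> borel snd = \<mu>"
    using s \<gamma>(3,4) by (simp_all add: distr_distr comp_def)
  moreover have "(\<integral>z. torus_dist (fst z) (snd z) \<partial>?\<gamma>) \<le> e"
    using integral_distr[OF s measurable_torus_dist] \<gamma>(5) by (simp add: torus_dist_commute)
  ultimately show ?thesis unfolding coupled_def by (intro exI[of _ ?\<gamma>]) auto
qed

lemma action_ge_mono: "action_ge P a b m c \<Longrightarrow> c' \<le> c \<Longrightarrow> action_ge P a b m c'"
  unfolding action_ge_def by (meson add_left_mono order_trans)

text \<open>Every particle travels at constant speed and arrives at time \<open>b\<close>. The
  energy is quadratic in the displacement but the cost is linear; as displacements are at most
  \<open>CARD('n)\<close>, the square is at most \<open>CARD('n)\<close> times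
  \<open>torus_dist\<close>. The linear term contributes \<open>norm P\<close>, the kinetic one the
  quotient by \<open>2 (b - a)\<close>.\<close>

lemma coupled_curve:
  fixes \<mu> :: "'n::finite torus measure"
  assumes "coupled e \<mu> \<nu>" and ab: "a < b"
  obtains m where "weak_curve a b m" "m a = \<mu>" "m b = \<nu>"
    "action_ge P a b m (- (norm P + CARD('n) / (2 * (b - a))) * e)"
proof -
  obtain \<gamma> where \<gamma>: "prob_space \<gamma>" "sets \<gamma> = sets (borel \<Otimes>\<^sub>M borel)"
     "distr \<gamma> borel fst = \<mu>" "distr \<gamma> borel snd = \<nu>" "(\<integral>z. torus_dist (fst z) (snd z) \<partial>\<gamma>) \<le> e"
    using assms by (auto simp: coupled_def)
  interpret prob_space \<gamma> by (rule \<gamma>(1))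
  note [measurable_cong] = \<gamma>(2)
  define A where "A z = frac_rep (fst z)" for z :: "'n torus \<times> 'n torus"
  define D where "D z = torus_diff (fst z) (snd z)" for z :: "'n torus \<times> 'n torus"
  define B where "B z = (1 / (b - a)) *\<^sub>R D z" for z
  let ?d = "\<lambda>z :: 'n torus \<times> 'n torus. torus_dist (fst z) (snd z)"
  let ?n = "real CARD('n)"
  have [measurable]: "A \<in> borel_measurable \<gamma>" unfolding A_def by measurable
  have [measurable]: "D \<in> borel_measurable \<gamma>" unfolding D_def by measurable
  have [measurable]: "B \<in> borel_measurable \<gamma>" unfolding B_def by measurable
  have [measurable]: "?d \<in> borel_measurable \<gamma>" by measurable
  have d: "norm (D z) \<le> ?d z" "?d z \<le> ?n" "0 \<le> ?d z" for z
    unfolding D_def by (rule norm_torus_diff_le torus_dist_le_card torus_dist_nonneg)+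
  have "norm (B z) \<le> ?n / (b - a)" for z
    using divide_right_mono[OF order_trans[OF d(1,2)], of "b - a" z] ab by (simp add: B_def)
  note tr = \<gamma>(1) \<open>A \<in> borel_measurable \<gamma>\<close> \<open>B \<in> borel_measurable \<gamma>\<close> this less_imp_le[OF ab]
  have id: "integrable \<gamma> ?d" using d by (intro integrable_const_bound[of _ ?n]) auto
  show thesis
  proof (rule that[of "transport \<gamma> A B a"])
    show "weak_curve a b (transport \<gamma> A B a)" by (rule weak_curve_transport[OF tr])
    show "transport \<gamma> A B a a = \<mu>"
      using \<gamma>(3) by (simp add: transport_def A_def)
    show "transport \<gamma> A B a b = \<nu>"
      using \<gamma>(4) ab by (simp add: transport_def A_def B_def D_def torus_proj_torus_diff)
    have "- (norm P + ?n / (2 * (b - a))) * e \<le> - (norm P + ?n / (2 * (b - a))) * (\<integral>z. ?d z \<partial>\<gamma>)"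
    proof (rule mult_left_mono_neg[OF \<gamma>(5)])
      have "0 \<le> norm P + ?n / (2 * (b - a))" using ab by (intro add_nonneg_nonneg divide_nonneg_pos) auto
      then show "- (norm P + ?n / (2 * (b - a))) \<le> 0" by linarith
    qed
    also have "\<dots> = (\<integral>z. - (norm P + ?n / (2 * (b - a))) * ?d z \<partial>\<gamma>)" by simp
    also have "\<dots> \<le> (\<integral>z. (b - a) * (P \<bullet> B z - 1/2 * (norm (B z))\<^sup>2) \<partial>\<gamma>)"
    proof (rule integral_mono)
      show "integrable \<gamma> (\<lambda>z. - (norm P + ?n / (2 * (b - a))) * ?d z)" using id by simp
      have pw: "\<bar>P \<bullet> D z\<bar> \<le> norm P * ?d z \<and> (norm (D z))\<^sup>2 \<le> ?n * ?d z" for z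
      proof
        have "\<bar>P \<bullet> D z\<bar> \<le> norm P * norm (D z)" by (rule Cauchy_Schwarz_ineq2)
        also have "\<dots> \<le> norm P * ?d z" using d by (intro mult_left_mono) auto
        finally show "\<bar>P \<bullet> D z\<bar> \<le> norm P * ?d z" .
        show "(norm (D z))\<^sup>2 \<le> ?n * ?d z"
          unfolding power2_eq_square using d[of z] by (intro mult_mono) auto
      qed
      have eq: "(b - a) * (P \<bullet> B z - 1/2 * (norm (B z))\<^sup>2) = P \<bullet> D z - (norm (D z))\<^sup>2 / (2 * (b - a))" for z
      proof -
        have "r * (x / r - 1/2 * (y / r)\<^sup>2) = x - y\<^sup>2 / (2 * r)" if "0 < r" for r x y :: real
          using that by (simp add: field_simps power2_eq_square)
        from this[of "b - a" "P \<bullet> D z" "norm (D z)"] show ?thesis using ab by (simp add: B_def)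
      qed
      show "integrable \<gamma> (\<lambda>z. (b - a) * (P \<bullet> B z - 1/2 * (norm (B z))\<^sup>2))"
      proof (rule integrable_const_bound[of _ "norm P * ?n + ?n * ?n / (2 * (b - a))"])
        show "AE z in \<gamma>. norm ((b - a) * (P \<bullet> B z - 1/2 * (norm (B z))\<^sup>2)) \<le> norm P * ?n + ?n * ?n / (2 * (b - a))"
        proof (intro AE_I2)
          fix z
          have "norm P * ?d z \<le> norm P * ?n" "?n * ?d z \<le> ?n * ?n" using d by (auto intro: mult_left_mono)
          then have P: "\<bar>P \<bullet> D z\<bar> \<le> norm P * ?n" and "(norm (D z))\<^sup>2 \<le> ?n * ?n"
            using pw[of z] by linarith+
          then have "(norm (D z))\<^sup>2 / (2 * (b - a)) \<le> ?n * ?n / (2 * (b - a))"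
            using ab by (intro divide_right_mono) auto
          moreover have "0 \<le> (norm (D z))\<^sup>2 / (2 * (b - a))" using ab by simp
          ultimately show "norm ((b - a) * (P \<bullet> B z - 1/2 * (norm (B z))\<^sup>2)) \<le> norm P * ?n + ?n * ?n / (2 * (b - a))"
            using P unfolding eq real_norm_def by linarith
        qed
      qed measurable
      fix z
      have "(norm (D z))\<^sup>2 / (2 * (b - a)) \<le> ?n * ?d z / (2 * (b - a))"
        using pw[of z] ab by (auto intro!: divide_right_mono)
      then show "- (norm P + ?n / (2 * (b - a))) * ?d z \<le> (b - a) * (P \<bullet> B z - 1/2 * (norm (B z))\<^sup>2)"
      proof -
        assume le: "(norm (D z))\<^sup>2 / (2 * (b - a)) \<le> ?n * ?d z / (2 * (b - a))"
        have "- (norm P * ?d z) \<le> P \<bullet> D z" using pw[of z] by linarith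
        moreover have "- (norm P + ?n / (2 * (b - a))) * ?d z = - (norm P * ?d z) - ?n * ?d z / (2 * (b - a))"
          by (simp add: algebra_simps)
        ultimately show ?thesis using le unfolding eq by linarith
      qed
    qed
    also have "\<dots> = (b - a) * (\<integral>z. P \<bullet> B z - 1/2 * (norm (B z))\<^sup>2 \<partial>\<gamma>)"
      by (rule integral_mult_right_zero)
    finally show "action_ge P a b (transport \<gamma> A B a) (- (norm P + ?n / (2 * (b - a))) * e)"
      by (rule action_ge_mono[OF action_ge_transport[OF tr]])
  qed
qed

text \<open>Normalised tent functions over a finite subcover by balls. Their continuity lets weak-*
  open sets control the masses of the cells.\<close>

lemma torus_partition:
  assumes "0 < \<epsilon>"
  obtains J and \<rho> :: "'n::finite torus \<Rightarrow> 'n torus \<Rightarrow> real" where "finite J"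
    "\<And>p. p \<in> J \<Longrightarrow> continuous_on UNIV (\<rho> p)" "\<And>p q. 0 \<le> \<rho> p q" "\<And>q. (\<Sum>p\<in>J. \<rho> p q) = 1"
    "\<And>p q. \<rho> p q \<noteq> 0 \<Longrightarrow> torus_dist p q < \<epsilon>"
proof -
  have op: "open {q. torus_dist p q < \<epsilon>}" for p :: "'n torus"
    by (intro open_Collect_less continuous_on_torus_dist continuous_on_const)
  obtain J where J: "finite J" "UNIV \<subseteq> (\<Union>p\<in>J. {q :: 'n torus. torus_dist p q < \<epsilon>})"
  proof (rule compactE_image[OF compact_torus, of UNIV "\<lambda>p. {q. torus_dist p q < \<epsilon>}"])
    show "(UNIV :: 'n torus set) \<subseteq> (\<Union>p. {q. torus_dist p q < \<epsilon>})"
    proof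
      fix q :: "'n torus"
      show "q \<in> (\<Union>p. {q. torus_dist p q < \<epsilon>})" using assms by (intro UN_I[of q]) auto
    qed
  qed (use op that in auto)
  define b where "b p q = max 0 (\<epsilon> - torus_dist p q)" for p q :: "'n torus"
  define s where "s q = (\<Sum>p\<in>J. b p q)" for q
  have s: "0 < s q" for q
  proof -
    obtain p where p: "p \<in> J" "torus_dist p q < \<epsilon>" using J(2) by auto
    have "0 < b p q" using p by (simp add: b_def)
    also have "\<dots> \<le> s q" unfolding s_def using p J by (intro member_le_sum) (auto simp: b_def)
    finally show ?thesis .
  qed
  have cb: "continuous_on UNIV (b p)" for p
    unfolding b_def by (intro continuous_intros continuous_on_torus_dist)
  have cs: "continuous_on UNIV s" unfolding s_def by (intro continuous_intros cb)
  show thesis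
  proof (rule that[of J "\<lambda>p q. b p q / s q"])
    show "continuous_on UNIV (\<lambda>q. b p q / s q)" for p
      using s by (intro continuous_on_divide cb cs) (metis less_irrefl)
    show "0 \<le> b p q / s q" for p q using s[of q] by (simp add: b_def)
    show "(\<Sum>p\<in>J. b p q / s q) = 1" for q
      using s[of q] by (simp add: sum_divide_distrib[symmetric] s_def)
    show "b p q / s q \<noteq> 0 \<Longrightarrow> torus_dist p q < \<epsilon>" for p q
      by (auto simp: b_def max_def split: if_splits)
  qed (rule J)
qed

text \<open>The plan has density \<open>h\<close> with respect to the product measure. The first
  marginal is prescribed almost everywhere, which accommodates cells of positive extent but zero
  mass.\<close>

lemma coupledI:
  fixes \<mu> \<nu> :: "'n::finite torus measure"
  assumes \<mu>: "\<mu> \<in> torus_probs" and \<nu>: "\<nu> \<in> torus_probs"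
    and h: "continuous_on UNIV (\<lambda>z :: 'n torus \<times> 'n torus. h (fst z) (snd z))" "\<And>x y. 0 \<le> h x y"
    and hm: "(\<lambda>z. h (fst z) (snd z)) \<in> borel_measurable (borel \<Otimes>\<^sub>M borel)"
    and marg: "AE x in \<mu>. (\<integral>y. h x y \<partial>\<nu>) = 1" "\<And>y. (\<integral>x. h x y \<partial>\<mu>) = 1"
    and e: "(\<integral>z. h (fst z) (snd z) * torus_dist (fst z) (snd z) \<partial>(\<mu> \<Otimes>\<^sub>M \<nu>)) \<le> e"
  shows "coupled e \<mu> \<nu>"
proof -
  interpret \<mu>: prob_space \<mu> by (rule torus_probsD[OF \<mu>])
  interpret \<nu>: prob_space \<nu> by (rule torus_probsD[OF \<nu>])
  interpret pair_prob_space \<mu> \<nu> ..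
  note [measurable_cong] = torus_probsD(2)[OF \<mu>] torus_probsD(2)[OF \<nu>]
  have sets_pair: "sets (\<mu> \<Otimes>\<^sub>M \<nu>) = sets (borel \<Otimes>\<^sub>M borel)"
    by (intro sets_pair_measure_cong torus_probsD \<mu> \<nu>)
  note [measurable_cong] = sets_pair
  have [measurable]: "(\<lambda>z. h (fst z) (snd z)) \<in> borel_measurable (\<mu> \<Otimes>\<^sub>M \<nu>)" using hm by measurable
  define \<gamma> where "\<gamma> = density (\<mu> \<Otimes>\<^sub>M \<nu>) (\<lambda>z. ennreal (h (fst z) (snd z)))"
  have [simp, measurable_cong]: "sets \<gamma> = sets (borel \<Otimes>\<^sub>M borel)" unfolding \<gamma>_def using sets_pair by simp
  have hx: "continuous_on UNIV (h x)" and hy: "continuous_on UNIV (\<lambda>x. h x y)" for x y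
  proof -
    have "continuous_on UNIV (\<lambda>y. (x, y))" "continuous_on UNIV (\<lambda>x. (x, y))" by (intro continuous_intros)+
    from this[THEN continuous_on_compose2[OF h(1)]] show "continuous_on UNIV (h x)" "continuous_on UNIV (\<lambda>x. h x y)"
      by simp_all
  qed
  have nn\<nu>: "(\<integral>\<^sup>+y. ennreal (h x y) \<partial>\<nu>) = ennreal (\<integral>y. h x y \<partial>\<nu>)" for x
    by (intro nn_integral_eq_integral integrable_torus \<nu> hx) (auto simp: h)
  have nn\<mu>: "(\<integral>\<^sup>+x. ennreal (h x y) \<partial>\<mu>) = ennreal (\<integral>x. h x y \<partial>\<mu>)" for y
    by (intro nn_integral_eq_integral integrable_torus \<mu> hy) (auto simp: h)
  have sp: "space \<gamma> = UNIV" using sets_eq_imp_space_eq[of \<gamma> "borel \<Otimes>\<^sub>M borel"] by (simp add: space_pair_measure)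
  have fst: "distr \<gamma> borel fst = \<mu>"
  proof (rule measure_eqI)
    fix A assume "A \<in> sets (distr \<gamma> borel fst)"
    then have [measurable]: "A \<in> sets borel" by simp
    have "emeasure (distr \<gamma> borel fst) A = emeasure \<gamma> (fst -` A \<inter> space \<gamma>)"
      by (rule emeasure_distr) auto
    also have "\<dots> = (\<integral>\<^sup>+z. ennreal (h (fst z) (snd z)) * indicator A (fst z) \<partial>(\<mu> \<Otimes>\<^sub>M \<nu>))"
      unfolding \<gamma>_def
      by (subst emeasure_density) (auto intro!: nn_integral_cong split: split_indicator)
    also have "\<dots> = (\<integral>\<^sup>+x. \<integral>\<^sup>+y. ennreal (h x y) * indicator A x \<partial>\<nu> \<partial>\<mu>)"
      by (subst \<nu>.nn_integral_fst[symmetric]) auto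
    also have "\<dots> = (\<integral>\<^sup>+x. indicator A x \<partial>\<mu>)"
      using marg(1)
    proof (intro nn_integral_cong_AE, eventually_elim)
      fix x assume "(\<integral>y. h x y \<partial>\<nu>) = 1"
      then show "(\<integral>\<^sup>+y. ennreal (h x y) * indicator A x \<partial>\<nu>) = indicator A x"
        using nn\<nu>[of x] hx[THEN borel_measurable_continuous_onI, of x] by (subst nn_integral_multc) auto
    qed
    also have "\<dots> = emeasure \<mu> A" by simp
    finally show "emeasure (distr \<gamma> borel fst) A = emeasure \<mu> A" .
  qed (simp add: torus_probsD(2)[OF \<mu>])
  have snd: "distr \<gamma> borel snd = \<nu>"
  proof (rule measure_eqI)
    fix A assume "A \<in> sets (distr \<gamma> borel snd)"
    then have [measurable]: "A \<in> sets borel" by simp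
    have "emeasure (distr \<gamma> borel snd) A = emeasure \<gamma> (snd -` A \<inter> space \<gamma>)"
      by (rule emeasure_distr) auto
    also have "\<dots> = (\<integral>\<^sup>+z. ennreal (h (fst z) (snd z)) * indicator A (snd z) \<partial>(\<mu> \<Otimes>\<^sub>M \<nu>))"
      unfolding \<gamma>_def
      by (subst emeasure_density) (auto intro!: nn_integral_cong split: split_indicator)
    also have "\<dots> = (\<integral>\<^sup>+y. \<integral>\<^sup>+x. ennreal (h x y) * indicator A y \<partial>\<mu> \<partial>\<nu>)"
      by (subst nn_integral_snd[symmetric]) (auto simp: case_prod_beta)
    also have "\<dots> = (\<integral>\<^sup>+y. indicator A y \<partial>\<nu>)"
    proof (rule nn_integral_cong)
      fix y
      show "(\<integral>\<^sup>+x. ennreal (h x y) * indicator A y \<partial>\<mu>) = indicator A y"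
        using nn\<mu>[of y] marg(2)[of y] hy[THEN borel_measurable_continuous_onI, of y] by (subst nn_integral_multc) auto
    qed
    also have "\<dots> = emeasure \<nu> A" by simp
    finally show "emeasure (distr \<gamma> borel snd) A = emeasure \<nu> A" .
  qed (simp add: torus_probsD(2)[OF \<nu>])
  have "prob_space \<gamma>"
  proof
    have "emeasure \<gamma> (space \<gamma>) = emeasure (distr \<gamma> borel fst) UNIV"
      by (subst emeasure_distr) auto
    then show "emeasure \<gamma> (space \<gamma>) = 1" using \<mu>.emeasure_space_1 torus_probsD(3)[OF \<mu>] by (simp add: fst)
  qed
  moreover have "(\<integral>z. torus_dist (fst z) (snd z) \<partial>\<gamma>) \<le> e"
    using e h(2) unfolding \<gamma>_def by (subst integral_density) auto
  ultimately show ?thesis unfolding coupled_def using fst snd by (intro exI[of _ \<gamma>]) auto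
qed

text \<open>With a partition of unity \<open>\<rho>\<close> into small cells and cell masses \<open>a\<close>, \<open>b\<close> of \<open>\<mu>\<close>, \<open>\<nu>\<close>
  satisfying \<open>b \<ge> (1 - \<eta>) a\<close>, couple a fraction \<open>1 - \<eta>\<close> of \<open>\<mu>\<close> cell by cell and the remaining
  mass independently. Cells with \<open>b = 0\<close> have \<open>a = 0\<close>, so division by \<open>0\<close> is harmless.\<close>

lemma coupled_neighbourhood:
  fixes \<mu> :: "'n::finite torus measure"
  assumes \<mu>: "\<mu> \<in> torus_probs" and e: "0 < e"
  obtains U where "openin weak_star U" "\<mu> \<in> U" "\<And>\<nu>. \<nu> \<in> U \<Longrightarrow> coupled e \<mu> \<nu>"
proof -
  let ?n = "real CARD('n)"
  \<comment> \<open>\<open>1/2\<close> keeps \<open>\<eta>\<close> below 1. The other entry makes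
    the independently coupled mass \<open>\<eta>\<close>, moved by at most \<open>CARD('n)\<close>,
    cost at most \<open>e / 2\<close>.\<close>
  define \<eta> where "\<eta> = min (1/2) (e / (2 * ?n))"
  have \<eta>: "0 < \<eta>" "\<eta> < 1" using e by (auto simp: \<eta>_def)
  have "\<eta> \<le> e / (2 * ?n)" by (simp add: \<eta>_def)
  then have \<eta>n: "?n * \<eta> \<le> e / 2" by (simp add: field_simps)
  \<comment> \<open>Radius \<open>e / 4\<close> puts any two points of a cell within distance
    \<open>e / 2\<close>.\<close>
  obtain J and \<rho> :: "'n torus \<Rightarrow> 'n torus \<Rightarrow> real" where J: "finite J"
    and c\<rho>: "\<And>p. p \<in> J \<Longrightarrow> continuous_on UNIV (\<rho> p)" and \<rho>0: "\<And>p q. 0 \<le> \<rho> p q" and \<rho>1: "\<And>q. (\<Sum>p\<in>J. \<rho> p q) = 1"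
    and supp: "\<And>p q. \<rho> p q \<noteq> 0 \<Longrightarrow> torus_dist p q < e / 4"
    using torus_partition[of "e / 4"] e by auto
  define a where "a p = (\<integral>x. \<rho> p x \<partial>\<mu>)" for p
  have a0: "0 \<le> a p" for p unfolding a_def by (intro integral_nonneg_AE AE_I2 \<rho>0)
  have int\<rho>: "integrable \<mu>' (\<rho> p)" if "p \<in> J" "\<mu>' \<in> torus_probs" for p \<mu>'
    using that c\<rho> by (intro integrable_torus)
  have suma: "(\<Sum>p\<in>J. a p) = 1"
    unfolding a_def using \<mu> by (subst Bochner_Integration.integral_sum[symmetric]) (auto simp: int\<rho> \<rho>1)
  \<comment> \<open>The strict lower bounds concern only cells with \<open>a p > 0\<close>, so that
    \<open>\<mu>\<close> itself satisfies them; on the other cells the bound is trivial. Upper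
    bounds are implicit, because both families of masses sum to 1.\<close>
  define U where "U = (\<Inter>p\<in>{p \<in> J. 0 < a p}. {\<nu> \<in> torus_probs. (\<integral>x. \<rho> p x \<partial>\<nu>) \<in> {(1 - \<eta>) * a p<..}}) \<inter> torus_probs"
  show thesis
  proof (rule that[of U])
    have "openin weak_star {\<nu> \<in> torus_probs. (\<integral>x. \<rho> p x \<partial>\<nu>) \<in> {(1 - \<eta>) * a p<..}}" if "p \<in> J" for p
      using openin_continuous_map_preimage[OF continuous_map_weak_star_integral[OF c\<rho>[OF that]], of "{(1 - \<eta>) * a p<..}"]
      by (simp add: topspace_weak_star)
    then show "openin weak_star U"
      unfolding U_def topspace_weak_star[symmetric] using J by (intro openin_INT) (auto simp: topspace_weak_star)
    show "\<mu> \<in> U" using \<mu> \<eta> by (auto simp: U_def a_def[symmetric] mult_less_cancel_right1)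
  next
    fix \<nu> assume \<nu>U: "\<nu> \<in> U"
    then have \<nu>: "\<nu> \<in> torus_probs" by (simp add: U_def)
    define b where "b p = (\<integral>x. \<rho> p x \<partial>\<nu>)" for p
    have b0: "0 \<le> b p" for p unfolding b_def by (intro integral_nonneg_AE AE_I2 \<rho>0)
    have sumb: "(\<Sum>p\<in>J. b p) = 1"
      unfolding b_def using \<nu> by (subst Bochner_Integration.integral_sum[symmetric]) (auto simp: int\<rho> \<rho>1)
    have ba: "(1 - \<eta>) * a p \<le> b p" if "p \<in> J" for p
    proof (cases "a p = 0")
      case False
      then have "0 < a p" using a0[of p] by simp
      then show ?thesis using \<nu>U that by (auto simp: U_def b_def)
    qed (use b0 in simp)
    have b_zero: "a p = 0" if "p \<in> J" "b p = 0" for p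
      using ba[OF that(1)] that(2) a0[of p] \<eta> by (simp add: mult_le_0_iff)
    \<comment> \<open>\<open>h1\<close> spreads the share \<open>1 - \<eta>\<close> of
      \<open>\<mu>\<close> in each cell over \<open>\<nu>\<close> in the same cell.
      \<open>h2\<close> is what the second marginal still lacks; it does not involve
      \<open>x\<close>, so this part is coupled independently.\<close>
    define h1 where "h1 x y = (1 - \<eta>) * (\<Sum>p\<in>J. \<rho> p x * \<rho> p y / b p)" for x y
    define h2 where "h2 y = (\<Sum>p\<in>J. (1 - (1 - \<eta>) * a p / b p) * \<rho> p y)" for y
    have h1_nonneg: "0 \<le> h1 x y" for x y
      unfolding h1_def using \<eta> b0 \<rho>0 by (intro mult_nonneg_nonneg sum_nonneg divide_nonneg_nonneg) auto
    \<comment> \<open>For \<open>b p = 0\<close> the quotient is 0 and the coefficient is 1.\<close>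
    have coef: "0 \<le> 1 - (1 - \<eta>) * a p / b p" if "p \<in> J" for p
      using ba[OF that] b0[of p] by (cases "b p = 0") (auto simp: divide_le_eq_1)
    have h2_nonneg: "0 \<le> h2 y" for y
      unfolding h2_def using coef \<rho>0 by (intro sum_nonneg mult_nonneg_nonneg) auto
    have c\<rho>': "continuous_on UNIV (\<lambda>z. \<rho> p (fst z))" "continuous_on UNIV (\<lambda>z. \<rho> p (snd z))" if "p \<in> J" for p
      using that by (auto intro!: continuous_on_compose2[OF c\<rho>] continuous_intros)
    have m\<rho>: "(\<lambda>z. \<rho> p (fst z)) \<in> borel_measurable (borel \<Otimes>\<^sub>M borel)" "(\<lambda>z. \<rho> p (snd z)) \<in> borel_measurable (borel \<Otimes>\<^sub>M borel)"
      if "p \<in> J" for p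
      using measurable_compose[OF measurable_fst borel_measurable_continuous_onI[OF c\<rho>[OF that]]]
        measurable_compose[OF measurable_snd borel_measurable_continuous_onI[OF c\<rho>[OF that]]] .
    let ?h = "\<lambda>x y. h1 x y + h2 y"
    have hc: "continuous_on UNIV (\<lambda>z. ?h (fst z) (snd z))"
      unfolding h1_def h2_def divide_inverse by (intro continuous_intros c\<rho>')
    have ch2: "continuous_on UNIV h2" unfolding h2_def by (intro continuous_intros c\<rho>)
    have hm: "(\<lambda>z. ?h (fst z) (snd z)) \<in> borel_measurable (borel \<Otimes>\<^sub>M borel)"
      unfolding h1_def h2_def divide_inverse
      by (intro borel_measurable_add borel_measurable_times borel_measurable_sum borel_measurable_const m\<rho>)
    have h2_int: "(\<integral>y. h2 y \<partial>\<nu>) = \<eta>"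
    proof -
      have "(\<integral>y. h2 y \<partial>\<nu>) = (\<Sum>p\<in>J. (1 - (1 - \<eta>) * a p / b p) * b p)"
        unfolding h2_def b_def using int\<rho>[OF _ \<nu>] by (subst Bochner_Integration.integral_sum) auto
      also have "\<dots> = (\<Sum>p\<in>J. b p - (1 - \<eta>) * a p)"
      proof (intro sum.cong refl)
        fix p assume p: "p \<in> J"
        show "(1 - (1 - \<eta>) * a p / b p) * b p = b p - (1 - \<eta>) * a p"
          using b_zero[OF p] by (cases "b p = 0") (simp_all add: field_simps)
      qed
      also have "\<dots> = \<eta>" by (simp add: sum_subtractf sumb suma sum_distrib_left[symmetric])
      finally show ?thesis .
    qed
    have margx: "AE x in \<mu>. (\<integral>y. ?h x y \<partial>\<nu>) = 1"
    proof -
      \<comment> \<open>If \<open>b p = 0\<close> then also \<open>a p = 0\<close>, so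
        \<open>\<rho> p\<close> vanishes \<open>\<mu>\<close>-almost everywhere. Outside this null
        set cancelling \<open>b p\<close> is correct in every summand.\<close>
      have "AE x in \<mu>. \<forall>p\<in>J. b p = 0 \<longrightarrow> \<rho> p x = 0"
      proof (rule AE_finite_allI[OF J])
        fix p assume p: "p \<in> J"
        show "AE x in \<mu>. b p = 0 \<longrightarrow> \<rho> p x = 0"
        proof (cases "b p = 0")
          case True
          then have "(\<integral>x. \<rho> p x \<partial>\<mu>) = 0" using b_zero[OF p] by (simp add: a_def)
          then show ?thesis
            using integral_nonneg_eq_0_iff_AE[OF int\<rho>[OF p \<mu>]] \<rho>0 by simp
        qed simp
      qed
      then show ?thesis
      proof eventually_elim
        fix x assume z: "\<forall>p\<in>J. b p = 0 \<longrightarrow> \<rho> p x = 0"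
        have "(\<integral>y. ?h x y \<partial>\<nu>) = (\<integral>y. h1 x y \<partial>\<nu>) + (\<integral>y. h2 y \<partial>\<nu>)"
        proof (rule Bochner_Integration.integral_add)
          show "integrable \<nu> (h1 x)" unfolding h1_def divide_inverse
            by (intro integrable_torus[OF \<nu>] continuous_intros c\<rho>)
        qed (rule integrable_torus[OF \<nu> ch2])
        also have "(\<integral>y. h1 x y \<partial>\<nu>) = (1 - \<eta>) * (\<Sum>p\<in>J. \<rho> p x * b p / b p)"
          unfolding h1_def b_def using int\<rho>[OF _ \<nu>] by (subst integral_mult_right_zero, subst Bochner_Integration.integral_sum) auto
        also have "(\<Sum>p\<in>J. \<rho> p x * b p / b p) = (\<Sum>p\<in>J. \<rho> p x)"
          using z by (intro sum.cong) auto
        finally show "(\<integral>y. ?h x y \<partial>\<nu>) = 1" by (simp add: \<rho>1 h2_int)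
      qed
    qed
    have margy: "(\<integral>x. ?h x y \<partial>\<mu>) = 1" for y
    proof -
      have "(\<integral>x. ?h x y \<partial>\<mu>) = (\<integral>x. h1 x y \<partial>\<mu>) + (\<integral>x. h2 y \<partial>\<mu>)"
      proof (rule Bochner_Integration.integral_add)
        show "integrable \<mu> (\<lambda>x. h1 x y)" unfolding h1_def divide_inverse
          by (intro integrable_torus[OF \<mu>] continuous_intros c\<rho>)
      qed (intro integrable_torus[OF \<mu>] continuous_intros)
      also have "(\<integral>x. h1 x y \<partial>\<mu>) = (1 - \<eta>) * (\<Sum>p\<in>J. a p * \<rho> p y / b p)"
        unfolding h1_def a_def using int\<rho>[OF _ \<mu>] by (subst integral_mult_right_zero, subst Bochner_Integration.integral_sum) auto
      also have "(\<integral>x. h2 y \<partial>\<mu>) = (\<Sum>p\<in>J. \<rho> p y) - (1 - \<eta>) * (\<Sum>p\<in>J. a p * \<rho> p y / b p)"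
        using \<mu> by (simp add: h2_def left_diff_distrib sum_subtractf sum_distrib_left mult.assoc)
      finally show ?thesis by (simp add: \<rho>1)
    qed
    show "coupled e \<mu> \<nu>"
    proof (rule coupledI[OF \<mu> \<nu> hc _ hm margx margy])
      show "0 \<le> ?h x y" for x y using h1_nonneg h2_nonneg by (intro add_nonneg_nonneg)
      interpret \<mu>: prob_space \<mu> by (rule torus_probsD[OF \<mu>])
      interpret \<nu>: prob_space \<nu> by (rule torus_probsD[OF \<nu>])
      interpret pair_prob_space \<mu> \<nu> ..
      have sets_pair: "sets (\<mu> \<Otimes>\<^sub>M \<nu>) = sets (borel \<Otimes>\<^sub>M borel)"
        by (intro sets_pair_measure_cong torus_probsD \<mu> \<nu>)
      note [measurable_cong] = sets_pair
      let ?d = "\<lambda>z :: 'n torus \<times> 'n torus. torus_dist (fst z) (snd z)"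
      have [measurable]: "(\<lambda>z. ?h (fst z) (snd z)) \<in> borel_measurable (\<mu> \<Otimes>\<^sub>M \<nu>)" using hm by measurable
      have [measurable]: "(\<lambda>z. h2 (snd z)) \<in> borel_measurable (\<mu> \<Otimes>\<^sub>M \<nu>)"
        using measurable_compose[OF measurable_snd borel_measurable_continuous_onI[OF ch2]] by measurable
      have [measurable]: "?d \<in> borel_measurable (\<mu> \<Otimes>\<^sub>M \<nu>)" by measurable
      have "compact ((\<lambda>z. ?h (fst z) (snd z)) ` (UNIV \<times> UNIV))"
        by (intro compact_continuous_image compact_Times compact_torus continuous_on_subset[OF hc]) auto
      then have "bounded (range (\<lambda>z. ?h (fst z) (snd z)))" by (simp add: compact_imp_bounded)
      then obtain C where C: "\<And>z. norm (?h (fst z) (snd z)) \<le> C" unfolding bounded_iff by blast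
      have ih: "integrable (\<mu> \<Otimes>\<^sub>M \<nu>) (\<lambda>z. ?h (fst z) (snd z))"
        using C by (intro P.integrable_const_bound[of _ C]) auto
      obtain C2 where C2: "\<And>y. norm (h2 y) \<le> C2" using continuous_on_torus_bounded[OF ch2] by metis
      have ih2: "integrable (\<mu> \<Otimes>\<^sub>M \<nu>) (\<lambda>z. h2 (snd z))"
        using C2 by (intro P.integrable_const_bound[of _ C2]) auto
      have Eh: "(\<integral>z. ?h (fst z) (snd z) \<partial>(\<mu> \<Otimes>\<^sub>M \<nu>)) = 1"
      proof -
        have "(\<integral>x. (\<integral>y. ?h x y \<partial>\<nu>) \<partial>\<mu>) = (\<integral>x. 1 \<partial>\<mu>)"
          by (rule integral_cong_AE[OF _ _ margx]) (use hm in measurable)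
        then show ?thesis using integral_fst'[OF ih] by (simp add: \<mu>.prob_space)
      qed
      have Eh2: "(\<integral>z. h2 (snd z) \<partial>(\<mu> \<Otimes>\<^sub>M \<nu>)) = \<eta>"
        using integral_fst'[OF ih2] by (simp add: \<mu>.prob_space h2_int)
      \<comment> \<open>Where \<open>h1\<close> is nonzero, both points lie in a common cell;
        \<open>h2\<close> is charged the bound \<open>CARD('n)\<close> on all distances.\<close>
      have pw: "?h (fst z) (snd z) * ?d z \<le> e / 2 * ?h (fst z) (snd z) + ?n * h2 (snd z)" for z
      proof -
        have "h1 (fst z) (snd z) * ?d z \<le> e / 2 * h1 (fst z) (snd z)"
        proof (cases "h1 (fst z) (snd z) = 0")
          case False
          then have "(\<Sum>p\<in>J. \<rho> p (fst z) * \<rho> p (snd z) / b p) \<noteq> 0" by (simp add: h1_def)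
          then obtain p where "\<rho> p (fst z) * \<rho> p (snd z) / b p \<noteq> 0" by (meson sum.neutral)
          then have "torus_dist p (fst z) < e / 4" "torus_dist p (snd z) < e / 4" using supp by auto
          then have "?d z \<le> e / 2"
            using torus_dist_triangle[of "fst z" "snd z" p] torus_dist_commute[of p "fst z"] by linarith
          then show ?thesis
            using mult_right_mono[OF _ h1_nonneg[of "fst z" "snd z"]] by (subst mult.commute) blast
        qed simp
        moreover have "h2 (snd z) * ?d z \<le> ?n * h2 (snd z)"
          using mult_left_mono[OF torus_dist_le_card[of "fst z" "snd z"] h2_nonneg[of "snd z"]]
          by (simp add: mult.commute[of ?n])
        moreover have "0 \<le> e / 2 * h2 (snd z)" using e h2_nonneg[of "snd z"] by simp
        ultimately show ?thesis by (simp add: distrib_left distrib_right)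
      qed
      have "(\<integral>z. ?h (fst z) (snd z) * ?d z \<partial>(\<mu> \<Otimes>\<^sub>M \<nu>)) \<le> (\<integral>z. e / 2 * ?h (fst z) (snd z) + ?n * h2 (snd z) \<partial>(\<mu> \<Otimes>\<^sub>M \<nu>))"
      proof (rule integral_mono[OF _ _ pw])
        show "integrable (\<mu> \<Otimes>\<^sub>M \<nu>) (\<lambda>z. ?h (fst z) (snd z) * ?d z)"
        proof (rule P.integrable_const_bound[of _ "C * ?n"])
          show "AE z in \<mu> \<Otimes>\<^sub>M \<nu>. norm (?h (fst z) (snd z) * ?d z) \<le> C * ?n"
          proof (intro AE_I2)
            fix z :: "'n torus \<times> 'n torus"
            have "0 \<le> C" using C[of z] norm_ge_zero by (rule order_trans[rotated])
            then show "norm (?h (fst z) (snd z) * ?d z) \<le> C * ?n"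
              unfolding norm_mult using C[of z] torus_dist_le_card[of "fst z" "snd z"] torus_dist_nonneg[of "fst z" "snd z"]
              by (intro mult_mono) auto
          qed
        qed measurable
        show "integrable (\<mu> \<Otimes>\<^sub>M \<nu>) (\<lambda>z. e / 2 * ?h (fst z) (snd z) + ?n * h2 (snd z))"
          by (intro Bochner_Integration.integrable_add integrable_mult_right ih ih2)
      qed
      also have "\<dots> = e / 2 * 1 + ?n * \<eta>"
        using ih ih2 Eh Eh2
        by (subst Bochner_Integration.integral_add) (auto simp only: integrable_mult_right integral_mult_right_zero)
      also have "\<dots> \<le> e" using \<eta>n by simp
      finally show "(\<integral>z. ?h (fst z) (snd z) * ?d z \<partial>(\<mu> \<Otimes>\<^sub>M \<nu>)) \<le> e" .
    qed
  qed
qed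

section \<open>Continuity of the dynamic functional\<close>

lemma weak_curve_Un:
  assumes "weak_curve a b m" "weak_curve b c m" "a \<le> b" "b \<le> c"
  shows "weak_curve a c m"
proof -
  have ac: "{a..c} = {a..b} \<union> {b..c}" using assms by auto
  show ?thesis
    using assms(1,2) unfolding weak_curve_def ac by (auto intro!: continuous_on_closed_Un)
qed

lemma joined_curve:
  fixes m m' :: "real \<Rightarrow> 'n::finite torus measure" and f :: "'n torus \<Rightarrow> real"
  assumes m: "weak_curve a b m" "action_ge P a b m c1" and m': "weak_curve b e m'" "action_ge P b e m' c2"
    and ends: "m b = m' b" and le: "a \<le> b" "b \<le> e"
  defines "j \<equiv> \<lambda>t. if t \<le> b then m t else m' t"
  shows "weak_curve a e j" "action_ge P a e j (c1 + c2)"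
    and "continuous_on UNIV f \<Longrightarrow> integral {a..e} (\<lambda>t. \<integral>x. f x \<partial>j t) =
      integral {a..b} (\<lambda>t. \<integral>x. f x \<partial>m t) + integral {b..e} (\<lambda>t. \<integral>x. f x \<partial>m' t)"
proof -
  have jm: "m t = j t" if "t \<in> {a..b}" for t using that by (simp add: j_def)
  have jm': "m' t = j t" if "t \<in> {b..e}" for t using that ends by (cases "t = b") (simp_all add: j_def)
  have wj: "weak_curve a b j" "weak_curve b e j"
    using weak_curve_cong[OF m(1) jm] weak_curve_cong[OF m'(1) jm'] by auto
  then show w: "weak_curve a e j" by (rule weak_curve_Un[OF _ _ le])
  show "action_ge P a e j (c1 + c2)"
    using action_ge_cong[OF m(2) jm le(1)] action_ge_cong[OF m'(2) jm' le(2)]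
    by (rule action_ge_join[OF _ _ w le])
  assume f: "continuous_on UNIV f"
  then have "continuous_on {a..e} (\<lambda>t. \<integral>x. f x \<partial>j t)" using w by (simp add: weak_curve_def)
  then have "integral {a..e} (\<lambda>t. \<integral>x. f x \<partial>j t) = integral {a..b} (\<lambda>t. \<integral>x. f x \<partial>j t) + integral {b..e} (\<lambda>t. \<integral>x. f x \<partial>j t)"
    using le by (intro Henstock_Kurzweil_Integration.integral_combine[symmetric] integrable_continuous_real)
  also have "integral {a..b} (\<lambda>t. \<integral>x. f x \<partial>j t) = integral {a..b} (\<lambda>t. \<integral>x. f x \<partial>m t)"
    by (intro integral_cong) (simp add: jm)
  also have "integral {b..e} (\<lambda>t. \<integral>x. f x \<partial>j t) = integral {b..e} (\<lambda>t. \<integral>x. f x \<partial>m' t)"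
    by (intro integral_cong) (simp add: jm')
  finally show "integral {a..e} (\<lambda>t. \<integral>x. f x \<partial>j t) =
      integral {a..b} (\<lambda>t. \<integral>x. f x \<partial>m t) + integral {b..e} (\<lambda>t. \<integral>x. f x \<partial>m' t)" .
qed

lemma integral_curve_bounds:
  fixes f :: "'n::finite torus \<Rightarrow> real"
  assumes m: "weak_curve a b m" and f: "continuous_on UNIV f" "\<And>x. \<bar>f x\<bar> \<le> M" and ab: "a \<le> b"
  shows "\<bar>integral {a..b} (\<lambda>t. \<integral>x. f x \<partial>m t)\<bar> \<le> (b - a) * M"
proof -
  have c: "continuous_on {a..b} (\<lambda>t. \<integral>x. f x \<partial>m t)" using m f by (simp add: weak_curve_def)
  have "\<bar>\<integral>x. f x \<partial>m t\<bar> \<le> M" if "t \<in> {a..b}" for t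
  proof -
    have mt: "m t \<in> torus_probs" using m that by (rule weak_curve_probs)
    have "f x \<le> M" "- M \<le> f x" for x using f(2)[of x] by auto
    then show ?thesis
      using integral_torus_le[OF mt f(1), of M] integral_torus_ge[OF mt f(1), of "- M"] by (simp add: abs_le_iff)
  qed
  then show ?thesis
    using integral_bound[OF ab c, of M] by (simp add: mult.commute)
qed

section \<open>The stationary functional and elementary bounds on the dynamic one\<close>

lemma F_stat_le:
  assumes "\<mu> \<in> torus_probs" "\<And>q. has_torus_gradient \<psi> (g q) q" "continuous_on UNIV g"
  shows "F_stat \<mu> P \<le> (\<integral>x. 1/2 * (norm (g x + P))\<^sup>2 \<partial>\<mu>)"
proof -
  have g: "torus_gradient \<psi> x = g x" for x using assms(2) by (rule torus_gradient_eq)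
  have "(INF \<phi>\<in>torus_C1. \<integral>x. (norm (torus_gradient \<phi> x + P))\<^sup>2 \<partial>\<mu>)
     \<le> (\<integral>x. (norm (torus_gradient \<psi> x + P))\<^sup>2 \<partial>\<mu>)"
    by (intro cINF_lower bdd_belowI2[of _ 0] torus_C1I[OF assms(2,3)]) simp
  then show ?thesis by (simp add: F_stat_def g)
qed

lemma torus_C1_const: "(\<lambda>_. c) \<in> torus_C1"
  by (rule torus_C1I[of _ "\<lambda>_. 0"]) (auto simp: has_torus_gradient_def GDERIV_const)

lemma F_stat_nonneg: "0 \<le> F_stat \<mu> P"
  unfolding F_stat_def using torus_C1_const[of 0] by (auto intro!: cINF_greatest)

lemma F_stat_approx:
  assumes "0 < \<kappa>"
  obtains \<psi> where "\<psi> \<in> torus_C1" "(\<integral>x. 1/2 * (norm (torus_gradient \<psi> x + P))\<^sup>2 \<partial>\<mu>) < F_stat \<mu> P + \<kappa>"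
proof -
  have "(INF \<phi>\<in>torus_C1. \<integral>x. (norm (torus_gradient \<phi> x + P))\<^sup>2 \<partial>\<mu>) < 2 * (F_stat \<mu> P + \<kappa>)"
    using assms by (simp add: F_stat_def)
  then obtain \<psi> where "\<psi> \<in> torus_C1" "(\<integral>x. (norm (torus_gradient \<psi> x + P))\<^sup>2 \<partial>\<mu>) < 2 * (F_stat \<mu> P + \<kappa>)"
    using torus_C1_const[of 0] by (subst (asm) cINF_less_iff) (auto intro!: bdd_belowI2[of _ 0])
  then show thesis by (intro that) auto
qed

text \<open>A constant curve is transport with velocity zero, so the time derivative integrates to
  the boundary terms. At each fixed time the slice of \<open>\<phi>\<close> competes in the infimum
  defining \<open>F_stat\<close>.\<close>

lemma action_ge_const:
  assumes \<mu>: "\<mu> \<in> torus_probs" and T: "0 \<le> T"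
  shows "action_ge P 0 T (\<lambda>_. \<mu>) (T * F_stat \<mu> P)"
  unfolding action_ge_def
proof (intro allI impI)
  fix \<phi> g d assume \<phi>: "spacetime_C1 \<phi> g (d :: 'a torus \<Rightarrow> real \<Rightarrow> real)"
  have "frac_rep \<in> borel_measurable \<mu>" "(\<lambda>_. 0 :: real ^ 'a) \<in> borel_measurable \<mu>"
    using measurable_frac_rep
      measurable_cong_sets[OF torus_probsD(2)[OF \<mu>] refl, of "borel :: (real ^ 'a) measure"] by auto
  note tr = torus_probsD(1)[OF \<mu>] this
  have const: "transport \<mu> frac_rep (\<lambda>_. 0) 0 t = \<mu>" for t
    by (simp add: transport_def distr_id2 torus_probsD(2)[OF \<mu>])
  have d: "((\<lambda>t. \<integral>x. d x t \<partial>\<mu>) has_integral ((\<integral>x. \<phi> x T \<partial>\<mu>) - (\<integral>x. \<phi> x 0 \<partial>\<mu>))) {0..T}"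
    using transport_continuity_equation(1)[OF tr, of 0 0 T, OF _ T \<phi>] by (simp add: const)
  have "((\<lambda>t. F_stat \<mu> P) has_integral (T * F_stat \<mu> P)) {0..T}"
    using has_integral_const_real[of "F_stat \<mu> P" 0 T] T by simp
  from has_integral_add[OF d this]
  show "(\<integral>x. \<phi> x T \<partial>\<mu>) - (\<integral>x. \<phi> x 0 \<partial>\<mu>) + T * F_stat \<mu> P
     \<le> integral {0..T} (\<lambda>t. \<integral>x. d x t + 1/2 * (norm (g x t + P))\<^sup>2 \<partial>\<mu>)"
  proof (rule has_integral_le[OF _ integrable_integral])
    show "(\<lambda>t. \<integral>x. d x t + 1/2 * (norm (g x t + P))\<^sup>2 \<partial>\<mu>) integrable_on {0..T}"
      by (intro integrable_on_curve weak_curve_const \<mu> spacetime_C1_integrand_continuous[OF \<phi>])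
    fix t
    have cd: "continuous_on UNIV (\<lambda>x. d x t)" and cg: "continuous_on UNIV (\<lambda>x. g x t)"
      using \<phi> by (auto simp: spacetime_C1_def intro: continuous_on_slice)
    have cn: "continuous_on UNIV (\<lambda>x. 1/2 * (norm (g x t + P))\<^sup>2)" by (intro continuous_intros cg)
    have "F_stat \<mu> P \<le> (\<integral>x. 1/2 * (norm (g x t + P))\<^sup>2 \<partial>\<mu>)"
      by (rule F_stat_le[OF \<mu> _ cg]) (use \<phi> in \<open>auto simp: spacetime_C1_def\<close>)
    then show "(\<integral>x. d x t \<partial>\<mu>) + F_stat \<mu> P \<le> (\<integral>x. d x t + 1/2 * (norm (g x t + P))\<^sup>2 \<partial>\<mu>)"
      by (subst Bochner_Integration.integral_add[OF integrable_torus[OF \<mu> cd] integrable_torus[OF \<mu> cn]]) simp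
  qed
qed

text \<open>Tested with the zero function. A real number strictly between the two sides reduces the
  claim to an inequality between reals.\<close>

lemma F_dyn_le:
  assumes T: "0 < T" and m: "weak_curve 0 T m"
  shows "F_dyn m P T \<le> ereal (1/2 * (norm P)\<^sup>2)"
proof (rule ccontr)
  assume "\<not> ?thesis"
  then obtain v where v: "1/2 * (norm P)\<^sup>2 < v" "ereal v < F_dyn m P T"
    using ereal_dense2[of "ereal (1/2 * (norm P)\<^sup>2)"] by (auto simp: not_le)
  have C1: "spacetime_C1 (\<lambda>_ _. 0) (\<lambda>_ _. 0) (\<lambda>_ _. 0 :: real)"
    by (rule spacetime_C1_stationary) (auto simp: has_torus_gradient_def GDERIV_const)
  have "v * T \<le> integral {0..T} (\<lambda>t. \<integral>x. 0 + 1/2 * (norm (0 + P))\<^sup>2 \<partial>m t)"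
    by (rule F_dyn_le_action[OF _ T m C1, of _ _ T]) (use v T in auto)
  also have "\<dots> = integral {0..T} (\<lambda>t. 1/2 * (norm P)\<^sup>2)"
    using weak_curve_probs[OF m] by (intro integral_cong) simp
  also have "\<dots> = T * (1/2 * (norm P)\<^sup>2)" using T by simp
  finally show False using v T by (simp add: mult.commute)
qed

section \<open>Values of loops and comparison between two base measures\<close>

context
  fixes \<Xi> :: "'n::finite torus \<Rightarrow> real" and M :: real
  assumes \<Xi>: "continuous_on UNIV \<Xi>" and M: "\<And>x. \<bar>\<Xi> x\<bar> \<le> M"
begin

lemma loops_iff:
  "m \<in> loops T \<mu> \<longleftrightarrow> weak_curve 0 T m \<and> m 0 = \<mu> \<and> m T = \<mu>"
  by (simp add: loops_def weak_curve_iff)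

lemma LBINT_curve:
  assumes "weak_curve 0 T m"
  shows "(LBINT t:{0..T}. \<integral>x. \<Xi> x \<partial>m t) = integral {0..T} (\<lambda>t. \<integral>x. \<Xi> x \<partial>m t)"
  using assms \<Xi> by (intro LBINT_eq_integral) (simp add: weak_curve_def)

lemma H_dyn_ge:
  assumes "m \<in> loops T \<mu>" "action_ge P 0 T m c" "0 < T"
  shows "ereal ((integral {0..T} (\<lambda>t. \<integral>x. \<Xi> x \<partial>m t) + c) / T) \<le> H_dyn \<Xi> T \<mu> P"
proof -
  have m: "weak_curve 0 T m" using assms(1) by (simp add: loops_iff)
  have "ereal ((integral {0..T} (\<lambda>t. \<integral>x. \<Xi> x \<partial>m t) + c) / T)
     = ereal (1 / T * integral {0..T} (\<lambda>t. \<integral>x. \<Xi> x \<partial>m t)) + ereal (c / T)"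
    by (simp add: add_divide_distrib)
  also have "\<dots> \<le> ereal (1 / T * (LBINT t:{0..T}. \<integral>x. \<Xi> x \<partial>m t)) + F_dyn m P T"
    using F_dyn_ge[OF assms(2) m assms(3)] by (intro add_mono) (simp_all add: LBINT_curve[OF m])
  also have "\<dots> \<le> H_dyn \<Xi> T \<mu> P" unfolding H_dyn_def by (rule SUP_upper[OF assms(1)])
  finally show ?thesis .
qed

lemma H_stat_le_H_dyn:
  assumes "\<mu> \<in> torus_probs" "0 < T"
  shows "ereal (H_stat \<Xi> \<mu> P) \<le> H_dyn \<Xi> T \<mu> P"
proof -
  have "(\<lambda>_. \<mu>) \<in> loops T \<mu>" using assms by (simp add: loops_iff weak_curve_const)
  from H_dyn_ge[OF this action_ge_const[OF assms(1)] assms(2), of P] show ?thesis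
    using assms by (simp add: H_stat_def add_divide_distrib)
qed

lemma H_stat_ge: "\<mu> \<in> torus_probs \<Longrightarrow> - M \<le> H_stat \<Xi> \<mu> P"
  using integral_torus_ge[OF _ \<Xi>, of \<mu> "- M"] M F_stat_nonneg[of \<mu> P]
  unfolding H_stat_def by (smt (verit) abs_le_iff)

text \<open>The passage from extended reals to reals: a loop whose value exceeds a real
  \<open>v\<close> has an honest action bound. Loops with \<open>F_dyn\<close> equal to
  \<open>-\<infinity>\<close> never satisfy the premise.\<close>

lemma loop_value_lessD:
  assumes m: "m \<in> loops T \<mu>" and T: "0 < T"
    and v: "ereal v < ereal (1 / T * (LBINT t:{0..T}. \<integral>x. \<Xi> x \<partial>m t)) + F_dyn m P T"
  shows "action_ge P 0 T m (T * v - integral {0..T} (\<lambda>t. \<integral>x. \<Xi> x \<partial>m t))"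
    and "v \<le> M + 1/2 * (norm P)\<^sup>2"
proof -
  define I where "I = integral {0..T} (\<lambda>t. \<integral>x. \<Xi> x \<partial>m t)"
  have w: "weak_curve 0 T m" using m by (simp add: loops_iff)
  have v': "ereal v < ereal (I / T) + F_dyn m P T" using v LBINT_curve[OF w] by (simp add: I_def)
  have "ereal ((T * v - I) / T) \<le> F_dyn m P T"
  proof (cases "F_dyn m P T")
    case (real r)
    then show ?thesis using v' T by (simp add: field_simps)
  qed (use v' in auto)
  then show A: "action_ge P 0 T m (T * v - integral {0..T} (\<lambda>t. \<integral>x. \<Xi> x \<partial>m t))"
    unfolding I_def by (rule action_ge_F_dyn[OF _ T w])
  have "ereal (I / T) + F_dyn m P T \<le> ereal M + ereal (1/2 * (norm P)\<^sup>2)"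
    using integral_curve_bounds[OF w \<Xi> M] T
    by (intro add_mono F_dyn_le[OF T w]) (simp add: I_def divide_le_eq abs_le_iff mult.commute)
  with v' have "ereal v < ereal M + ereal (1/2 * (norm P)\<^sup>2)" by (rule less_le_trans)
  then show "v \<le> M + 1/2 * (norm P)\<^sup>2" by simp
qed

lemma H_dyn_le:
  assumes "0 < T"
  shows "H_dyn \<Xi> T \<mu> P \<le> ereal (M + 1/2 * (norm P)\<^sup>2)"
  unfolding H_dyn_def
proof (rule SUP_least, rule ccontr)
  fix m assume m: "m \<in> loops T \<mu>"
    and "\<not> ereal (1 / T * (LBINT t:{0..T}. \<integral>x. \<Xi> x \<partial>m t)) + F_dyn m P T \<le> ereal (M + 1/2 * (norm P)\<^sup>2)"
  then obtain v where "M + 1/2 * (norm P)\<^sup>2 < v"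
    "ereal v < ereal (1 / T * (LBINT t:{0..T}. \<integral>x. \<Xi> x \<partial>m t)) + F_dyn m P T"
    using ereal_dense2[of "ereal (M + 1/2 * (norm P)\<^sup>2)"] by (auto simp: not_le)
  then show False using loop_value_lessD(2)[OF m assms, of v P] by simp
qed

text \<open>From a loop at \<open>\<mu>\<close> build one at \<open>\<nu>\<close>: travel from \<open>\<nu>\<close> to \<open>\<mu>\<close> in time \<open>\<delta>\<close>, run through the
  given loop at a slightly higher speed, and travel back.\<close>

lemma H_dyn_coupled_step:
  assumes c: "coupled e \<mu> \<nu>" and m: "m \<in> loops T \<mu>" and act: "action_ge P 0 T m c"
    and T: "0 < T" and \<delta>: "0 < \<delta>" "4 * \<delta> \<le> T" and C: "\<bar>c\<bar> \<le> C" and M0: "0 \<le> M"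
  defines "I \<equiv> integral {0..T} (\<lambda>t. \<integral>x. \<Xi> x \<partial>m t)"
  shows "ereal ((I + c - \<delta> * (8 / T * (C + T * (norm P)\<^sup>2) + 4 * M) - 2 * (norm P + CARD('n) / (2 * \<delta>)) * e) / T)
     \<le> H_dyn \<Xi> T \<nu> P"
proof -
  \<comment> \<open>Chosen so that \<open>s T = T - 2 \<delta>\<close> leaves time
    \<open>\<delta>\<close> at either end; \<open>4 \<delta> \<le> T\<close> gives
    \<open>s \<ge> 1/2\<close>.\<close>
  define s where "s = 1 - 2 * \<delta> / T"
  have s: "1/2 \<le> s" "s \<le> 1" "s * T = T - 2 * \<delta>" using T \<delta> by (auto simp: s_def field_simps)
  have w: "weak_curve 0 T m" "m 0 = \<mu>" "m T = \<mu>" using m by (auto simp: loops_iff)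
  define X where "X = 8 / T * (C + T * (norm P)\<^sup>2)"
  define A where "A = norm P + CARD('n) / (2 * \<delta>)"
  define k where "k = - A * e"
  obtain p where p: "weak_curve 0 \<delta> p" "p 0 = \<nu>" "p \<delta> = \<mu>" "action_ge P 0 \<delta> p k"
    using coupled_curve[OF coupled_commute[OF c] \<delta>(1), of P] unfolding k_def A_def by auto
  obtain q where q: "weak_curve (T - \<delta>) T q" "q (T - \<delta>) = \<mu>" "q T = \<nu>" "action_ge P (T - \<delta>) T q k"
    using coupled_curve[OF c, of "T - \<delta>" T P] \<delta> unfolding k_def A_def by auto
  define r where "r t = m ((t - \<delta>) / s)" for t
  define c' where "c' = ((2 - s) * c - 2 * (1 - s) * T * (norm P)\<^sup>2) / s"
  have end_r: "\<delta> + s * T = T - \<delta>" using s by simp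
  have r: "weak_curve \<delta> (T - \<delta>) r" "action_ge P \<delta> (T - \<delta>) r c'"
    using weak_curve_rescale[OF w(1), of s \<delta>] action_ge_rescale[OF act w(1), of s \<delta>] s T
    unfolding r_def[abs_def] c'_def end_r by auto
  have "(T - \<delta> - \<delta>) / s = T" using s by (simp add: field_simps)
  then have rends: "r \<delta> = \<mu>" "r (T - \<delta>) = \<mu>" using w by (simp_all add: r_def)
  define j where "j t = (if t \<le> \<delta> then p t else r t)" for t
  define l where "l t = (if t \<le> T - \<delta> then j t else q t)" for t
  have le: "0 \<le> \<delta>" "\<delta> \<le> T - \<delta>" "0 \<le> T - \<delta>" "T - \<delta> \<le> T" using \<delta> by auto
  have "p \<delta> = r \<delta>" using p rends by simp
  note j = joined_curve[OF p(1,4) r this le(1,2), folded j_def]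
  have "j (T - \<delta>) = q (T - \<delta>)" using rends q \<delta> by (simp add: j_def)
  note l = joined_curve[OF j(1,2) q(1,4) this le(3,4), folded l_def]
  have "l 0 = \<nu>" "l T = \<nu>" using p q \<delta> by (simp_all add: l_def j_def)
  then have "l \<in> loops T \<nu>" using l(1) by (simp add: loops_iff)
  from H_dyn_ge[OF this l(2) T]
  have H: "ereal ((integral {0..T} (\<lambda>t. \<integral>x. \<Xi> x \<partial>l t) + (k + c' + k)) / T) \<le> H_dyn \<Xi> T \<nu> P" .
  have "integral {0..T} (\<lambda>t. \<integral>x. \<Xi> x \<partial>l t) = integral {0..\<delta>} (\<lambda>t. \<integral>x. \<Xi> x \<partial>p t)
     + integral {\<delta>..T - \<delta>} (\<lambda>t. \<integral>x. \<Xi> x \<partial>r t) + integral {T - \<delta>..T} (\<lambda>t. \<integral>x. \<Xi> x \<partial>q t)"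
    using j(3)[OF \<Xi>] l(3)[OF \<Xi>] by simp
  moreover have "integral {\<delta>..T - \<delta>} (\<lambda>t. \<integral>x. \<Xi> x \<partial>r t) = s * I"
  proof -
    have "continuous_on {\<delta>..\<delta> + s * T} (\<lambda>t. \<integral>x. \<Xi> x \<partial>r t)"
      unfolding end_r using r(1) \<Xi> by (simp add: weak_curve_def)
    from integral_rescale[OF this] show ?thesis using s T end_r by (simp add: r_def I_def)
  qed
  moreover have "\<bar>integral {0..\<delta>} (\<lambda>t. \<integral>x. \<Xi> x \<partial>p t)\<bar> \<le> \<delta> * M"
    using integral_curve_bounds[OF p(1) \<Xi> M] \<delta> by simp
  moreover have "\<bar>integral {T - \<delta>..T} (\<lambda>t. \<integral>x. \<Xi> x \<partial>q t)\<bar> \<le> \<delta> * M"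
    using integral_curve_bounds[OF q(1) \<Xi> M] \<delta> by simp
  moreover have "I - 2 * \<delta> * M \<le> s * I"
  proof -
    have "\<bar>I\<bar> \<le> T * M" using integral_curve_bounds[OF w(1) \<Xi> M] T by (simp add: I_def)
    then have "(1 - s) * I \<le> (1 - s) * (T * M)" using s by (intro mult_left_mono) auto
    also have "\<dots> = 2 * \<delta> * M" using T by (simp add: s_def)
    finally show ?thesis by (simp add: left_diff_distrib)
  qed
  \<comment> \<open>The connecting pieces lose at most \<open>2 \<delta> M\<close>, and the time cut
    from the loop, the fraction \<open>1 - s = 2 \<delta> / T\<close>, another
    \<open>2 \<delta> M\<close>.\<close>
  ultimately have I: "I - 4 * \<delta> * M \<le> integral {0..T} (\<lambda>t. \<integral>x. \<Xi> x \<partial>l t)" by linarith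
  \<comment> \<open>The rescaled bound is \<open>c\<close> plus \<open>2 (1 - s) / s\<close> times
    \<open>c - T |P|^2\<close>, and \<open>s \<ge> 1/2\<close> bounds that factor by
    \<open>8 \<delta> / T\<close>.\<close>
  have "c - 8 * \<delta> / T * (C + T * (norm P)\<^sup>2) \<le> c'"
  proof -
    have "0 \<le> C + T * (norm P)\<^sup>2" using C T by (intro add_nonneg_nonneg) auto
    moreover have "2 * (1 - s) / s \<le> 8 * \<delta> / T"
    proof -
      have "2 * (1 - s) / s \<le> 2 * (1 - s) / (1/2)" using s by (intro divide_left_mono) auto
      also have "\<dots> = 8 * \<delta> / T" by (simp add: s_def)
      finally show ?thesis .
    qed
    ultimately have "2 * (1 - s) / s * (C + T * (norm P)\<^sup>2) \<le> 8 * \<delta> / T * (C + T * (norm P)\<^sup>2)"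
      by (intro mult_right_mono) auto
    moreover have "2 * (1 - s) / s * (- C) \<le> 2 * (1 - s) / s * c"
      using s C by (intro mult_left_mono divide_nonneg_nonneg) auto
    moreover have "c' = c + 2 * (1 - s) / s * c - 2 * (1 - s) / s * (T * (norm P)\<^sup>2)"
      using s by (simp add: c'_def field_simps)
    ultimately show ?thesis unfolding distrib_left mult_minus_right by linarith
  qed
  moreover have "8 * \<delta> / T * (C + T * (norm P)\<^sup>2) = \<delta> * X" unfolding X_def by (simp only: mult.commute mult.left_commute times_divide_eq_left times_divide_eq_right)
  ultimately have c': "c - \<delta> * X \<le> c'" by simp
  have "I + c - \<delta> * (X + 4 * M) - 2 * A * e = (I - 4 * \<delta> * M) + (k + (c - \<delta> * X) + k)"
    by (simp add: k_def algebra_simps)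
  also have "\<dots> \<le> integral {0..T} (\<lambda>t. \<integral>x. \<Xi> x \<partial>l t) + (k + c' + k)"
    using I c' by linarith
  finally have "I + c - \<delta> * (X + 4 * M) - 2 * A * e \<le> integral {0..T} (\<lambda>t. \<integral>x. \<Xi> x \<partial>l t) + (k + c' + k)" .
  then show ?thesis
    unfolding X_def[symmetric] A_def[symmetric]
    using T by (intro order_trans[OF _ H]) (simp add: divide_right_mono)
qed

text \<open>A loop at \<open>\<mu>\<close> can violate the estimate only if its value exceeds the
  one at \<open>\<nu>\<close>, which is at least \<open>- M\<close>. This confines the action
  constants to a fixed range, so \<open>e\<close> can be chosen independently of both
  measures.\<close>

lemma H_dyn_coupled:
  assumes T: "0 < T" and \<kappa>: "0 < \<kappa>"
  obtains e where "0 < e"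
    "\<And>\<mu> \<nu>. \<nu> \<in> torus_probs \<Longrightarrow> coupled e \<mu> \<nu> \<Longrightarrow> H_dyn \<Xi> T \<mu> P \<le> H_dyn \<Xi> T \<nu> P + ereal \<kappa>"
proof -
  have M0: "0 \<le> M" using M[of undefined] by linarith
  \<comment> \<open>Bounds \<open>\<bar>T * v - I\<bar>\<close> for the loops that matter:
    \<open>\<bar>v\<bar> \<le> M + |P|^2 / 2\<close> and
    \<open>\<bar>I\<bar> \<le> T M\<close>.\<close>
  define C where "C = T * (2 * M + 1/2 * (norm P)\<^sup>2)"
  define Q where "Q = 8 / T * (C + T * (norm P)\<^sup>2) + 4 * M"
  have Q: "0 \<le> Q" using M0 T by (simp add: Q_def C_def)
  \<comment> \<open>The losses proportional to \<open>\<delta>\<close> receive half of the budget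
    \<open>\<kappa> T\<close>.\<close>
  define \<delta> where "\<delta> = min (T / 4) (\<kappa> * T / (2 * (Q + 1)))"
  have \<delta>: "0 < \<delta>" "4 * \<delta> \<le> T" using T \<kappa> Q by (auto simp: \<delta>_def)
  have \<delta>Q: "\<delta> * Q \<le> \<kappa> * T / 2"
  proof -
    have "\<delta> * Q \<le> \<delta> * (Q + 1)" using \<delta> by (intro mult_left_mono) auto
    also have "\<dots> \<le> \<kappa> * T / (2 * (Q + 1)) * (Q + 1)" using Q by (intro mult_right_mono) (auto simp: \<delta>_def)
    also have "\<dots> = \<kappa> * T / 2" using Q by (simp add: field_simps)
    finally show ?thesis .
  qed
  define K where "K = norm P + CARD('n) / (2 * \<delta>)"
  have K: "0 < K" using \<delta> unfolding K_def by (intro add_nonneg_pos divide_pos_pos) auto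
  \<comment> \<open>The two connecting curves receive the other half. Since \<open>K\<close> grows
    like \<open>1 / \<delta>\<close>, this choice has to follow that of
    \<open>\<delta>\<close>.\<close>
  define e where "e = \<kappa> * T / (4 * K)"
  have e: "0 < e" "2 * K * e = \<kappa> * T / 2" using K \<kappa> T by (auto simp: e_def)
  show thesis
  proof (rule that[of e])
    fix \<mu> \<nu> :: "'n torus measure"
    assume \<nu>: "\<nu> \<in> torus_probs" and c: "coupled e \<mu> \<nu>"
    have Hm: "ereal (- M) \<le> H_dyn \<Xi> T \<nu> P"
      using H_stat_le_H_dyn[OF \<nu> T, of P] H_stat_ge[OF \<nu>, of P] by (meson ereal_less_eq(3) order_trans)
    show "H_dyn \<Xi> T \<mu> P \<le> H_dyn \<Xi> T \<nu> P + ereal \<kappa>"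
      unfolding H_dyn_def[of \<Xi> T \<mu>]
    proof (rule SUP_least, rule ccontr)
      fix m assume m: "m \<in> loops T \<mu>"
        and "\<not> ereal (1 / T * (LBINT t:{0..T}. \<integral>x. \<Xi> x \<partial>m t)) + F_dyn m P T \<le> H_dyn \<Xi> T \<nu> P + ereal \<kappa>"
      then obtain v where v: "H_dyn \<Xi> T \<nu> P + ereal \<kappa> < ereal v"
        "ereal v < ereal (1 / T * (LBINT t:{0..T}. \<integral>x. \<Xi> x \<partial>m t)) + F_dyn m P T"
        using ereal_dense2 by (metis not_le)
      define I where "I = integral {0..T} (\<lambda>t. \<integral>x. \<Xi> x \<partial>m t)"
      note A = loop_value_lessD[OF m T v(2)]
      have "ereal (- M + \<kappa>) < ereal v"
        using le_less_trans[OF add_right_mono[OF Hm, of "ereal \<kappa>"] v(1)] by simp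
      then have "- M \<le> v" using \<kappa> by simp
      then have vb: "\<bar>v\<bar> \<le> M + 1/2 * (norm P)\<^sup>2" using A(2) zero_le_power2[of "norm P"] by linarith
      have "\<bar>I\<bar> \<le> T * M"
        using m integral_curve_bounds[OF _ \<Xi> M, of 0 T m] T by (simp add: I_def loops_iff)
      moreover have "\<bar>T * v\<bar> \<le> T * (M + 1/2 * (norm P)\<^sup>2)"
        using vb T by (simp add: abs_mult)
      ultimately have C: "\<bar>T * v - I\<bar> \<le> C" by (simp add: C_def algebra_simps)
      have "v - \<kappa> \<le> (I + (T * v - I) - \<delta> * Q - 2 * K * e) / T"
      proof -
        have "(v - \<kappa>) * T = T * v - \<kappa> * T" by (simp add: algebra_simps)
        then have "(v - \<kappa>) * T \<le> I + (T * v - I) - \<delta> * Q - 2 * K * e" using \<delta>Q e(2) by linarith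
        then show ?thesis by (simp only: pos_le_divide_eq[OF T])
      qed
      moreover have "ereal ((I + (T * v - I) - \<delta> * Q - 2 * K * e) / T) \<le> H_dyn \<Xi> T \<nu> P"
        using H_dyn_coupled_step[OF c m A(1) T \<delta> C[unfolded I_def] M0] unfolding I_def Q_def K_def by simp
      ultimately have "ereal (v - \<kappa>) \<le> H_dyn \<Xi> T \<nu> P" by (meson ereal_less_eq(3) order_trans)
      from add_right_mono[OF this, of "ereal \<kappa>"] have "ereal v \<le> H_dyn \<Xi> T \<nu> P + ereal \<kappa>" by simp
      with v(1) show False by simp
    qed
  qed (rule e)
qed

end

section \<open>The short-time limit\<close>

text \<open>Stone-Weierstrass below is applied on a Hausdorff space. Points are separated by being
  nearer to, or farther from, \<open>p\<close> than half their distance.\<close>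

instance torus :: (finite) t2_space
proof
  fix p q :: "'a torus" assume "p \<noteq> q"
  have "0 < torus_dist p q"
  proof (rule ccontr)
    assume "\<not> 0 < torus_dist p q"
    then have "norm (torus_diff p q) \<le> 0" using norm_torus_diff_le[of p q] by linarith
    then have "torus_diff p q = 0" by simp
    then show False using torus_proj_torus_diff[of p q] \<open>p \<noteq> q\<close> by simp
  qed
  moreover have "open {x. torus_dist p x < torus_dist p q / 2}" "open {x. torus_dist p q / 2 < torus_dist p x}"
    by (intro open_Collect_less continuous_on_torus_dist continuous_on_const)+
  ultimately show "\<exists>U V. open U \<and> open V \<and> p \<in> U \<and> q \<in> V \<and> U \<inter> V = {}"
    by (intro exI[of _ "{x. torus_dist p x < torus_dist p q / 2}"] exI[of _ "{x. torus_dist p q / 2 < torus_dist p x}"])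
       auto
qed

lemma torus_C1_add: "f \<in> torus_C1 \<Longrightarrow> g \<in> torus_C1 \<Longrightarrow> (\<lambda>x. f x + g x) \<in> torus_C1"
proof -
  assume f: "f \<in> torus_C1" and g: "g \<in> torus_C1"
  show ?thesis
  proof (rule torus_C1I)
    show "has_torus_gradient (\<lambda>x. f x + g x) (torus_gradient f q + torus_gradient g q) q" for q
      using has_torus_gradient_torus_gradient[OF f, of q] has_torus_gradient_torus_gradient[OF g, of q]
      by (simp add: has_torus_gradient_def GDERIV_add)
    show "continuous_on UNIV (\<lambda>q. torus_gradient f q + torus_gradient g q)"
      using f g by (intro continuous_on_add) (auto simp: torus_C1_def)
  qed
qed

lemma torus_C1_mult: "f \<in> torus_C1 \<Longrightarrow> g \<in> torus_C1 \<Longrightarrow> (\<lambda>x. f x * g x) \<in> torus_C1"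
proof -
  assume f: "f \<in> torus_C1" and g: "g \<in> torus_C1"
  note Df = has_torus_gradient_torus_gradient[OF f] and Dg = has_torus_gradient_torus_gradient[OF g]
  show ?thesis
  proof (rule torus_C1I)
    show "has_torus_gradient (\<lambda>x. f x * g x) (f q *\<^sub>R torus_gradient g q + g q *\<^sub>R torus_gradient f q) q" for q
      using Df[of q] Dg[of q] unfolding has_torus_gradient_def by (auto dest: GDERIV_mult)
    show "continuous_on UNIV (\<lambda>q. f q *\<^sub>R torus_gradient g q + g q *\<^sub>R torus_gradient f q)"
      using f g by (intro continuous_on_add continuous_on_scaleR continuous_on_has_torus_gradient[OF Df]
          continuous_on_has_torus_gradient[OF Dg]) (auto simp: torus_C1_def)
  qed
qed

lemma sin_cos_2pi_cong_int:
  assumes "z - w \<in> \<int>"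
  shows "sin (2 * pi * z) = sin (2 * pi * w)" "cos (2 * pi * z) = cos (2 * pi * w)"
proof -
  obtain k where "z - w = of_int k" using assms by (rule Ints_cases)
  then have "z = w + of_int k" by simp
  then have "2 * pi * z = 2 * pi * w + 2 * pi * of_int k" by (simp only: distrib_left)
  then show "sin (2 * pi * z) = sin (2 * pi * w)" "cos (2 * pi * z) = cos (2 * pi * w)"
    using sin_cos_eq_iff[of "2 * pi * z" "2 * pi * w"] by blast+
qed

text \<open>In a coordinate where the points differ modulo the integers, the cosine centred at
  \<open>p\<close> takes the value 1 at \<open>p\<close> but not at \<open>q\<close>.\<close>

lemma torus_C1_separates:
  fixes p q :: "'n::finite torus"
  assumes "p \<noteq> q"
  obtains f where "f \<in> torus_C1" "f p \<noteq> f q"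
proof -
  have "\<exists>i. rep_torus q $ i - rep_torus p $ i \<notin> \<int>"
    using assms torus_proj_eq_iff[of "rep_torus q" "rep_torus p"] by auto
  then obtain i where i: "rep_torus q $ i - rep_torus p $ i \<notin> \<int>" by blast
  let ?c = "rep_torus p $ i"
  define f where "f x = cos (2 * pi * (rep_torus x $ i - ?c))" for x
  define g where "g x = (- 2 * pi * sin (2 * pi * (rep_torus x $ i - ?c))) *\<^sub>R axis i (1 :: real)" for x :: "'n torus"
  have rep: "rep_torus (torus_proj x) $ i - ?c - (x $ i - ?c) \<in> \<int>" for x
    using torus_proj_eq_iff[of "rep_torus (torus_proj x)" x] by simp
  have fp: "f (torus_proj x) = cos (2 * pi * (x $ i - ?c))" for x
    unfolding f_def by (rule sin_cos_2pi_cong_int[OF rep])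
  have gp: "g (torus_proj x) = (- 2 * pi * sin (2 * pi * (x $ i - ?c))) *\<^sub>R axis i 1" for x
    unfolding g_def using sin_cos_2pi_cong_int(1)[OF rep[of x]] by simp
  show thesis
  proof (rule that[of f])
    show "f \<in> torus_C1"
    proof (rule torus_C1I[of f g])
      have "GDERIV (\<lambda>y. cos (2 * pi * (y $ i - ?c))) x :> g (torus_proj x)" for x
        unfolding gderiv_def gp
        by (auto intro!: derivative_eq_intros bounded_linear.has_derivative[OF bounded_linear_vec_nth] simp: inner_axis)
      then show "has_torus_gradient f (g q) q" for q
        by (auto simp: has_torus_gradient_def fp)
      show "continuous_on UNIV g"
        by (rule continuous_on_torusI) (simp add: gp, intro continuous_intros)
    qed
    show "f p \<noteq> f q"
    proof
      assume "f p = f q"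
      then have "cos (2 * pi * (rep_torus q $ i - ?c)) = 1" by (simp add: f_def)
      then obtain k :: int where "2 * pi * (rep_torus q $ i - ?c) = of_int k * 2 * pi"
        by (auto simp: cos_one_2pi_int)
      then have "rep_torus q $ i - ?c = of_int k" by simp
      with i show False by (metis Ints_of_int)
    qed
  qed
qed

lemma torus_C1_dense:
  fixes f :: "'n::finite torus \<Rightarrow> real"
  assumes "continuous_on UNIV f" "0 < e"
  obtains g where "g \<in> torus_C1" "\<And>x. \<bar>f x - g x\<bar> < e"
proof -
  interpret function_ring_on "torus_C1 :: ('n torus \<Rightarrow> real) set" UNIV
  proof
    fix f :: "'n torus \<Rightarrow> real" assume "f \<in> torus_C1"
    then show "continuous_on UNIV f"
      by (rule continuous_on_has_torus_gradient[OF has_torus_gradient_torus_gradient])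
  next
    fix p q :: "'n torus" assume "p \<noteq> q"
    then obtain f where "f \<in> torus_C1" "f p \<noteq> f q" by (rule torus_C1_separates)
    then show "\<exists>f\<in>torus_C1. f p \<noteq> f q" by blast
  qed (auto intro: torus_C1_add torus_C1_mult torus_C1_const compact_torus)
  show thesis using Stone_Weierstrass_basic[OF assms] that by auto
qed

lemma H_dyn_upper:
  fixes \<Xi> :: "'n::finite torus \<Rightarrow> real"
  assumes \<Xi>: "continuous_on UNIV \<Xi>" and \<mu>: "\<mu> \<in> torus_probs" and \<kappa>: "0 < \<kappa>"
  obtains T0 where "0 < T0" "\<And>T. 0 < T \<Longrightarrow> T < T0 \<Longrightarrow> H_dyn \<Xi> T \<mu> P \<le> ereal (H_stat \<Xi> \<mu> P + \<kappa>)"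
proof -
  obtain M where M: "\<And>x. \<bar>\<Xi> x\<bar> \<le> M" using continuous_on_torus_bounded[OF \<Xi>] by (metis real_norm_def)
  obtain \<psi> where \<psi>: "\<psi> \<in> torus_C1" "(\<integral>x. 1/2 * (norm (torus_gradient \<psi> x + P))\<^sup>2 \<partial>\<mu>) < F_stat \<mu> P + \<kappa> / 4"
    using F_stat_approx[of "\<kappa> / 4"] \<kappa> by auto
  define u where "u x = 1/2 * (norm (torus_gradient \<psi> x + P))\<^sup>2" for x
  have c\<psi>: "continuous_on UNIV (torus_gradient \<psi>)" using \<psi>(1) by (simp add: torus_C1_def)
  have u: "continuous_on UNIV u" unfolding u_def by (intro continuous_intros c\<psi>)
  have "continuous_on UNIV (\<lambda>x. \<Xi> x + u x)" by (intro continuous_intros \<Xi> u)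
  then obtain f where f: "f \<in> torus_C1" "\<And>x. \<bar>\<Xi> x + u x - f x\<bar> < \<kappa> / 8"
    using torus_C1_dense[of "\<lambda>x. \<Xi> x + u x" "\<kappa> / 8"] \<kappa> by auto
  note Df = has_torus_gradient_torus_gradient[OF f(1)]
  have cf: "continuous_on UNIV f" by (rule continuous_on_has_torus_gradient[OF Df])
  have cgf: "continuous_on UNIV (torus_gradient f)" using f(1) by (simp add: torus_C1_def)
  obtain L where L: "0 \<le> L" "\<And>x. norm (torus_gradient f x) \<le> L" using continuous_on_torus_bounded[OF cgf] by metis
  \<comment> \<open>Bounds the kinetic term of the test function \<open>- (t / T) f\<close>, whose
    gradient stays bounded as \<open>T\<close> shrinks; over the whole interval it contributes only
    \<open>T R\<close>.\<close>
  define R where "R = 1/2 * (L + norm P)\<^sup>2"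
  define h where "h = H_stat \<Xi> \<mu> P"
  \<comment> \<open>Makes \<open>T (R + \<bar>M - h\<bar>)\<close> smaller than
    \<open>\<kappa> / 2\<close>; the added 1 keeps the denominator positive.\<close>
  define T0 where "T0 = \<kappa> / (2 * (R + (\<bar>M - h\<bar> + 1)))"
  have pos: "0 < R + (\<bar>M - h\<bar> + 1)" by (intro add_nonneg_pos) (auto simp: R_def)
  show thesis
  proof (rule that[of T0])
    show "0 < T0" using pos \<kappa> by (simp add: T0_def)
    fix T assume T: "0 < T" "T < T0"
    have T\<kappa>: "T * (R + \<bar>M - h\<bar>) < \<kappa> / 2"
    proof -
      have "T * (R + \<bar>M - h\<bar>) \<le> T * (R + (\<bar>M - h\<bar> + 1))" using T by (intro mult_left_mono) auto
      also have "\<dots> < T0 * (R + (\<bar>M - h\<bar> + 1))" using T pos by (intro mult_strict_right_mono)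
      also have "\<dots> = \<kappa> / 2" using pos by (simp add: T0_def field_simps)
      finally show ?thesis .
    qed
    show "H_dyn \<Xi> T \<mu> P \<le> ereal (H_stat \<Xi> \<mu> P + \<kappa>)"
      unfolding H_dyn_def h_def[symmetric]
    proof (rule SUP_least, rule ccontr)
      fix m assume m: "m \<in> loops T \<mu>"
        and "\<not> ereal (1 / T * (LBINT t:{0..T}. \<integral>x. \<Xi> x \<partial>m t)) + F_dyn m P T \<le> ereal (h + \<kappa>)"
      then have v: "ereal (h + \<kappa>) < ereal (1 / T * (LBINT t:{0..T}. \<integral>x. \<Xi> x \<partial>m t)) + F_dyn m P T" by simp
      define J where "J g = integral {0..T} (\<lambda>t. \<integral>x. g x \<partial>m t)" for g :: "'n torus \<Rightarrow> real"
      have w: "weak_curve 0 T m" "m 0 = \<mu>" "m T = \<mu>" using m by (auto simp: loops_iff[OF \<Xi> M])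
      have mt: "m t \<in> torus_probs" if "t \<in> {0..T}" for t using weak_curve_probs[OF w(1) that] .
      have Jint: "(\<lambda>t. \<integral>x. g x \<partial>m t) integrable_on {0..T}" if "continuous_on UNIV g" for g :: "'n torus \<Rightarrow> real"
        using w(1) that by (intro integrable_continuous_real) (simp add: weak_curve_def)
      define c where "c = T * (h + \<kappa>) - J \<Xi>"
      have A: "action_ge P 0 T m c"
        unfolding c_def J_def by (rule loop_value_lessD(1)[OF \<Xi> M m T(1) v])
      have "J \<Xi> \<le> T * M" using integral_curve_bounds[OF w(1) \<Xi> M] T by (simp add: J_def abs_le_iff)
      \<comment> \<open>If \<open>c\<close> is negative, then only by an amount of order
        \<open>T\<close>, because the \<open>\<Xi>\<close> part of the value is at most
        \<open>T M\<close>.\<close>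
      have "c \<ge> - (T * \<bar>M - h\<bar>)"
      proof -
        have "T * (M - h) \<le> T * \<bar>M - h\<bar>" using T by (intro mult_left_mono) auto
        moreover have "0 \<le> T * \<kappa>" using T \<kappa> by simp
        ultimately show ?thesis using \<open>J \<Xi> \<le> T * M\<close> unfolding c_def by (simp add: algebra_simps)
      qed
      \<comment> \<open>For a stationary test function the boundary terms cancel, because the curve
        is a loop.\<close>
      have "c \<le> J u"
        using A[unfolded action_ge_def, rule_format, OF spacetime_C1_stationary[OF has_torus_gradient_torus_gradient[OF \<psi>(1)] c\<psi>]]
        by (simp add: w u_def[abs_def] J_def)
      then have "T * (h + \<kappa>) \<le> J \<Xi> + J u" by (simp add: c_def)
      also have "\<dots> = integral {0..T} (\<lambda>t. (\<integral>x. \<Xi> x \<partial>m t) + (\<integral>x. u x \<partial>m t))"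
        unfolding J_def by (rule Henstock_Kurzweil_Integration.integral_add[symmetric, OF Jint[OF \<Xi>] Jint[OF u]])
      also have "\<dots> \<le> integral {0..T} (\<lambda>t. (\<integral>x. f x \<partial>m t) + \<kappa> / 8)"
      proof (rule integral_le)
        fix t assume t: "t \<in> {0..T}"
        have "(\<integral>x. \<Xi> x \<partial>m t) + (\<integral>x. u x \<partial>m t) = (\<integral>x. \<Xi> x + u x \<partial>m t)"
          using integrable_torus[OF mt[OF t]] \<Xi> u by simp
        also have "\<dots> \<le> (\<integral>x. f x + \<kappa> / 8 \<partial>m t)"
        proof (rule integral_torus_mono[OF mt[OF t]])
          show "\<Xi> x + u x \<le> f x + \<kappa> / 8" for x using f(2)[of x] by linarith
        qed (intro continuous_intros \<Xi> u cf)+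
        also have "\<dots> = (\<integral>x. f x \<partial>m t) + \<kappa> / 8"
          using integrable_torus[OF mt[OF t] cf] integrable_torus[OF mt[OF t] continuous_on_const] mt[OF t] by simp
        finally show "(\<integral>x. \<Xi> x \<partial>m t) + (\<integral>x. u x \<partial>m t) \<le> (\<integral>x. f x \<partial>m t) + \<kappa> / 8" .
      qed (intro integrable_add Jint \<Xi> u cf integrable_const_ivl)+
      also have "\<dots> = J f + T * (\<kappa> / 8)"
        using Henstock_Kurzweil_Integration.integral_add[OF Jint[OF cf] integrable_const_ivl] T by (simp add: J_def)
      finally have up: "T * (h + \<kappa>) \<le> J f + T * (\<kappa> / 8)" .
      \<comment> \<open>The test function is 0 at time 0 and \<open>- f\<close> at time
        \<open>T\<close>. Its boundary term is minus the integral of \<open>f\<close> against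
        \<open>\<mu>\<close>, and its time derivative yields \<open>- J f / T\<close>; the remaining
        terms are of order \<open>T\<close>.\<close>
      have Jf: "J f \<le> T * (\<integral>x. f x \<partial>\<mu>) + T * (T * (R + \<bar>M - h\<bar>))"
      proof -
        have C1: "spacetime_C1 (\<lambda>x t. (- t / T) * f x) (\<lambda>x t. (- t / T) *\<^sub>R torus_gradient f x)
            (\<lambda>x t. (- 1 / T) * f x + (- t / T) * 0)"
          by (rule spacetime_C1_mult_time[OF spacetime_C1_stationary[OF Df cgf]])
             (use T in \<open>auto intro!: derivative_eq_intros continuous_intros\<close>)
        from A[unfolded action_ge_def, rule_format, OF C1]
        have "- (\<integral>x. f x \<partial>\<mu>) + c \<le> integral {0..T} (\<lambda>t. \<integral>x. (- 1 / T) * f x + (- t / T) * 0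
            + 1/2 * (norm ((- t / T) *\<^sub>R torus_gradient f x + P))\<^sup>2 \<partial>m t)"
          using T by (simp add: w)
        also have "\<dots> \<le> integral {0..T} (\<lambda>t. (- 1 / T) * (\<integral>x. f x \<partial>m t) + R)"
        proof (rule integral_le)
          show "(\<lambda>t. \<integral>x. (- 1 / T) * f x + (- t / T) * 0
            + 1/2 * (norm ((- t / T) *\<^sub>R torus_gradient f x + P))\<^sup>2 \<partial>m t) integrable_on {0..T}"
            by (intro integrable_on_curve[OF w(1)] spacetime_C1_integrand_continuous[OF C1])
          show "(\<lambda>t. (- 1 / T) * (\<integral>x. f x \<partial>m t) + R) integrable_on {0..T}"
            using integrable_cmul[OF Jint[OF cf], of "- 1 / T"] by (intro integrable_add integrable_const_ivl) simp
          fix t assume t: "t \<in> {0..T}"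
          have "(\<integral>x. (- 1 / T) * f x + (- t / T) * 0 + 1/2 * (norm ((- t / T) *\<^sub>R torus_gradient f x + P))\<^sup>2 \<partial>m t)
            \<le> (\<integral>x. (- 1 / T) * f x + R \<partial>m t)"
          proof (rule integral_torus_mono[OF mt[OF t] continuous_on_slice[OF spacetime_C1_integrand_continuous[OF C1]]])
            fix x
            have "norm ((- t / T) *\<^sub>R torus_gradient f x + P) \<le> norm ((- t / T) *\<^sub>R torus_gradient f x) + norm P"
              by (rule norm_triangle_ineq)
            also have "norm ((- t / T) *\<^sub>R torus_gradient f x) \<le> 1 * L"
              unfolding norm_scaleR using t T L(2)[of x] by (intro mult_mono) (auto simp: field_simps)
            finally have "(norm ((- t / T) *\<^sub>R torus_gradient f x + P))\<^sup>2 \<le> (L + norm P)\<^sup>2"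
              by (intro power_mono) simp_all
            then show "(- 1 / T) * f x + (- t / T) * 0 + 1/2 * (norm ((- t / T) *\<^sub>R torus_gradient f x + P))\<^sup>2 \<le> (- 1 / T) * f x + R"
              unfolding R_def by linarith
          qed (intro continuous_intros cf)
          also have "\<dots> = (- 1 / T) * (\<integral>x. f x \<partial>m t) + R"
            using integrable_torus[OF mt[OF t] cf] integrable_torus[OF mt[OF t] continuous_on_const] mt[OF t] by simp
          finally show "(\<integral>x. (- 1 / T) * f x + (- t / T) * 0 + 1/2 * (norm ((- t / T) *\<^sub>R torus_gradient f x + P))\<^sup>2 \<partial>m t)
             \<le> (- 1 / T) * (\<integral>x. f x \<partial>m t) + R" .
        qed
        also have "\<dots> = (- 1 / T) * J f + T * R"
          using Henstock_Kurzweil_Integration.integral_add[OF integrable_cmul[OF Jint[OF cf], of "- 1 / T"] integrable_const_ivl] T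
          by (simp add: J_def)
        finally have "J f / T \<le> (\<integral>x. f x \<partial>\<mu>) + (T * R - c)" by simp
        also have "T * R - c \<le> T * (R + \<bar>M - h\<bar>)" using \<open>c \<ge> - (T * \<bar>M - h\<bar>)\<close> by (simp add: distrib_left)
        finally have "J f / T \<le> (\<integral>x. f x \<partial>\<mu>) + T * (R + \<bar>M - h\<bar>)" by simp
        then show ?thesis using T by (simp add: pos_divide_le_eq distrib_left mult.commute)
      qed
      have "(\<integral>x. f x \<partial>\<mu>) \<le> (\<integral>x. \<Xi> x + u x + \<kappa> / 8 \<partial>\<mu>)"
      proof (rule integral_torus_mono[OF \<mu> cf])
        show "f x \<le> \<Xi> x + u x + \<kappa> / 8" for x using f(2)[of x] by linarith
      qed (intro continuous_intros \<Xi> u)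
      also have "\<dots> = (\<integral>x. \<Xi> x \<partial>\<mu>) + (\<integral>x. u x \<partial>\<mu>) + \<kappa> / 8"
        using integrable_torus[OF \<mu> \<Xi>] integrable_torus[OF \<mu> u] integrable_torus[OF \<mu> continuous_on_const] \<mu> by simp
      also have "\<dots> < h + \<kappa> / 4 + \<kappa> / 8" using \<psi>(2) by (simp add: h_def H_stat_def u_def)
      finally have "T * (\<integral>x. f x \<partial>\<mu>) < T * (h + \<kappa> / 4 + \<kappa> / 8)" using T by simp
      moreover have "T * (T * (R + \<bar>M - h\<bar>)) < T * (\<kappa> / 2)" by (rule mult_strict_left_mono[OF T\<kappa> T(1)])
      \<comment> \<open>The tolerances \<open>\<kappa> / 8\<close> and \<open>\<kappa> / 8\<close>
        for the two uses of \<open>f\<close>, \<open>\<kappa> / 4\<close> for \<open>\<psi>\<close>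
        and \<open>\<kappa> / 2\<close> for small \<open>T\<close> add up to
        \<open>\<kappa>\<close>, with strict inequality.\<close>
      ultimately show False using up Jf by (simp add: algebra_simps)
    qed
  qed
qed

text \<open>The finiteness clause makes continuity into the extended reals mean continuity of a real
  functional.\<close>

theorem theorem4p4:
  fixes \<Xi> :: "'n::finite torus \<Rightarrow> real"
  assumes "continuous_on UNIV \<Xi>"
  shows "(\<forall>T>0. \<forall>P :: real ^ 'n.
            (\<forall>\<mu>\<in>torus_probs. \<bar>H_dyn \<Xi> T \<mu> P\<bar> \<noteq> \<infinity>) \<and>
            continuous_map weak_star euclidean (\<lambda>\<mu>. H_dyn \<Xi> T \<mu> P)) \<and>
         (\<forall>\<mu>\<in>torus_probs. \<forall>P :: real ^ 'n.
            ((\<lambda>T. H_dyn \<Xi> T \<mu> P) \<longlongrightarrow> ereal (H_stat \<Xi> \<mu> P)) (at_right 0))"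
proof (intro conjI allI impI ballI)
  obtain M where M: "\<And>x. \<bar>\<Xi> x\<bar> \<le> M" using continuous_on_torus_bounded[OF assms] by (metis real_norm_def)
  fix T :: real and P :: "real ^ 'n" assume T: "0 < T"
  show fin: "\<bar>H_dyn \<Xi> T \<mu> P\<bar> \<noteq> \<infinity>" if "\<mu> \<in> torus_probs" for \<mu>
    using H_stat_le_H_dyn[OF assms M that T, of P] H_dyn_le[OF assms M T, of \<mu> P] by auto
  \<comment> \<open>Continuity is proved for the real version, where distances are available, and
    carried back through \<open>ereal\<close>.\<close>
  define H where "H \<mu> = real_of_ereal (H_dyn \<Xi> T \<mu> P)" for \<mu>
  have H: "H_dyn \<Xi> T \<mu> P = ereal (H \<mu>)" if "\<mu> \<in> torus_probs" for \<mu>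
    using fin[OF that] by (simp add: H_def ereal_real')
  have "continuous_map weak_star euclidean H"
  proof (rule continuous_map_atin[THEN iffD2], intro ballI)
    fix \<mu> :: "'n torus measure" assume "\<mu> \<in> topspace weak_star"
    then have \<mu>: "\<mu> \<in> torus_probs" by (simp add: topspace_weak_star)
    show "limitin euclidean H (H \<mu>) (atin weak_star \<mu>)"
      unfolding limitin_canonical_iff tendsto_iff
    proof (intro allI impI)
      fix \<kappa> :: real assume "0 < \<kappa>"
      then have "0 < \<kappa> / 2" by simp
      obtain e where e: "0 < e"
        "\<And>\<mu> \<nu>. \<nu> \<in> torus_probs \<Longrightarrow> coupled e \<mu> \<nu> \<Longrightarrow> H_dyn \<Xi> T \<mu> P \<le> H_dyn \<Xi> T \<nu> P + ereal (\<kappa> / 2)"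
        by (rule H_dyn_coupled[OF assms M T \<open>0 < \<kappa> / 2\<close>, of P]) (rule that)
      obtain U where U: "openin weak_star U" "\<mu> \<in> U" "\<And>\<nu>. \<nu> \<in> U \<Longrightarrow> coupled e \<mu> \<nu>"
        using coupled_neighbourhood[OF \<mu> e(1)] by metis
      have "dist (H \<nu>) (H \<mu>) < \<kappa>" if "\<nu> \<in> U" for \<nu>
      proof -
        have \<nu>: "\<nu> \<in> torus_probs" using openin_subset[OF U(1)] that by (auto simp: topspace_weak_star)
        \<comment> \<open>The same \<open>e\<close> serves both base measures, so reversing the
          coupling gives the second inequality.\<close>
        have "H \<mu> \<le> H \<nu> + \<kappa> / 2" "H \<nu> \<le> H \<mu> + \<kappa> / 2"
          using e(2)[OF \<nu> U(3)[OF that]] e(2)[OF \<mu> coupled_commute[OF U(3)[OF that]]] by (simp_all add: H \<mu> \<nu>)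
        then show ?thesis using \<open>0 < \<kappa>\<close> unfolding dist_real_def by linarith
      qed
      then show "\<forall>\<^sub>F \<nu> in atin weak_star \<mu>. dist (H \<nu>) (H \<mu>) < \<kappa>"
        unfolding eventually_atin using U by blast
    qed
  qed
  then have "continuous_map weak_star euclidean (ereal \<circ> H)"
    by (rule continuous_map_compose) (simp add: continuous_on_ereal continuous_on_id)
  then show "continuous_map weak_star euclidean (\<lambda>\<mu>. H_dyn \<Xi> T \<mu> P)"
    by (rule continuous_map_eq) (simp add: H topspace_weak_star)
next
  obtain M where M: "\<And>x. \<bar>\<Xi> x\<bar> \<le> M" using continuous_on_torus_bounded[OF assms] by (metis real_norm_def)
  fix \<mu> :: "'n torus measure" and P :: "real ^ 'n" assume \<mu>: "\<mu> \<in> torus_probs"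
  show "((\<lambda>T. H_dyn \<Xi> T \<mu> P) \<longlongrightarrow> ereal (H_stat \<Xi> \<mu> P)) (at_right 0)"
  proof (rule order_tendstoI)
    fix l assume "l < ereal (H_stat \<Xi> \<mu> P)"
    then have "l < H_dyn \<Xi> T \<mu> P" if "0 < T" for T
      using H_stat_le_H_dyn[OF assms M \<mu> that, of P] by (rule less_le_trans)
    then show "\<forall>\<^sub>F T in at_right 0. l < H_dyn \<Xi> T \<mu> P"
      by (simp add: eventually_at_right_less eventually_mono[OF eventually_at_right_less])
  next
    fix l assume "ereal (H_stat \<Xi> \<mu> P) < l"
    then obtain r where r: "H_stat \<Xi> \<mu> P < r" "ereal r < l" using ereal_dense2 by (metis ereal_less(2) less_ereal.simps(1))
    obtain T0 where T0: "0 < T0" "\<And>T. 0 < T \<Longrightarrow> T < T0 \<Longrightarrow> H_dyn \<Xi> T \<mu> P \<le> ereal (H_stat \<Xi> \<mu> P + (r - H_stat \<Xi> \<mu> P))"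
      using H_dyn_upper[OF assms \<mu>, of "r - H_stat \<Xi> \<mu> P" P] r by auto
    have "H_dyn \<Xi> T \<mu> P < l" if "0 < T" "T < T0" for T
      using T0(2)[OF that] r(2) by (simp add: order_le_less_trans)
    then show "\<forall>\<^sub>F T in at_right 0. H_dyn \<Xi> T \<mu> P < l"
      using T0(1) unfolding eventually_at_right_field by blast
  qed
qed

end
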